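(* Let $\phi_*$ be a simple rational skew product, and $\zeta \in \mathbb{P}^1_{an}$. Then $\mathfrak m(\phi_*(\zeta)) \mid \mathfrak m(\zeta)$. Hence $\phi_*(\mathcal T_m) \subseteq \mathcal T_m$ for any $m \in \mathbb N_+$.
   Context: $k$ is an algebraically closed field of characteristic $0$; $\mathbb{K}=\bigcup_{n\ge 1}k((x^{1/n}))$ is the field of Puiseux series with its $x$-adic absolute value ($0<|x|<1$ fixed), $\hat{\mathbb K}$ its completion, and $\mathbb{P}^1_{an}=\mathbb{P}^1_{an}(\hat{\mathbb K})$ the Berkovich projective line with coordinate $y$; write $\|\cdot\|_\zeta$ for the seminorm $\zeta$. $G=\mathrm{Gal}(\mathbb K/k((x)))$ acts by isometries on $\hat{\mathbb K}$ (the element attached to a compatible system $\omega=(\omega_n)$ of roots of unity sends $x^{m/n}\mapsto\omega_n^m x^{m/n}$), hence on $\hat{\mathbb K}(y)$ fixing $y$, and on $\mathbb{P}^1_{an}$. The multiplicity $\mathfrak m(\zeta)\in\mathbb N_+\cup\{\infty\}$ is the cardinality of the $G$-orbit of $\zeta$; every positive integer (and $\infty$) divides $\infty$. $\mathcal T_m=\{\zeta\in\mathbb P^1_{an}:\mathfrak m(\zeta)\mid m\}$. A $k$-rational skew endomorphism is a $k$-algebra endomorphism $\phi^*$ of $k((x))(y)$ with $\phi^*(x)=\phi_1(x)=\lambda x^n+O(x^{n+1})\in k((x))$ ($n\in\mathbb N_+$, $\lambda\in k^\times$) and $\phi^*(y)=\phi_2\in k((x))(y)$. It is extended to $\hat{\mathbb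 K}(y)$ by writing $\phi_1(x)=\lambda x^n(1+h(x))$, choosing a compatible sequence of roots $(\lambda_b)_{b\ge1}$ ($\lambda_1=\lambda$, $\lambda_{bc}^c=\lambda_b$), and sending $x^{a/b}\mapsto\lambda_b^a x^{na/b}(1+h(x))^{a/b}$ (binomial series), extended continuously. The induced ($k$-)rational skew product $\phi_*:\mathbb P^1_{an}\to\mathbb P^1_{an}$ is defined by $\|f\|_{\phi_*(\zeta)}=\|\phi^*(f)\|_\zeta^{1/n}$; its scale factor is $1/n$, and it is *simple* if $n=1$. *)

theory Defs
  imports "HOL-Analysis.Analysis" "HOL-Computational_Algebra.Computational_Algebra" "HOL-Library.Extended_Nat"
begin

section \<open>The completed field of Puiseux series\<close>

text \<open>
  The completion of the field of Puiseux series over \<open>k\<close> is realised as the field of formal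
  series \<open>\<Sum> a\<^sub>q x\<^sup>q\<close> with rational exponents whose support is left-finite, i.e. has
  only finitely many elements below any given bound. That this is the completion is the content of
  \<open>mcomplete_cpuiseux\<close> and \<open>puiseux_dense\<close> below.
\<close>

definition left_finite :: "(rat \<Rightarrow> 'a::zero) \<Rightarrow> bool" where
  "left_finite f \<longleftrightarrow> (\<forall>N. finite {q. q \<le> N \<and> f q \<noteq> 0})"

typedef (overloaded) ('a::zero) cpuiseux = "{f :: rat \<Rightarrow> 'a. left_finite f}"
  morphisms cp_nth Abs_cpuiseux
  by (rule exI[of _ "\<lambda>_. 0"]) (simp add: left_finite_def)

setup_lifting type_definition_cpuiseux

lemma cp_eqI: "(\<And>q. cp_nth a q = cp_nth b q) \<Longrightarrow> a = b"
  by (simp add: cp_nth_inject[symmetric] fun_eq_iff)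

lemma cp_finite: "finite {q. q \<le> N \<and> cp_nth a q \<noteq> 0}"
  using cp_nth[of a] by (auto simp: left_finite_def)

lemma cp_lower_bound: obtains l where "\<And>q. cp_nth a q \<noteq> 0 \<Longrightarrow> l \<le> q"
proof -
  let ?S = "{q. q \<le> 0 \<and> cp_nth a q \<noteq> 0}"
  have "Min (insert 0 ?S) \<le> q" if "cp_nth a q \<noteq> 0" for q
  proof (cases "q \<le> 0")
    case True
    then show ?thesis using that cp_finite[of 0 a] by (intro Min_le) auto
  next
    case False
    have "Min (insert 0 ?S) \<le> 0" using cp_finite[of 0 a] by (intro Min_le) auto
    then show ?thesis using False by linarith
  qed
  then show thesis using that by blast
qed

lift_definition cp_monom :: "'a::zero \<Rightarrow> rat \<Rightarrow> 'a cpuiseux"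
  is "\<lambda>c q p. if p = q then c else 0"
  by (auto simp: left_finite_def intro!: finite_subset[of _ "{_}"])

definition cp_const :: "'a::zero \<Rightarrow> 'a cpuiseux" where
  "cp_const c = cp_monom c 0"

instantiation cpuiseux :: (comm_monoid_add) comm_monoid_add
begin
lift_definition zero_cpuiseux :: "'a cpuiseux" is "\<lambda>_. 0"
  by (simp add: left_finite_def)
lift_definition plus_cpuiseux :: "'a cpuiseux \<Rightarrow> 'a cpuiseux \<Rightarrow> 'a cpuiseux"
  is "\<lambda>f g q. f q + g q"
proof -
  fix f g :: "rat \<Rightarrow> 'a" assume *: "left_finite f" "left_finite g"
  show "left_finite (\<lambda>q. f q + g q)"
    unfolding left_finite_def
  proof
    fix N
    have "{q. q \<le> N \<and> f q + g q \<noteq> 0} \<subseteq> {q. q \<le> N \<and> f q \<noteq> 0} \<union> {q. q \<le> N \<and> g q \<noteq> 0}"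
      by auto
    then show "finite {q. q \<le> N \<and> f q + g q \<noteq> 0}"
      using * unfolding left_finite_def by (meson finite_UnI finite_subset)
  qed
qed
instance
  by standard (transfer; simp add: ac_simps)+
end

instantiation cpuiseux :: (ab_group_add) ab_group_add
begin
lift_definition uminus_cpuiseux :: "'a cpuiseux \<Rightarrow> 'a cpuiseux" is "\<lambda>f q. - f q"
  by (simp add: left_finite_def)
definition minus_cpuiseux :: "'a cpuiseux \<Rightarrow> 'a cpuiseux \<Rightarrow> 'a cpuiseux" where
  "minus_cpuiseux a b = a + - b"
instance
  by standard (transfer, simp, simp only: minus_cpuiseux_def)
end

lemma cp_nth_0 [simp]: "cp_nth 0 q = 0" by transfer simp
lemma cp_nth_add [simp]: "cp_nth (a + b) q = cp_nth a q + cp_nth b q" by transfer simp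
lemma cp_nth_uminus [simp]: "cp_nth (- a) q = - cp_nth a q" by transfer simp
lemma cp_nth_diff [simp]: "cp_nth (a - b) q = cp_nth a q - cp_nth b q"
  by (subst minus_cpuiseux_def, subst cp_nth_add, subst cp_nth_uminus, rule add_uminus_conv_diff)
lemma cp_nth_monom: "cp_nth (cp_monom c q) p = (if p = q then c else 0)"
  by transfer simp

lemma cp_nth_sum: "cp_nth (sum f A) q = (\<Sum>i\<in>A. cp_nth (f i) q)"
  by (induction A rule: infinite_finite_induct) auto

instantiation cpuiseux :: (comm_ring_1) comm_ring_1
begin

definition one_cpuiseux :: "'a cpuiseux" where "one_cpuiseux = cp_monom 1 0"

lift_definition times_cpuiseux :: "'a cpuiseux \<Rightarrow> 'a cpuiseux \<Rightarrow> 'a cpuiseux"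
  is "\<lambda>f g q. \<Sum>p\<in>{p. f p \<noteq> 0 \<and> g (q - p) \<noteq> 0}. f p * g (q - p)"
proof -
  fix f g :: "rat \<Rightarrow> 'a" assume *: "left_finite f" "left_finite g"
  obtain l where l: "\<And>q. f q \<noteq> 0 \<Longrightarrow> l \<le> q"
    using cp_lower_bound[of "Abs_cpuiseux f"] * by (auto simp: Abs_cpuiseux_inverse)
  obtain m where m: "\<And>q. g q \<noteq> 0 \<Longrightarrow> m \<le> q"
    using cp_lower_bound[of "Abs_cpuiseux g"] * by (auto simp: Abs_cpuiseux_inverse)
  show "left_finite (\<lambda>q. \<Sum>p\<in>{p. f p \<noteq> 0 \<and> g (q - p) \<noteq> 0}. f p * g (q - p))"
    unfolding left_finite_def
  proof
    fix N
    let ?F = "{p. p \<le> N - m \<and> f p \<noteq> 0}" and ?G = "{p. p \<le> N - l \<and> g p \<noteq> 0}"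
    have "{q. q \<le> N \<and> (\<Sum>p\<in>{p. f p \<noteq> 0 \<and> g (q - p) \<noteq> 0}. f p * g (q - p)) \<noteq> 0}
          \<subseteq> (\<lambda>(s, t). s + t) ` (?F \<times> ?G)"
    proof
      fix q assume q: "q \<in> {q. q \<le> N \<and> (\<Sum>p\<in>{p. f p \<noteq> 0 \<and> g (q - p) \<noteq> 0}. f p * g (q - p)) \<noteq> 0}"
      then obtain p where p: "f p \<noteq> 0" "g (q - p) \<noteq> 0"
        using sum.neutral by force
      have "p \<in> ?F" "q - p \<in> ?G" using p l[of p] m[of "q - p"] q by auto
      then show "q \<in> (\<lambda>(s, t). s + t) ` (?F \<times> ?G)"
        by (intro image_eqI[of _ _ "(p, q - p)"]) auto
    qed
    moreover have "finite (?F \<times> ?G)" using * by (simp add: left_finite_def)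
    ultimately show "finite {q. q \<le> N \<and> (\<Sum>p\<in>{p. f p \<noteq> 0 \<and> g (q - p) \<noteq> 0}. f p * g (q - p)) \<noteq> 0}"
      by (meson finite_imageI finite_subset)
  qed
qed

lemma cp_conv_finite:
  "finite {p. cp_nth a p \<noteq> 0 \<and> cp_nth b (q - p) \<noteq> 0}"
proof -
  obtain m where m: "\<And>q. cp_nth b q \<noteq> 0 \<Longrightarrow> m \<le> q" using cp_lower_bound[of b] by blast
  show ?thesis
    by (rule finite_subset[OF _ cp_finite[of "q - m" a]]) (use m in force)
qed

lemma cp_nth_mult_superset:
  assumes "finite A" "{p. cp_nth a p \<noteq> 0 \<and> cp_nth b (q - p) \<noteq> 0} \<subseteq> A"
  shows "cp_nth (a * b) q = (\<Sum>p\<in>A. cp_nth a p * cp_nth b (q - p))"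
  unfolding times_cpuiseux.rep_eq
  by (rule sum.mono_neutral_left) (use assms in auto)

lemma cp_mult_commute: "a * b = b * (a :: 'a cpuiseux)"
proof (rule cp_eqI)
  fix q
  show "cp_nth (a * b) q = cp_nth (b * a) q"
    unfolding times_cpuiseux.rep_eq
    by (rule sum.reindex_bij_witness[of _ "\<lambda>p. q - p" "\<lambda>p. q - p"]) (auto simp: mult.commute)
qed

lemma cp_mult_assoc: "a * b * c = a * (b * (c :: 'a cpuiseux))"
proof (rule cp_eqI)
  fix q
  obtain la where la: "\<And>q. cp_nth a q \<noteq> 0 \<Longrightarrow> la \<le> q" using cp_lower_bound[of a] by blast
  obtain lb where lb: "\<And>q. cp_nth b q \<noteq> 0 \<Longrightarrow> lb \<le> q" using cp_lower_bound[of b] by blast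
  obtain lc where lc: "\<And>q. cp_nth c q \<noteq> 0 \<Longrightarrow> lc \<le> q" using cp_lower_bound[of c] by blast
  define SA where "SA = {p. p \<le> q - lb - lc \<and> cp_nth a p \<noteq> 0}"
  define SB where "SB = {p. p \<le> q - la - lc \<and> cp_nth b p \<noteq> 0}"
  define P where "P = (\<lambda>(s, t). s + t) ` (SA \<times> SB)"
  have fin: "finite SA" "finite SB" "finite P"
    unfolding P_def SA_def SB_def by (auto intro: cp_finite)
  have ab: "cp_nth (a * b) p = (\<Sum>s\<in>SA. cp_nth a s * cp_nth b (p - s))" if "cp_nth c (q - p) \<noteq> 0" for p
    by (rule cp_nth_mult_superset) (use fin lb lc[OF that] in \<open>force simp: SA_def\<close>)+
  have "cp_nth (a * b * c) q = (\<Sum>p\<in>P. cp_nth (a * b) p * cp_nth c (q - p))"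
  proof (rule cp_nth_mult_superset)
    show "{p. cp_nth (a * b) p \<noteq> 0 \<and> cp_nth c (q - p) \<noteq> 0} \<subseteq> P"
    proof safe
      fix p assume p: "cp_nth (a * b) p \<noteq> 0" "cp_nth c (q - p) \<noteq> 0"
      then obtain s where s: "s \<in> SA" "cp_nth b (p - s) \<noteq> 0"
        unfolding ab[OF p(2)] using sum.neutral by force
      have "p - s \<in> SB" using s la[of s] lc[OF p(2)] by (auto simp: SA_def SB_def)
      then show "p \<in> P" unfolding P_def using s by (intro image_eqI[of _ _ "(s, p - s)"]) auto
    qed
  qed (fact fin)
  also have "\<dots> = (\<Sum>p\<in>P. (\<Sum>s\<in>SA. cp_nth a s * cp_nth b (p - s)) * cp_nth c (q - p))"
  proof (rule sum.cong[OF refl])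
    fix p show "cp_nth (a * b) p * cp_nth c (q - p)
        = (\<Sum>s\<in>SA. cp_nth a s * cp_nth b (p - s)) * cp_nth c (q - p)"
      by (cases "cp_nth c (q - p) = 0") (simp_all add: ab)
  qed
  also have "\<dots> = (\<Sum>s\<in>SA. \<Sum>p\<in>P. cp_nth a s * (cp_nth b (p - s) * cp_nth c (q - p)))"
    by (subst sum.swap) (simp add: sum_distrib_right mult.assoc)
  also have "\<dots> = (\<Sum>s\<in>SA. cp_nth a s * cp_nth (b * c) (q - s))"
  proof (rule sum.cong[OF refl])
    fix s assume s: "s \<in> SA"
    have "cp_nth (b * c) (q - s) = (\<Sum>t\<in>(\<lambda>p. p - s) ` P. cp_nth b t * cp_nth c (q - s - t))"
    proof (rule cp_nth_mult_superset)
      show "{p. cp_nth b p \<noteq> 0 \<and> cp_nth c (q - s - p) \<noteq> 0} \<subseteq> (\<lambda>p. p - s) ` P"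
      proof safe
        fix t assume t: "cp_nth b t \<noteq> 0" "cp_nth c (q - s - t) \<noteq> 0"
        have "t \<in> SB" using t(1) lc[OF t(2)] la[of s] s by (auto simp: SB_def SA_def)
        then have "s + t \<in> P" unfolding P_def using s by (intro image_eqI[of _ _ "(s, t)"]) auto
        then show "t \<in> (\<lambda>p. p - s) ` P" by (intro image_eqI[of _ _ "s + t"]) auto
      qed
    qed (use fin in simp)
    also have "\<dots> = (\<Sum>p\<in>P. cp_nth b (p - s) * cp_nth c (q - p))"
      by (subst sum.reindex) (auto simp: inj_on_def algebra_simps)
    finally show "(\<Sum>p\<in>P. cp_nth a s * (cp_nth b (p - s) * cp_nth c (q - p)))
        = cp_nth a s * cp_nth (b * c) (q - s)"
      by (simp add: sum_distrib_left)
  qed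
  also have "\<dots> = cp_nth (a * (b * c)) q"
  proof (rule cp_nth_mult_superset[symmetric])
    show "{p. cp_nth a p \<noteq> 0 \<and> cp_nth (b * c) (q - p) \<noteq> 0} \<subseteq> SA"
    proof safe
      fix p assume p: "cp_nth a p \<noteq> 0" "cp_nth (b * c) (q - p) \<noteq> 0"
      then obtain t where "cp_nth b t \<noteq> 0" "cp_nth c (q - p - t) \<noteq> 0"
        unfolding times_cpuiseux.rep_eq using sum.neutral by force
      then show "p \<in> SA" using p lb[of t] lc[of "q - p - t"] by (auto simp: SA_def)
    qed
  qed (fact fin)
  finally show "cp_nth (a * b * c) q = cp_nth (a * (b * c)) q" .
qed

lemma cp_one_mult: "1 * a = (a :: 'a cpuiseux)"
proof (rule cp_eqI)
  fix q
  have "cp_nth (1 * a) q = (\<Sum>p\<in>{0}. cp_nth 1 p * cp_nth a (q - p))"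
    by (rule cp_nth_mult_superset) (auto simp: one_cpuiseux_def cp_nth_monom split: if_splits)
  then show "cp_nth (1 * a) q = cp_nth a q"
    by (simp add: one_cpuiseux_def cp_nth_monom)
qed

lemma cp_distrib: "(a + b) * c = a * c + b * (c :: 'a cpuiseux)"
proof (rule cp_eqI)
  fix q
  let ?A = "{p. cp_nth a p \<noteq> 0 \<and> cp_nth c (q - p) \<noteq> 0} \<union> {p. cp_nth b p \<noteq> 0 \<and> cp_nth c (q - p) \<noteq> 0}"
  have f: "finite ?A" using cp_conv_finite by blast
  have "cp_nth ((a + b) * c) q = (\<Sum>p\<in>?A. cp_nth (a + b) p * cp_nth c (q - p))"
    by (rule cp_nth_mult_superset[OF f]) auto
  also have "\<dots> = (\<Sum>p\<in>?A. cp_nth a p * cp_nth c (q - p)) + (\<Sum>p\<in>?A. cp_nth b p * cp_nth c (q - p))"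
    by (simp add: algebra_simps sum.distrib)
  also have "\<dots> = cp_nth (a * c) q + cp_nth (b * c) q"
    by (simp add: cp_nth_mult_superset[OF f])
  finally show "cp_nth ((a + b) * c) q = cp_nth (a * c + b * c) q" by simp
qed

instance
proof
  show "(0 :: 'a cpuiseux) \<noteq> 1"
    by (metis cp_nth_0 cp_nth_monom one_cpuiseux_def zero_neq_one)
qed (rule cp_mult_assoc cp_mult_commute cp_one_mult cp_distrib)+

end

lemma cp_nth_1: "cp_nth 1 q = (if q = 0 then 1 else 0)"
  by (simp add: one_cpuiseux_def cp_nth_monom)

lemma cp_nth_monom_mult: "cp_nth (cp_monom c p * a) q = c * cp_nth a (q - p)"
proof -
  have "cp_nth (cp_monom c p * a) q = (\<Sum>s\<in>{p}. cp_nth (cp_monom c p) s * cp_nth a (q - s))"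
    by (rule cp_nth_mult_superset) (auto simp: cp_nth_monom split: if_splits)
  then show ?thesis by (simp add: cp_nth_monom)
qed

definition cp_ord :: "'a::zero cpuiseux \<Rightarrow> rat" where
  "cp_ord a = (LEAST q. cp_nth a q \<noteq> 0)"

lemma cp_ord_props:
  assumes "a \<noteq> (0 :: 'a::comm_monoid_add cpuiseux)"
  shows cp_nth_ord: "cp_nth a (cp_ord a) \<noteq> 0"
    and cp_ord_le: "cp_nth a q \<noteq> 0 \<Longrightarrow> cp_ord a \<le> q"
proof -
  obtain p where p: "cp_nth a p \<noteq> 0"
    using assms by (metis cp_eqI cp_nth_0)
  define S where "S = {q. q \<le> p \<and> cp_nth a q \<noteq> 0}"
  have S: "finite S" "p \<in> S" using p cp_finite by (auto simp: S_def)
  have 1: "cp_nth a (Min S) \<noteq> 0" using Min_in[OF S(1)] S(2) by (auto simp: S_def)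
  have 2: "Min S \<le> q" if "cp_nth a q \<noteq> 0" for q
  proof (cases "q \<le> p")
    case True
    then show ?thesis using that S by (intro Min_le) (auto simp: S_def)
  next
    case False
    then show ?thesis using Min_le[OF S] by linarith
  qed
  have "cp_ord a = Min S" unfolding cp_ord_def by (rule Least_equality) (use 1 2 in auto)
  then show "cp_nth a (cp_ord a) \<noteq> 0" "cp_nth a q \<noteq> 0 \<Longrightarrow> cp_ord a \<le> q"
    using 1 2 by auto
qed

lemma cp_nth_mult_low:
  assumes "\<And>q. cp_nth a q \<noteq> 0 \<Longrightarrow> l \<le> q" "\<And>q. cp_nth b q \<noteq> 0 \<Longrightarrow> m \<le> q"
  shows "cp_nth (a * b) (l + m) = cp_nth a l * cp_nth b m"
    and "q < l + m \<Longrightarrow> cp_nth (a * b) q = 0"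
proof -
  have "cp_nth (a * b) (l + m) = (\<Sum>p\<in>{l}. cp_nth a p * cp_nth b (l + m - p))"
    by (rule cp_nth_mult_superset) (use assms in force)+
  then show "cp_nth (a * b) (l + m) = cp_nth a l * cp_nth b m" by simp
  assume q: "q < l + m"
  have "cp_nth (a * b) q = (\<Sum>p\<in>{}. cp_nth a p * cp_nth b (q - p))"
    by (rule cp_nth_mult_superset) (use assms q in force)+
  then show "cp_nth (a * b) q = 0" by simp
qed

lemma cp_ord_mult:
  fixes a b :: "'a::idom cpuiseux"
  assumes "a \<noteq> 0" "b \<noteq> 0"
  shows "a * b \<noteq> 0" "cp_ord (a * b) = cp_ord a + cp_ord b"
proof -
  note low = cp_nth_mult_low[of a "cp_ord a" b "cp_ord b", OF cp_ord_le[OF assms(1)] cp_ord_le[OF assms(2)]]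
  have nz: "cp_nth (a * b) (cp_ord a + cp_ord b) \<noteq> 0"
    using low(1) cp_nth_ord[OF assms(1)] cp_nth_ord[OF assms(2)] by simp
  then show "a * b \<noteq> 0" by force
  show "cp_ord (a * b) = cp_ord a + cp_ord b"
    unfolding cp_ord_def[of "a * b"] by (rule Least_equality) (use nz low(2) in force)+
qed

lemma cp_inverse_exists:
  fixes a :: "'a::field cpuiseux"
  assumes "a \<noteq> 0"
  shows "\<exists>b. a * b = 1"
proof -
  define v where "v = cp_ord a"
  define c where "c = cp_nth a v"
  have c: "c \<noteq> 0" using cp_nth_ord[OF assms] by (simp add: c_def v_def)
  define u where "u = 1 - cp_monom (inverse c) (- v) * a"
  have nu: "cp_nth u q = (if q = 0 then 1 else 0) - inverse c * cp_nth a (q + v)" for q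
    by (simp add: u_def cp_nth_1 cp_nth_monom_mult)
  have upos: "q > 0" if "cp_nth u q \<noteq> 0" for q
  proof -
    have "q \<noteq> 0" using that c by (auto simp: nu c_def[symmetric])
    then have "cp_nth a (q + v) \<noteq> 0" using that by (simp add: nu)
    from cp_ord_le[OF assms this] have "v \<le> q + v" by (simp only: v_def)
    then show ?thesis using \<open>q \<noteq> 0\<close> by linarith
  qed
  obtain d where d: "d > 0" "\<And>q. cp_nth u q \<noteq> 0 \<Longrightarrow> d \<le> q"
  proof (cases "u = 0")
    case True
    then show ?thesis using that[of 1] by simp
  next
    case False
    then show ?thesis using that[of "cp_ord u"] cp_nth_ord[OF False] cp_ord_le[OF False] upos by blast
  qed
  have pw: "of_nat k * d \<le> q" if "cp_nth (u ^ k) q \<noteq> 0" for k q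
    using that
  proof (induction k arbitrary: q)
    case 0
    then show ?case by (simp add: cp_nth_1 split: if_splits)
  next
    case (Suc k)
    show ?case
    proof (rule ccontr)
      assume "\<not> ?case"
      then have "q < d + of_nat k * d" by (simp add: algebra_simps)
      then have "cp_nth (u * u ^ k) q = 0"
        using cp_nth_mult_low(2)[of u d "u ^ k" "of_nat k * d"] d(2) Suc.IH by blast
      then show False using Suc.prems by simp
    qed
  qed
  define K where "K q = nat \<lceil>q / d\<rceil> + 1" for q
  have K: "q < of_nat (K q) * d" for q
  proof -
    have "q / d < of_nat (K q)" unfolding K_def by linarith
    then show ?thesis using d(1) by (simp add: pos_divide_less_eq)
  qed
  define B where "B n = (\<Sum>k<n. u ^ k)" for n
  have Bst: "cp_nth (B n) q = cp_nth (B m) q" if "q < of_nat m * d" "m \<le> n" for n m q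
    using that(2)
  proof (induction n rule: dec_induct)
    case (step n)
    have "cp_nth (u ^ n) q = 0"
    proof (rule ccontr)
      assume "cp_nth (u ^ n) q \<noteq> 0"
      from pw[OF this] that(1) have "of_nat n * d < of_nat m * d" by linarith
      then have "(of_nat n :: rat) < of_nat m" using d(1) by (simp add: mult_less_cancel_right)
      then show False using step.hyps by simp
    qed
    then show ?case using step.IH by (simp add: B_def)
  qed simp
  have Bst': "cp_nth (B n) q = cp_nth (B m) q" if "q < of_nat m * d" "q < of_nat n * d" for n m q
    using Bst[of q m n] Bst[of q n m] that by (cases "m \<le> n") auto
  define b where "b = Abs_cpuiseux (\<lambda>q. cp_nth (B (K q)) q)"
  have "left_finite (\<lambda>q. cp_nth (B (K q)) q)"
    unfolding left_finite_def
  proof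
    fix N
    have "{q. q \<le> N \<and> cp_nth (B (K q)) q \<noteq> 0} \<subseteq> {q. q \<le> N \<and> cp_nth (B (K N)) q \<noteq> 0}"
    proof safe
      fix q assume q: "q \<le> N" "cp_nth (B (K q)) q \<noteq> 0" "cp_nth (B (K N)) q = 0"
      have "cp_nth (B (K q)) q = cp_nth (B (K N)) q"
        by (rule Bst'[OF _ K]) (rule order_le_less_trans[OF q(1) K])
      then show False using q by simp
    qed
    then show "finite {q. q \<le> N \<and> cp_nth (B (K q)) q \<noteq> 0}"
      using cp_finite finite_subset by blast
  qed
  then have nb: "cp_nth b q = cp_nth (B (K q)) q" for q
    by (simp add: b_def Abs_cpuiseux_inverse)
  have inv: "(1 - u) * b = 1"
  proof (rule cp_eqI)
    fix q
    let ?n = "K q"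
    have bq: "cp_nth b p = cp_nth (B ?n) p" if "p \<le> q" for p
      unfolding nb by (rule Bst') (use K[of p] K[of q] that in auto)
    have low: "0 \<le> p" if "cp_nth (1 - u) p \<noteq> 0" for p
      using that upos[of p] by (auto simp: cp_nth_1 split: if_splits)
    define A where "A = {p. cp_nth (1 - u) p \<noteq> 0 \<and> cp_nth b (q - p) \<noteq> 0}"
    have finA: "finite A" unfolding A_def by (rule cp_conv_finite)
    have eq: "cp_nth b (q - p) = cp_nth (B ?n) (q - p)" if "cp_nth (1 - u) p \<noteq> 0" for p
      by (rule bq) (use low[OF that] in simp)
    have "cp_nth ((1 - u) * b) q = (\<Sum>p\<in>A. cp_nth (1 - u) p * cp_nth b (q - p))"
      by (rule cp_nth_mult_superset[OF finA]) (simp add: A_def)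
    also have "\<dots> = (\<Sum>p\<in>A. cp_nth (1 - u) p * cp_nth (B ?n) (q - p))"
      by (rule sum.cong[OF refl]) (use eq in \<open>auto simp: A_def\<close>)
    also have "\<dots> = cp_nth ((1 - u) * B ?n) q"
    proof (rule cp_nth_mult_superset[OF finA, symmetric])
      show "{p. cp_nth (1 - u) p \<noteq> 0 \<and> cp_nth (B ?n) (q - p) \<noteq> 0} \<subseteq> A"
        unfolding A_def using eq by (auto simp del: cp_nth_diff)
    qed
    also have "(1 - u) * B ?n = 1 - u ^ ?n"
      by (simp add: B_def one_diff_power_eq)
    also have "cp_nth (1 - u ^ ?n) q = cp_nth 1 q"
      using pw[of ?n q] K[of q] by fastforce
    finally show "cp_nth ((1 - u) * b) q = cp_nth 1 q" .
  qed
  have "cp_monom (inverse c) (- v) * a * b = 1" using inv by (simp add: u_def)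
  then have "a * (cp_monom (inverse c) (- v) * b) = 1" by (simp add: mult_ac)
  then show ?thesis by blast
qed

instantiation cpuiseux :: (field) field
begin

definition inverse_cpuiseux :: "'a cpuiseux \<Rightarrow> 'a cpuiseux" where
  "inverse_cpuiseux a = (if a = 0 then 0 else SOME b. a * b = 1)"

definition divide_cpuiseux :: "'a cpuiseux \<Rightarrow> 'a cpuiseux \<Rightarrow> 'a cpuiseux" where
  "divide_cpuiseux a b = a * inverse b"

instance
proof
  fix a b :: "'a cpuiseux"
  show "inverse a * a = 1" if "a \<noteq> 0"
    using someI_ex[OF cp_inverse_exists[OF that]] that
    by (simp add: inverse_cpuiseux_def mult.commute)
qed (simp_all add: divide_cpuiseux_def inverse_cpuiseux_def)

end


text \<open>
  The subfield \<open>K = \<Union>\<^sub>n k((x\<^bsup>1/n\<^esup>))\<close>; supports are bounded below by left-finiteness.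
\<close>

definition puiseux :: "'a::zero cpuiseux set" where
  "puiseux = {a. \<exists>n>0. \<forall>q. cp_nth a q \<noteq> 0 \<longrightarrow> of_nat n * q \<in> \<int>}"

lift_definition cp_of_fls :: "'a::zero fls \<Rightarrow> 'a cpuiseux"
  is "\<lambda>f q. if q \<in> \<int> then fls_nth f \<lfloor>q\<rfloor> else 0"
proof -
  fix f :: "'a fls"
  show "left_finite (\<lambda>q :: rat. if q \<in> \<int> then fls_nth f \<lfloor>q\<rfloor> else 0)"
    unfolding left_finite_def
  proof
    fix N :: rat
    have "{q. q \<le> N \<and> (if q \<in> \<int> then fls_nth f \<lfloor>q\<rfloor> else 0) \<noteq> 0} \<subseteq> of_int ` {fls_subdegree f..\<lfloor>N\<rfloor>}"
    proof
      fix q assume q: "q \<in> {q. q \<le> N \<and> (if q \<in> \<int> then fls_nth f \<lfloor>q\<rfloor> else 0) \<noteq> 0}"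
      then have "q \<in> \<int>" "fls_nth f \<lfloor>q\<rfloor> \<noteq> 0" "q \<le> N" by (auto split: if_splits)
      then show "q \<in> of_int ` {fls_subdegree f..\<lfloor>N\<rfloor>}"
        by (intro image_eqI[of _ _ "\<lfloor>q\<rfloor>"]) (auto intro: fls_subdegree_leI floor_mono elim: Ints_cases)
    qed
    then show "finite {q. q \<le> N \<and> (if q \<in> \<int> then fls_nth f \<lfloor>q\<rfloor> else 0) \<noteq> 0}"
      by (rule finite_subset) simp
  qed
qed

text \<open>The absolute value normalised by \<open>\<bar>x\<bar> = r\<close>, where \<open>0 < r < 1\<close>.\<close>

definition cp_abs :: "real \<Rightarrow> 'a::comm_monoid_add cpuiseux \<Rightarrow> real" where
  "cp_abs r a = (if a = 0 then 0 else r powr of_rat (cp_ord a))"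

definition cp_dist :: "real \<Rightarrow> 'a::ab_group_add cpuiseux \<Rightarrow> 'a cpuiseux \<Rightarrow> real" where
  "cp_dist r a b = cp_abs r (a - b)"

abbreviation cp_topology :: "real \<Rightarrow> 'a::ab_group_add cpuiseux topology" where
  "cp_topology r \<equiv> Metric_space.mtopology UNIV (cp_dist r)"

lemma cp_abs_eq_0 [simp]: "0 < r \<Longrightarrow> cp_abs r a = 0 \<longleftrightarrow> a = 0"
  by (simp add: cp_abs_def)

lemma cp_abs_nonneg: "0 \<le> cp_abs r a"
  by (simp add: cp_abs_def)

lemma cp_abs_mult: "cp_abs r (a * b) = cp_abs r a * cp_abs r (b :: 'a::idom cpuiseux)"
  by (cases "a = 0 \<or> b = 0") (auto simp: cp_abs_def cp_ord_mult of_rat_add powr_add)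

lemma cp_abs_le_iff:
  assumes "0 < r" "r < 1"
  shows "cp_abs r a \<le> r powr of_rat N \<longleftrightarrow> (\<forall>q<N. cp_nth a q = 0)"
proof (cases "a = 0")
  case False
  have "cp_abs r a \<le> r powr of_rat N \<longleftrightarrow> N \<le> cp_ord a"
  proof (cases "N \<le> cp_ord a")
    case True
    then have "(of_rat N :: real) \<le> of_rat (cp_ord a)" by (simp add: of_rat_less_eq)
    then show ?thesis using assms False True by (auto simp: cp_abs_def intro!: powr_mono')
  next
    case n: False
    then have "(of_rat (cp_ord a) :: real) < of_rat N" by (simp add: of_rat_less)
    then have "r powr of_rat N < r powr of_rat (cp_ord a)"
      using assms by (intro powr_less_mono') auto
    then show ?thesis using False n by (simp add: cp_abs_def)
  qed
  also have "\<dots> \<longleftrightarrow> (\<forall>q<N. cp_nth a q = 0)"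
    using cp_nth_ord[OF False] cp_ord_le[OF False] by (meson leD leI order_less_le_trans)
  finally show ?thesis .
qed (simp add: cp_abs_def)

lemma cp_abs_triangle:
  assumes "0 < r" "r < 1"
  shows "cp_abs r (a + b :: 'a::ab_group_add cpuiseux) \<le> max (cp_abs r a) (cp_abs r b)"
proof -
  have *: "cp_abs r (a + b) \<le> cp_abs r a" if "cp_abs r b \<le> cp_abs r a" for a b :: "'a cpuiseux"
  proof (cases "a = 0")
    case True
    then show ?thesis using that assms by (simp add: cp_abs_def split: if_splits)
  next
    case False
    then have "cp_abs r a = r powr of_rat (cp_ord a)" by (simp add: cp_abs_def)
    then show ?thesis using that cp_abs_le_iff[OF assms] by (metis add.right_neutral cp_nth_add order_refl)
  qed
  show ?thesis using *[of b a] *[of a b] by (simp add: add.commute max_def)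
qed

lemma cp_Metric_space:
  assumes "0 < r" "r < 1"
  shows "Metric_space UNIV (cp_dist r :: 'a::ab_group_add cpuiseux \<Rightarrow> _)"
proof
  fix a b c :: "'a cpuiseux"
  show "0 \<le> cp_dist r a b" by (simp add: cp_dist_def cp_abs_nonneg)
  have "cp_abs r (- d) = cp_abs r d" for d :: "'a cpuiseux"
    by (auto simp: cp_abs_def cp_ord_def)
  then show "cp_dist r a b = cp_dist r b a" unfolding cp_dist_def by (metis minus_diff_eq)
  show "cp_dist r a b = 0 \<longleftrightarrow> a = b" using assms by (simp add: cp_dist_def)
  show "cp_dist r a c \<le> cp_dist r a b + cp_dist r b c"
    using cp_abs_triangle[OF assms, of "a - b" "b - c"] cp_abs_nonneg[of r "a - b"] cp_abs_nonneg[of r "b - c"]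
    by (simp add: cp_dist_def)
qed

lemma cp_small_exponent:
  assumes "0 < r" "r < (1::real)" "0 < e"
  obtains n :: nat where "r powr of_rat (of_nat n) < e"
  using real_arch_pow_inv[OF assms(3,2)] assms by (auto simp: powr_realpow)

lemma cp_abs_lessI:
  assumes "0 < r" "r < 1" "r powr of_rat N < e" "\<And>q. q < N \<Longrightarrow> cp_nth a q = 0"
  shows "cp_abs r a < e"
  using cp_abs_le_iff[OF assms(1,2), of a N] assms(3,4) by auto

lemma cp_abs_lessD:
  assumes "0 < r" "r < 1" "cp_abs r a < r powr of_rat N" "q \<le> N"
  shows "cp_nth a q = 0"
proof (rule ccontr)
  assume *: "cp_nth a q \<noteq> 0"
  then have a: "a \<noteq> 0" by auto
  from cp_ord_le[OF a *] assms(4) have "(of_rat (cp_ord a) :: real) \<le> of_rat N"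
    by (simp add: of_rat_less_eq)
  then have "r powr of_rat N \<le> r powr of_rat (cp_ord a)"
    using assms(1,2) by (intro powr_mono') auto
  then show False using assms(3) a by (simp add: cp_abs_def)
qed

lemma mcomplete_cpuiseux:
  assumes "0 < r" "r < 1"
  shows "Metric_space.mcomplete UNIV (cp_dist r :: 'a::ab_group_add cpuiseux \<Rightarrow> _)"
proof -
  interpret Metric_space UNIV "cp_dist r :: 'a cpuiseux \<Rightarrow> _" by (rule cp_Metric_space[OF assms])
  show ?thesis unfolding mcomplete_def
  proof (intro allI impI)
    fix s :: "nat \<Rightarrow> 'a cpuiseux" assume "MCauchy s"
    then have *: "\<exists>M. \<forall>n n'. M \<le> n \<longrightarrow> M \<le> n' \<longrightarrow> cp_abs r (s n - s n') < r powr of_rat N" for N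
      using assms(1) by (simp add: MCauchy_def cp_dist_def)
    define M where "M N = (SOME M. \<forall>n n'. M \<le> n \<longrightarrow> M \<le> n' \<longrightarrow> cp_abs r (s n - s n') < r powr of_rat N)" for N
    have "\<forall>n n'. M N \<le> n \<longrightarrow> M N \<le> n' \<longrightarrow> cp_abs r (s n - s n') < r powr of_rat N" for N
      unfolding M_def by (rule someI_ex[OF *])
    then have M: "cp_nth (s n) q = cp_nth (s n') q" if "M N \<le> n" "M N \<le> n'" "q \<le> N" for n n' N q
      using cp_abs_lessD[OF assms, of "s n - s n'" N q] that by simp
    define f where "f q = cp_nth (s (M q)) q" for q
    have f: "f q = cp_nth (s n) q" if "M N \<le> n" "q \<le> N" for n N q
    proof -
      have "f q = cp_nth (s (max n (M q))) q"
        unfolding f_def by (rule M[of q]) auto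
      also have "\<dots> = cp_nth (s n) q"
        by (rule M[of N]) (use that in auto)
      finally show ?thesis .
    qed
    have "left_finite f" unfolding left_finite_def
    proof
      fix N
      have "{q. q \<le> N \<and> f q \<noteq> 0} = {q. q \<le> N \<and> cp_nth (s (M N)) q \<noteq> 0}"
        using f[of N "M N"] by auto
      then show "finite {q. q \<le> N \<and> f q \<noteq> 0}" by (simp add: cp_finite)
    qed
    then have nth: "cp_nth (Abs_cpuiseux f) = f" by (simp add: Abs_cpuiseux_inverse)
    have "limitin mtopology s (Abs_cpuiseux f) sequentially"
      unfolding limit_metric_sequentially
    proof (intro conjI allI impI)
      fix e :: real assume "0 < e"
      then obtain n where n: "r powr of_rat (of_nat n) < e" using cp_small_exponent assms by blast
      have "cp_dist r (s m) (Abs_cpuiseux f) < e" if "M (of_nat n) \<le> m" for m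
        unfolding cp_dist_def
        by (rule cp_abs_lessI[OF assms n]) (use f[OF that] in \<open>simp add: nth\<close>)
      then show "\<exists>N. \<forall>n\<ge>N. s n \<in> UNIV \<and> cp_dist r (s n) (Abs_cpuiseux f) < e" by auto
    qed simp
    then show "\<exists>x. limitin mtopology s x sequentially" by blast
  qed
qed

lemma puiseux_dense:
  assumes "0 < r" "r < 1"
  shows "cp_topology r closure_of (puiseux :: 'a::ab_group_add cpuiseux set) = UNIV"
proof -
  interpret Metric_space UNIV "cp_dist r :: 'a cpuiseux \<Rightarrow> _" by (rule cp_Metric_space[OF assms])
  have "\<exists>b\<in>puiseux. cp_dist r a b < e" if e: "0 < e" for a :: "'a cpuiseux" and e
  proof -
    obtain n where n: "r powr of_rat (of_nat n) < e" using cp_small_exponent[OF assms e] by blast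
    let ?S = "{q. q \<le> of_nat n \<and> cp_nth a q \<noteq> 0}"
    define f where "f q = (if q \<le> of_nat n then cp_nth a q else 0)" for q
    have "{q. q \<le> N \<and> f q \<noteq> 0} \<subseteq> ?S" for N by (auto simp: f_def)
    then have "left_finite f" unfolding left_finite_def
      using finite_subset[OF _ cp_finite[of "of_nat n" a]] by blast
    then have nth: "cp_nth (Abs_cpuiseux f) = f" by (simp add: Abs_cpuiseux_inverse)
    have "\<exists>m>0. \<forall>q\<in>S. of_nat m * q \<in> \<int>" if "finite S" for S :: "rat set"
      using that
    proof (induction S)
      case (insert q S)
      then obtain m where m: "m > 0" "\<forall>q\<in>S. of_nat m * q \<in> \<int>" by blast
      obtain u v where uv: "v > 0" "q = of_int u / of_int v"
        by (cases q) (auto simp: Fract_of_int_quotient)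
      have "of_nat (m * nat v) * p \<in> \<int>" if "p \<in> insert q S" for p
      proof (cases "p = q")
        case True
        then have "of_nat (nat v) * p = (of_int u :: rat)" using uv by simp
        then have "of_nat (m * nat v) * p = of_nat m * of_int u" by (simp only: of_nat_mult mult.assoc)
        then show ?thesis by (simp only: Ints_mult Ints_of_nat Ints_of_int)
      next
        case False
        then have "of_nat m * p \<in> \<int>" using m that by blast
        then have "of_nat (nat v) * (of_nat m * p) \<in> \<int>" by (rule Ints_mult[OF Ints_of_nat])
        then show ?thesis by (simp add: mult_ac)
      qed
      then show ?case using m uv by (intro exI[of _ "m * nat v"]) auto
    qed auto
    from this[OF cp_finite[of "of_nat n" a]]
    obtain m where "m > 0" "\<forall>q\<in>?S. of_nat m * q \<in> \<int>" by blast
    then have "Abs_cpuiseux f \<in> puiseux"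
      unfolding puiseux_def mem_Collect_eq nth by (intro exI[of _ m]) (auto simp: f_def split: if_splits)
    moreover have "cp_dist r a (Abs_cpuiseux f) < e"
      unfolding cp_dist_def by (rule cp_abs_lessI[OF assms n]) (simp add: nth f_def)
    ultimately show ?thesis by blast
  qed
  then show ?thesis by (simp add: metric_closure_of)
qed


definition is_hom :: "('a::comm_ring_1 \<Rightarrow> 'b::comm_ring_1) \<Rightarrow> bool" where
  "is_hom h \<longleftrightarrow> h 1 = 1 \<and> (\<forall>a b. h (a + b) = h a + h b) \<and> (\<forall>a b. h (a * b) = h a * h b)"

lemma is_hom_0: "is_hom h \<Longrightarrow> h 0 = 0"
  unfolding is_hom_def by (metis add.right_neutral add_left_imp_eq)

lemma cp_of_fls_nth_int: "cp_nth (cp_of_fls f) (of_int n) = fls_nth f n"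
  by transfer simp

lemma cp_of_fls_nth_nonint: "q \<notin> \<int> \<Longrightarrow> cp_nth (cp_of_fls f) q = 0"
  by transfer simp

lemma is_hom_cp_of_fls: "is_hom (cp_of_fls :: 'a::comm_ring_1 fls \<Rightarrow> _)"
  unfolding is_hom_def
proof (intro conjI allI)
  show "cp_of_fls (1 :: 'a fls) = 1"
  proof (rule cp_eqI)
    fix q
    show "cp_nth (cp_of_fls (1 :: 'a fls)) q = cp_nth 1 q"
    proof (cases "q \<in> \<int>")
      case True
      then obtain n where "q = of_int n" by (auto elim: Ints_cases)
      then show ?thesis by (simp only: cp_of_fls_nth_int cp_nth_1) simp
    next
      case False
      then show ?thesis by (auto simp: cp_of_fls_nth_nonint cp_nth_1)
    qed
  qed
  fix f g :: "'a fls"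
  show "cp_of_fls (f + g) = cp_of_fls f + cp_of_fls g"
  proof (rule cp_eqI)
    fix q show "cp_nth (cp_of_fls (f + g)) q = cp_nth (cp_of_fls f + cp_of_fls g) q"
      by (cases "q \<in> \<int>") (auto simp: cp_of_fls_nth_nonint cp_of_fls_nth_int elim!: Ints_cases)
  qed
  show "cp_of_fls (f * g) = cp_of_fls f * cp_of_fls g"
  proof (rule cp_eqI)
    fix q
    show "cp_nth (cp_of_fls (f * g)) q = cp_nth (cp_of_fls f * cp_of_fls g) q"
    proof (cases "q \<in> \<int>")
      case True
      then obtain n where n: "q = of_int n" by (auto elim: Ints_cases)
      let ?I = "{fls_subdegree f..n - fls_subdegree g}"
      have "cp_nth (cp_of_fls f * cp_of_fls g) q
          = (\<Sum>p\<in>of_int ` ?I. cp_nth (cp_of_fls f) p * cp_nth (cp_of_fls g) (q - p))"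
      proof (rule cp_nth_mult_superset)
        show "{p. cp_nth (cp_of_fls f) p \<noteq> 0 \<and> cp_nth (cp_of_fls g) (q - p) \<noteq> 0} \<subseteq> of_int ` ?I"
        proof safe
          fix p assume p: "cp_nth (cp_of_fls f) p \<noteq> 0" "cp_nth (cp_of_fls g) (q - p) \<noteq> 0"
          then obtain i where i: "p = of_int i" using cp_of_fls_nth_nonint by (metis Ints_cases)
          then have qp: "q - p = of_int (n - i)" by (simp add: n)
          have fi: "fls_nth f i \<noteq> 0" using p(1) unfolding i cp_of_fls_nth_int .
          have gi: "fls_nth g (n - i) \<noteq> 0" using p(2) unfolding qp cp_of_fls_nth_int .
          from fls_subdegree_leI[OF fi] fls_subdegree_leI[OF gi]
          show "p \<in> of_int ` ?I" unfolding i by (intro imageI) auto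
        qed
      qed simp
      also have "\<dots> = (\<Sum>i\<in>?I. fls_nth f i * fls_nth g (n - i))"
        by (subst sum.reindex)
          (auto simp: n cp_of_fls_nth_int inj_on_def of_int_diff[symmetric] simp del: of_int_diff)
      finally show ?thesis by (simp add: n cp_of_fls_nth_int fls_times_nth(2))
    next
      case False
      have "cp_nth (cp_of_fls f * cp_of_fls g) q
          = (\<Sum>p\<in>{}. cp_nth (cp_of_fls f) p * cp_nth (cp_of_fls g) (q - p))"
      proof (rule cp_nth_mult_superset)
        show "{p. cp_nth (cp_of_fls f) p \<noteq> 0 \<and> cp_nth (cp_of_fls g) (q - p) \<noteq> 0} \<subseteq> {}"
        proof safe
          fix p assume p: "cp_nth (cp_of_fls f) p \<noteq> 0" "cp_nth (cp_of_fls g) (q - p) \<noteq> 0"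
          have "p \<in> \<int>" using p(1) cp_of_fls_nth_nonint[of p f] by blast
          moreover have "q - p \<in> \<int>" using p(2) cp_of_fls_nth_nonint[of "q - p" g] by blast
          ultimately have "p + (q - p) \<in> \<int>" by (rule Ints_add)
          then show "p \<in> {}" using False by simp
        qed
      qed simp
      then show ?thesis by (simp add: cp_of_fls_nth_nonint False)
    qed
  qed
qed


section \<open>Rational functions in one variable\<close>

definition rat_const :: "'a::idom \<Rightarrow> 'a poly fract" where
  "rat_const c = Fract [:c:] 1"

definition rat_var :: "'a::idom poly fract" where
  "rat_var = Fract [:0, 1:] 1"

definition num_den :: "'a::field poly fract \<Rightarrow> 'a poly \<times> 'a poly" where
  "num_den f = (SOME (p, q). f = Fract p q \<and> q \<noteq> 0 \<and> coprime p q)"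

lemma num_den:
  fixes f :: "'a::field poly fract"
  assumes "num_den f = (p, q)"
  shows "f = Fract p q" "q \<noteq> 0" "coprime p q"
proof -
  have ex: "\<exists>p' q'. Fract p q = Fract p' q' \<and> q' \<noteq> 0 \<and> coprime p' q'" if "q \<noteq> 0" for p q :: "'a poly"
    using that
  proof (induction "degree q" arbitrary: p q rule: less_induct)
    case less
    show ?case
    proof (cases "coprime p q")
      case False
      then obtain d where d: "d dvd p" "d dvd q" "\<not> d dvd 1" by (auto simp: coprime_def)
      then obtain p1 q1 where pq: "p = d * p1" "q = d * q1" by (auto elim!: dvdE)
      have nz: "d \<noteq> 0" "q1 \<noteq> 0" using less.prems pq by auto
      have "degree d > 0" using d(3) nz(1) by (simp add: is_unit_iff_degree)
      then have "degree q1 < degree q" using nz by (simp add: pq(2) degree_mult_eq)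
      moreover have "Fract p q = Fract p1 q1" using nz by (simp add: pq eq_fract mult_ac)
      ultimately show ?thesis using less.hyps nz(2) by metis
    qed (use less.prems in blast)
  qed
  obtain a b where "f = Fract a b" "b \<noteq> 0" by (cases f)
  then have "\<exists>x. case x of (p, q) \<Rightarrow> f = Fract p q \<and> q \<noteq> 0 \<and> coprime p q"
    using ex[of b a] by auto
  from someI_ex[OF this] show "f = Fract p q" "q \<noteq> 0" "coprime p q"
    using assms by (auto simp: num_den_def)
qed

text \<open>
  \<open>rat_eval h s\<close> is the homomorphism on \<open>K(y)\<close> that extends \<open>h\<close> and sends \<open>y\<close> to \<open>s\<close>. It is only
  meaningful if \<open>s\<close> is transcendental over the image of \<open>h\<close>; see \<open>rat_eval_hom\<close>.
\<close>

definition rat_eval :: "('a::field \<Rightarrow> 'b::field) \<Rightarrow> 'b \<Rightarrow> 'a poly fract \<Rightarrow> 'b" where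
  "rat_eval h s f = (case num_den f of (p, q) \<Rightarrow> poly (map_poly h p) s / poly (map_poly h q) s)"

lemma poly_map_poly_hom:
  assumes "is_hom h"
  shows "poly (map_poly h (p + q)) s = poly (map_poly h p) s + poly (map_poly h q) s"
    and "poly (map_poly h (p * q)) s = poly (map_poly h p) s * poly (map_poly h q) s"
proof -
  note h0 = is_hom_0[OF assms]
  have C: "poly (map_poly h (pCons c p)) s = h c + s * poly (map_poly h p) s" for c p
    using h0 by (cases "c = 0 \<and> p = 0") (auto simp: map_poly_pCons)
  have A: "poly (map_poly h (p + q)) s = poly (map_poly h p) s + poly (map_poly h q) s" for p q
  proof -
    have "map_poly h (p + q) = map_poly h p + map_poly h q"
      using assms h0 by (intro poly_eqI) (simp add: coeff_map_poly is_hom_def)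
    then show ?thesis by simp
  qed
  have S: "poly (map_poly h (smult c p)) s = h c * poly (map_poly h p) s" for c p
  proof -
    have "map_poly h (smult c p) = smult (h c) (map_poly h p)"
      using assms h0 by (intro poly_eqI) (simp add: coeff_map_poly is_hom_def)
    then show ?thesis by simp
  qed
  show "poly (map_poly h (p + q)) s = poly (map_poly h p) s + poly (map_poly h q) s" by (rule A)
  show "poly (map_poly h (p * q)) s = poly (map_poly h p) s * poly (map_poly h q) s"
    by (induction p) (simp_all add: C A S h0 algebra_simps)
qed

lemma rat_eval_Fract:
  assumes "is_hom h" and tr: "\<And>p. p \<noteq> 0 \<Longrightarrow> poly (map_poly h p) s \<noteq> 0" and "q \<noteq> 0"
  shows "rat_eval h s (Fract p q) = poly (map_poly h p) s / poly (map_poly h q) s"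
proof -
  obtain a b where ab: "num_den (Fract p q) = (a, b)" by fastforce
  note nd = num_den[OF ab]
  have "p * b = a * q" using nd(1,2) \<open>q \<noteq> 0\<close> by (simp add: eq_fract)
  then have "poly (map_poly h p) s * poly (map_poly h b) s = poly (map_poly h a) s * poly (map_poly h q) s"
    using poly_map_poly_hom(2)[OF assms(1)] by metis
  then show ?thesis using tr[OF nd(2)] tr[OF \<open>q \<noteq> 0\<close>] by (simp add: rat_eval_def ab frac_eq_eq)
qed

lemma rat_eval_hom:
  assumes "is_hom h" and tr: "\<And>p. p \<noteq> 0 \<Longrightarrow> poly (map_poly h p) s \<noteq> 0"
  shows "is_hom (rat_eval h s)" "rat_eval h s (rat_const c) = h c" "rat_eval h s rat_var = s"
proof -
  note ev = rat_eval_Fract[OF assms]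
  note hom = poly_map_poly_hom[OF assms(1)]
  have h: "h 0 = 0" "h 1 = 1" using is_hom_0[OF assms(1)] assms(1) by (auto simp: is_hom_def)
  have const: "poly (map_poly h [:c:]) s = h c" for c
    by (cases "c = 0") (auto simp: map_poly_pCons h)
  have one: "poly (map_poly h 1) s = 1" using const[of 1] h by (simp add: one_pCons)
  show "rat_eval h s (rat_const c) = h c" "rat_eval h s rat_var = s"
    by (simp_all add: rat_const_def rat_var_def ev one const) (simp add: map_poly_pCons h)
  show "is_hom (rat_eval h s)"
    unfolding is_hom_def
  proof (intro conjI allI)
    show "rat_eval h s 1 = 1" by (simp add: One_fract_def ev one)
    fix f g :: "'a poly fract"
    obtain a b c d where fg: "f = Fract a b" "b \<noteq> 0" "g = Fract c d" "d \<noteq> 0"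
      by (cases f, cases g)
    then have "b * d \<noteq> 0" by simp
    with fg show "rat_eval h s (f + g) = rat_eval h s f + rat_eval h s g"
      "rat_eval h s (f * g) = rat_eval h s f * rat_eval h s g"
      using tr by (simp_all add: ev hom add_frac_eq)
  qed
qed


section \<open>The Berkovich projective line\<close>

text \<open>
  For seminorms extending a non-archimedean absolute value, the triangle inequality and
  multiplicativity imply the ultrametric inequality.
\<close>

definition multiplicative_seminorm :: "real \<Rightarrow> ('a::field cpuiseux poly \<Rightarrow> real) \<Rightarrow> bool" where
  "multiplicative_seminorm r \<nu> \<longleftrightarrow>
     (\<forall>p. 0 \<le> \<nu> p) \<and>
     (\<forall>p q. \<nu> (p + q) \<le> \<nu> p + \<nu> q) \<and>
     (\<forall>p q. \<nu> (p * q) = \<nu> p * \<nu> q) \<and>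
     (\<forall>c. \<nu> [:c:] = cp_abs r c)"

text \<open>
  A point \<open>\<zeta>\<close> is identified with the function \<open>f \<mapsto> \<parallel>f\<parallel>\<^sub>\<zeta>\<close> on rational functions, with values
  in \<open>[0, \<infinity>]\<close>; the value \<open>\<infinity>\<close> occurs only for classical points, at the poles of \<open>f\<close>. As numerator
  and denominator are coprime, no seminorm vanishes on both.
\<close>

type_synonym 'a berkovich_point = "'a cpuiseux poly fract \<Rightarrow> ennreal"

definition affine_point :: "('a::field cpuiseux poly \<Rightarrow> real) \<Rightarrow> 'a berkovich_point" where
  "affine_point \<nu> f = (case num_den f of (p, q) \<Rightarrow> ennreal (\<nu> p) / ennreal (\<nu> q))"

text \<open>\<open>\<parallel>f\<parallel>\<^sub>\<infinity> = \<bar>f(\<infinity>)\<bar>\<close>.\<close>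

definition infinity_point :: "real \<Rightarrow> 'a::field berkovich_point" where
  "infinity_point r f = (case num_den f of (p, q) \<Rightarrow>
     if degree p < degree q then 0
     else if degree p = degree q then ennreal (cp_abs r (lead_coeff p / lead_coeff q))
     else \<infinity>)"

definition berkovich_line :: "real \<Rightarrow> 'a::field berkovich_point set" where
  "berkovich_line r = affine_point ` {\<nu>. multiplicative_seminorm r \<nu>} \<union> {infinity_point r}"


section \<open>The Galois action and multiplicity\<close>

definition puiseux_automorphism :: "('a::field cpuiseux \<Rightarrow> 'a cpuiseux) \<Rightarrow> bool" where
  "puiseux_automorphism \<sigma> \<longleftrightarrow>
     bij_betw \<sigma> puiseux puiseux \<and>
     (\<forall>a\<in>puiseux. \<forall>b\<in>puiseux. \<sigma> (a + b) = \<sigma> a + \<sigma> b \<and> \<sigma> (a * b) = \<sigma> a * \<sigma> b) \<and>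
     (\<forall>c. \<sigma> (cp_of_fls c) = cp_of_fls c)"

text \<open>
  The elements of \<open>Gal(K/k((x)))\<close>, each represented by its continuous extension to the
  completion.
\<close>

definition galois :: "real \<Rightarrow> ('a::field cpuiseux \<Rightarrow> 'a cpuiseux) set" where
  "galois r = {\<sigma>. puiseux_automorphism \<sigma> \<and> continuous_map (cp_topology r) (cp_topology r) \<sigma>}"

text \<open>
  Points are moved by precomposition; precomposing with \<open>\<sigma>\<^sup>-\<^sup>1\<close> instead gives the same orbits.
\<close>

definition galois_act :: "('a::field cpuiseux \<Rightarrow> 'a cpuiseux) \<Rightarrow> 'a berkovich_point \<Rightarrow> 'a berkovich_point" where
  "galois_act \<sigma> \<zeta> = (\<lambda>f. \<zeta> (rat_eval (\<lambda>c. rat_const (\<sigma> c)) rat_var f))"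

definition galois_orbit :: "real \<Rightarrow> 'a::field berkovich_point \<Rightarrow> 'a berkovich_point set" where
  "galois_orbit r \<zeta> = (\<lambda>\<sigma>. galois_act \<sigma> \<zeta>) ` galois r"

text \<open>
  Divisibility on \<^typ>\<open>enat\<close> is the required one for positive values: \<open>\<infinity>\<close> is divisible by all of
  them, and divides only itself among them.
\<close>

definition galois_multiplicity :: "real \<Rightarrow> 'a::field berkovich_point \<Rightarrow> enat" where
  "galois_multiplicity r \<zeta> =
     (if finite (galois_orbit r \<zeta>) then enat (card (galois_orbit r \<zeta>)) else \<infinity>)"

definition multiplicity_locus :: "real \<Rightarrow> nat \<Rightarrow> 'a::field berkovich_point set" where
  "multiplicity_locus r m = {\<zeta> \<in> berkovich_line r. galois_multiplicity r \<zeta> dvd enat m}"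


section \<open>Rational skew products\<close>

type_synonym 'a laurent_rat = "'a fls poly fract"

definition skew_endomorphism :: "('a::field laurent_rat \<Rightarrow> 'a laurent_rat) \<Rightarrow> bool" where
  "skew_endomorphism \<phi> \<longleftrightarrow>
     is_hom \<phi> \<and>
     (\<forall>c. \<phi> (rat_const (fls_const c)) = rat_const (fls_const c)) \<and>
     (\<exists>g. \<phi> (rat_const fls_X) = rat_const g \<and> fls_subdegree g \<ge> 1)"

text \<open>The data in \<open>\<phi>(x) = \<phi>\<^sub>1 = \<lambda> x\<^sup>n (1 + h)\<close>.\<close>

definition skew_x :: "('a::field laurent_rat \<Rightarrow> 'a laurent_rat) \<Rightarrow> 'a fls" where
  "skew_x \<phi> = (THE g. \<phi> (rat_const fls_X) = rat_const g)"

definition skew_order :: "('a::field laurent_rat \<Rightarrow> 'a laurent_rat) \<Rightarrow> nat" where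
  "skew_order \<phi> = nat (fls_subdegree (skew_x \<phi>))"

definition skew_lead :: "('a::field laurent_rat \<Rightarrow> 'a laurent_rat) \<Rightarrow> 'a" where
  "skew_lead \<phi> = fls_nth (skew_x \<phi>) (fls_subdegree (skew_x \<phi>))"

definition skew_pert :: "('a::field laurent_rat \<Rightarrow> 'a laurent_rat) \<Rightarrow> 'a fps" where
  "skew_pert \<phi> = fps_const (inverse (skew_lead \<phi>)) * fls_base_factor_to_fps (skew_x \<phi>) - 1"

lemma skew_x:
  assumes "skew_endomorphism \<phi>"
  shows "\<phi> (rat_const fls_X) = rat_const (skew_x \<phi>)" "fls_subdegree (skew_x \<phi>) \<ge> 1"
proof -
  obtain g where g: "\<phi> (rat_const fls_X) = rat_const g" "fls_subdegree g \<ge> 1"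
    using assms by (auto simp: skew_endomorphism_def)
  have "skew_x \<phi> = g"
    unfolding skew_x_def by (rule the_equality) (use g in \<open>auto simp: rat_const_def eq_fract\<close>)
  with g show "\<phi> (rat_const fls_X) = rat_const (skew_x \<phi>)" "fls_subdegree (skew_x \<phi>) \<ge> 1" by auto
qed

lemma skew_x_decomp:
  assumes "skew_endomorphism \<phi>"
  shows "skew_order \<phi> > 0" "skew_lead \<phi> \<noteq> 0" "fps_nth (skew_pert \<phi>) 0 = 0"
    "skew_x \<phi> = fls_const (skew_lead \<phi>) * fls_X ^ skew_order \<phi> * fps_to_fls (1 + skew_pert \<phi>)"
proof -
  note x = skew_x[OF assms]
  show "skew_order \<phi> > 0" using x(2) by (simp add: skew_order_def)
  have nz: "skew_x \<phi> \<noteq> 0" using x(2) by auto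
  then show l: "skew_lead \<phi> \<noteq> 0" by (simp add: skew_lead_def)
  then show "fps_nth (skew_pert \<phi>) 0 = 0"
    by (simp add: skew_pert_def skew_lead_def fls_base_factor_to_fps_nth)
  show "skew_x \<phi> = fls_const (skew_lead \<phi>) * fls_X ^ skew_order \<phi> * fps_to_fls (1 + skew_pert \<phi>)"
  proof (rule fls_eqI)
    fix i
    have "fls_nth (fls_const (skew_lead \<phi>) * fls_X ^ skew_order \<phi> * fps_to_fls (1 + skew_pert \<phi>)) i
        = skew_lead \<phi> * fls_nth (fls_X ^ skew_order \<phi> * fps_to_fls (1 + skew_pert \<phi>)) i"
      by (simp add: mult.assoc)
    also have "fls_nth (fls_X ^ skew_order \<phi> * fps_to_fls (1 + skew_pert \<phi>)) i
        = fls_nth (fps_to_fls (1 + skew_pert \<phi>)) (i - int (skew_order \<phi>))"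
      by (simp add: fls_X_power_times_conv_shift)
    also have "skew_lead \<phi> * \<dots> = fls_nth (skew_x \<phi>) i"
      using x(2) l by (auto simp: skew_pert_def skew_order_def fls_base_factor_to_fps_nth
          algebra_simps fls_eq0_below_subdegree)
    finally show "fls_nth (skew_x \<phi>) i
        = fls_nth (fls_const (skew_lead \<phi>) * fls_X ^ skew_order \<phi> * fps_to_fls (1 + skew_pert \<phi>)) i" ..
  qed
qed

definition compatible_roots :: "'a::field \<Rightarrow> (nat \<Rightarrow> 'a) \<Rightarrow> bool" where
  "compatible_roots l \<Lambda> \<longleftrightarrow> \<Lambda> 1 = l \<and> (\<forall>b\<ge>1. \<forall>c\<ge>1. \<Lambda> (b * c) ^ c = \<Lambda> b)"

definition root_power :: "(nat \<Rightarrow> 'a::field) \<Rightarrow> rat \<Rightarrow> 'a" where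
  "root_power \<Lambda> q = (case quotient_of q of (a, b) \<Rightarrow> \<Lambda> (nat b) powi a)"

text \<open>The image \<open>\<lambda>\<^sub>b\<^sup>a x\<^bsup>na/b\<^esup> (1 + h)\<^bsup>a/b\<^esup>\<close> of \<open>x\<^bsup>a/b\<^esup>\<close>.\<close>

definition skew_monom ::
  "('a::field_char_0 laurent_rat \<Rightarrow> 'a laurent_rat) \<Rightarrow> (nat \<Rightarrow> 'a) \<Rightarrow> rat \<Rightarrow> 'a cpuiseux" where
  "skew_monom \<phi> \<Lambda> q =
     cp_monom (root_power \<Lambda> q) (of_nat (skew_order \<phi>) * q) *
     cp_of_fls (fps_to_fls (fps_compose (fps_binomial (of_rat q)) (skew_pert \<phi>)))"

text \<open>
  The continuous extension \<open>\<Sum> a\<^sub>q x\<^sup>q \<mapsto> \<Sum> a\<^sub>q \<phi>(x\<^sup>q)\<close>; only finitely many summands contribute to any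
  given coefficient of the right-hand side.
\<close>

definition skew_series ::
  "('a::field_char_0 laurent_rat \<Rightarrow> 'a laurent_rat) \<Rightarrow> (nat \<Rightarrow> 'a) \<Rightarrow> 'a cpuiseux \<Rightarrow> 'a cpuiseux" where
  "skew_series \<phi> \<Lambda> a = Abs_cpuiseux (\<lambda>p.
     \<Sum>q\<in>{q. cp_nth a q \<noteq> 0 \<and> cp_nth (skew_monom \<phi> \<Lambda> q) p \<noteq> 0}. cp_nth a q * cp_nth (skew_monom \<phi> \<Lambda> q) p)"

lemma skew_monom_support:
  assumes "cp_nth (skew_monom \<phi> \<Lambda> q) p \<noteq> 0"
  shows "of_nat (skew_order \<phi>) * q \<le> p"
proof -
  let ?t = "p - of_nat (skew_order \<phi>) * q"
  have *: "cp_nth (cp_of_fls (fps_to_fls (fps_compose (fps_binomial (of_rat q)) (skew_pert \<phi>)))) ?t \<noteq> 0"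
    using assms by (auto simp: skew_monom_def cp_nth_monom_mult)
  then have "?t \<in> \<int>" using cp_of_fls_nth_nonint by metis
  then obtain i where i: "?t = of_int i" by (auto elim: Ints_cases)
  have "i \<ge> 0" using * unfolding i cp_of_fls_nth_int by (simp split: if_splits)
  then have "?t \<ge> 0" unfolding i by simp
  then show ?thesis by simp
qed

lemma skew_series_nth:
  assumes "skew_endomorphism \<phi>"
  shows "cp_nth (skew_series \<phi> \<Lambda> a) p =
     (\<Sum>q\<in>{q. cp_nth a q \<noteq> 0 \<and> cp_nth (skew_monom \<phi> \<Lambda> q) p \<noteq> 0}. cp_nth a q * cp_nth (skew_monom \<phi> \<Lambda> q) p)"
proof -
  let ?n = "of_nat (skew_order \<phi>) :: rat"
  have n: "?n > 0" using skew_x_decomp(1)[OF assms] by simp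
  let ?f = "\<lambda>p. \<Sum>q\<in>{q. cp_nth a q \<noteq> 0 \<and> cp_nth (skew_monom \<phi> \<Lambda> q) p \<noteq> 0}. cp_nth a q * cp_nth (skew_monom \<phi> \<Lambda> q) p"
  have "left_finite ?f"
    unfolding left_finite_def
  proof
    fix N
    have "{p. p \<le> N \<and> ?f p \<noteq> 0}
        \<subseteq> (\<Union>q\<in>{q. q \<le> N / ?n \<and> cp_nth a q \<noteq> 0}. {p. p \<le> N \<and> cp_nth (skew_monom \<phi> \<Lambda> q) p \<noteq> 0})"
    proof
      fix p assume "p \<in> {p. p \<le> N \<and> ?f p \<noteq> 0}"
      then have p: "p \<le> N" "?f p \<noteq> 0" by auto
      from p(2) obtain q where q: "cp_nth a q \<noteq> 0" "cp_nth (skew_monom \<phi> \<Lambda> q) p \<noteq> 0"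
        using sum.neutral by force
      have "q \<le> N / ?n" using skew_monom_support[OF q(2)] p(1) n by (simp add: pos_le_divide_eq mult.commute)
      then show "p \<in> (\<Union>q\<in>{q. q \<le> N / ?n \<and> cp_nth a q \<noteq> 0}. {p. p \<le> N \<and> cp_nth (skew_monom \<phi> \<Lambda> q) p \<noteq> 0})"
        using p(1) q by auto
    qed
    moreover have "finite \<dots>" by (intro finite_UN_I cp_finite)
    ultimately show "finite {p. p \<le> N \<and> ?f p \<noteq> 0}" by (rule finite_subset)
  qed
  then show ?thesis by (simp add: skew_series_def Abs_cpuiseux_inverse)
qed

lemma skew_series_monom:
  assumes "skew_endomorphism \<phi>"
  shows "skew_series \<phi> \<Lambda> (cp_monom c q) = cp_const c * skew_monom \<phi> \<Lambda> q"
proof (rule cp_eqI)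
  fix p
  have "cp_nth (skew_series \<phi> \<Lambda> (cp_monom c q)) p
      = (\<Sum>q'\<in>{q}. cp_nth (cp_monom c q) q' * cp_nth (skew_monom \<phi> \<Lambda> q') p)"
    unfolding skew_series_nth[OF assms]
    by (rule sum.mono_neutral_left) (auto simp: cp_nth_monom split: if_splits)
  then show "cp_nth (skew_series \<phi> \<Lambda> (cp_monom c q)) p = cp_nth (cp_const c * skew_monom \<phi> \<Lambda> q) p"
    by (simp add: cp_const_def cp_nth_monom_mult cp_nth_monom)
qed

lemma skew_series_continuous:
  assumes "0 < r" "r < 1" "skew_endomorphism \<phi>"
  shows "continuous_map (cp_topology r) (cp_topology r) (skew_series \<phi> \<Lambda>)"
proof -
  interpret M: Metric_space UNIV "cp_dist r :: 'a cpuiseux \<Rightarrow> _" by (rule cp_Metric_space[OF assms(1,2)])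
  let ?n = "of_nat (skew_order \<phi>) :: rat"
  have n: "?n > 0" using skew_x_decomp(1)[OF assms(3)] by simp
  show ?thesis
    unfolding M.metric_continuous_map[OF M.Metric_space_axioms]
  proof (intro conjI ballI allI impI)
    fix a :: "'a cpuiseux" and e :: real assume "0 < e"
    then obtain k where k: "r powr of_rat (of_nat k) < e" using cp_small_exponent[OF assms(1,2)] by blast
    have "cp_dist r (skew_series \<phi> \<Lambda> a) (skew_series \<phi> \<Lambda> b) < e" if b: "cp_dist r a b < r powr of_rat (of_nat k / ?n)" for b
    proof -
      have eq: "cp_nth a q = cp_nth b q" if "q \<le> of_nat k / ?n" for q
        using cp_abs_lessD[OF assms(1,2) b[unfolded cp_dist_def] that] by simp
      show ?thesis
        unfolding cp_dist_def
      proof (rule cp_abs_lessI[OF assms(1,2) k])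
        fix p :: rat assume p: "p < of_nat k"
        have "cp_nth (skew_series \<phi> \<Lambda> a) p = cp_nth (skew_series \<phi> \<Lambda> b) p"
          unfolding skew_series_nth[OF assms(3)]
        proof -
          have "cp_nth a q = cp_nth b q" if "cp_nth (skew_monom \<phi> \<Lambda> q) p \<noteq> 0" for q
            by (rule eq) (use skew_monom_support[OF that] p n in \<open>simp add: pos_le_divide_eq mult.commute\<close>)
          then show "(\<Sum>q\<in>{q. cp_nth a q \<noteq> 0 \<and> cp_nth (skew_monom \<phi> \<Lambda> q) p \<noteq> 0}. cp_nth a q * cp_nth (skew_monom \<phi> \<Lambda> q) p)
            = (\<Sum>q\<in>{q. cp_nth b q \<noteq> 0 \<and> cp_nth (skew_monom \<phi> \<Lambda> q) p \<noteq> 0}. cp_nth b q * cp_nth (skew_monom \<phi> \<Lambda> q) p)"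
            by (intro sum.cong) auto
        qed
        then show "cp_nth (skew_series \<phi> \<Lambda> a - skew_series \<phi> \<Lambda> b) p = 0" by simp
      qed
    qed
    then show "\<exists>d>0. \<forall>b. b \<in> UNIV \<and> cp_dist r a b < d
        \<longrightarrow> cp_dist r (skew_series \<phi> \<Lambda> a) (skew_series \<phi> \<Lambda> b) < e"
      using assms(1) by (intro exI[of _ "r powr of_rat (of_nat k / ?n)"]) auto
  qed auto
qed

definition skew_pullback ::
  "('a::field_char_0 laurent_rat \<Rightarrow> 'a laurent_rat) \<Rightarrow> (nat \<Rightarrow> 'a) \<Rightarrow>
    'a cpuiseux poly fract \<Rightarrow> 'a cpuiseux poly fract" where
  "skew_pullback \<phi> \<Lambda> =
     rat_eval (\<lambda>c. rat_const (skew_series \<phi> \<Lambda> c))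
       (rat_eval (\<lambda>c. rat_const (cp_of_fls c)) rat_var (\<phi> rat_var))"

definition ennreal_powr :: "ennreal \<Rightarrow> real \<Rightarrow> ennreal" where
  "ennreal_powr t s = (if t = \<infinity> then \<infinity> else ennreal (enn2real t powr s))"

definition skew_scale :: "('a::field laurent_rat \<Rightarrow> 'a laurent_rat) \<Rightarrow> real" where
  "skew_scale \<phi> = 1 / real (skew_order \<phi>)"

definition skew_product ::
  "('a::field_char_0 laurent_rat \<Rightarrow> 'a laurent_rat) \<Rightarrow> (nat \<Rightarrow> 'a) \<Rightarrow> 'a berkovich_point \<Rightarrow> 'a berkovich_point" where
  "skew_product \<phi> \<Lambda> \<zeta> = (\<lambda>f. ennreal_powr (\<zeta> (skew_pullback \<phi> \<Lambda> f)) (skew_scale \<phi>))"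

definition skew_simple :: "('a::field laurent_rat \<Rightarrow> 'a laurent_rat) \<Rightarrow> bool" where
  "skew_simple \<phi> \<longleftrightarrow> skew_order \<phi> = 1"

end

theory Submission
  imports Defs
begin

text \<open>
  A multiplicity is the size of an orbit of the Galois group \<open>G\<close>, so the theorem is a statement about
  equivariance. Let \<open>\<Phi>\<close> be the endomorphism of \<open>K(y)\<close> along which a simple skew product pulls back
  seminorms, where \<open>K\<close> is the completed field of Puiseux series. Since \<open>\<phi>(x) = \<lambda> x (1 + h)\<close> has order
  \<open>1\<close>, the image \<open>\<lambda>\<^sup>q x\<^sup>q (1 + h)\<^sup>q\<close> of \<open>x\<^sup>q\<close> is \<open>x\<^sup>q\<close> times a Laurent series. An element of \<open>G\<close> fixes
  Laurent series and multiplies \<open>x\<^sup>q\<close> by a root of unity \<open>w q\<close>, so it commutes with \<open>\<Phi>\<close> on \<open>K\<close>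
  (\<open>skew_series_twist\<close>); it also fixes \<open>y\<close> and \<open>\<Phi> y\<close>, hence commutes with \<open>\<Phi>\<close> altogether
  (\<open>galois_act_skew_product\<close>). The skew product is therefore a \<open>G\<close>-equivariant surjection from the orbit
  of \<open>\<zeta>\<close> onto the orbit of its image. Its fibres are permuted transitively, so they have equal size
  (\<open>card_image_dvd_if_transitive\<close>), and the divisibility follows.

  The argument rests on three descriptions. The group \<open>G\<close> consists of the twists
  \<open>\<Sum> a\<^sub>q x\<^sup>q \<mapsto> \<Sum> w(q) a\<^sub>q x\<^sup>q\<close> by characters \<open>w\<close> of \<open>\<rat>/\<int>\<close> (\<open>galois_cp_twist\<close>). The map \<open>\<Phi>\<close> is
  a homomorphism (\<open>skew_pullback_hom\<close>); besides the multiplicativity of substitution on \<open>K\<close> this needs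
  that \<open>\<Phi> y\<close> is transcendental over \<open>K\<close>, that is, that \<open>\<phi>(y)\<close> does not lie in \<open>k((x))\<close>. The reason is
  that \<open>\<phi>\<close> already maps \<open>k((x))\<close> onto itself and is injective. That \<open>\<phi>\<close> acts on \<open>k((x))\<close> by
  substitution, in particular continuously, is automatic: \<open>1 + x k[[x]]\<close> is a divisible group, and so must be its image
  (\<open>skew_substitution\<close>). Finally, for the inclusion between the loci \<open>T\<^sub>m\<close>, the image of a point has to be a
  point of the Berkovich line. For this the line is described as the set of all functions on \<open>K(y)\<close> with
  values in \<open>[0, \<infinity>]\<close> that satisfy axioms preserved by pulling back along \<open>\<Phi>\<close>
  (\<open>berkovich_line_eq\<close>).
\<close>

section \<open>Homomorphisms of rational function fields\<close>

lemma is_hom_simps: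
  assumes "is_hom h"
  shows "h 1 = 1" "h (a + b) = h a + h b" "h (a * b) = h a * h b" "h 0 = 0"
    "h (a ^ n) = h a ^ n"
proof -
  show "h 1 = 1" "h (a + b) = h a + h b" "h (a * b) = h a * h b" "h 0 = 0"
    using assms is_hom_0[OF assms] by (auto simp: is_hom_def)
  then show "h (a ^ n) = h a ^ n"
    using assms by (induction n) (auto simp: is_hom_def)
qed

lemma is_hom_minus: "is_hom h \<Longrightarrow> h (a - b) = h a - h b"
  using is_hom_simps(2)[of h "a - b" b] by (simp add: algebra_simps)

lemma is_hom_compose: "is_hom g \<Longrightarrow> is_hom h \<Longrightarrow> is_hom (\<lambda>a. g (h a))"
  by (simp add: is_hom_def)

lemma is_hom_eq_0_iff:
  fixes h :: "'a::field \<Rightarrow> 'b::comm_ring_1"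
  assumes "is_hom h"
  shows "h a = 0 \<longleftrightarrow> a = 0"
proof
  assume "h a = 0"
  show "a = 0"
  proof (rule ccontr)
    assume "a \<noteq> 0"
    then have "h a * h (inverse a) = 1"
      using is_hom_simps[OF assms] by (metis right_inverse)
    then show False using \<open>h a = 0\<close> by simp
  qed
qed (use is_hom_simps[OF assms] in simp)

lemma is_hom_eq_iff:
  fixes h :: "'a::field \<Rightarrow> 'b::comm_ring_1"
  assumes "is_hom h"
  shows "h a = h b \<longleftrightarrow> a = b"
  using is_hom_eq_0_iff[OF assms, of "a - b"] is_hom_minus[OF assms, of a b] by simp

lemma is_hom_inverse:
  fixes h :: "'a::field \<Rightarrow> 'b::field"
  assumes "is_hom h"
  shows "h (inverse a) = inverse (h a)"
proof (cases "a = 0")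
  case False
  then have "h a * h (inverse a) = 1"
    using is_hom_simps[OF assms] by (metis right_inverse)
  then show ?thesis by (metis inverse_unique)
qed (use is_hom_simps[OF assms] in simp)

lemma is_hom_divide:
  fixes h :: "'a::field \<Rightarrow> 'b::field"
  assumes "is_hom h"
  shows "h (a / b) = h a / h b"
  by (simp add: divide_inverse is_hom_simps[OF assms] is_hom_inverse[OF assms])

lemma euclidean_bezout:
  fixes a b :: "'a::euclidean_ring"
  assumes "coprime a b"
  obtains u v where "u * a + v * b = 1"
proof -
  have "\<exists>u v. u * a + v * b = 1" using assms
  proof (induction "euclidean_size b" arbitrary: a b rule: less_induct)
    case less
    show ?case
    proof (cases "b = 0")
      case True
      then have "is_unit a" using less.prems by (simp add: coprime_def)
      then obtain c where "1 = a * c" by blast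
      then have "c * a + 0 * b = 1" by (simp add: mult.commute)
      then show ?thesis by blast
    next
      case False
      have "coprime b (a mod b)"
        unfolding coprime_def
        using less.prems by (auto simp: dvd_mod_iff intro: coprime_common_divisor)
      then obtain u v where "u * b + v * (a mod b) = 1"
        using less.hyps[of "a mod b" b] mod_size_less[OF False] by blast
      then have "v * a + (u - v * (a div b)) * b = 1"
        by (simp add: minus_div_mult_eq_mod[symmetric] algebra_simps)
      then show ?thesis by blast
    qed
  qed
  then show thesis using that by blast
qed

text \<open>
  The condition \<open>\<exists>u v. u * a + v * b = 1\<close> is multiplicative in \<open>a\<close>, as one sees by multiplying two such
  identities; by symmetry it is multiplicative in \<open>b\<close> too.
\<close>

lemma euclidean_bezout_powers:
  fixes a b :: "'a::euclidean_ring"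
  assumes "coprime a b"
  obtains u v where "u * a ^ m + v * b ^ n = 1"
proof -
  have step: "\<exists>u v. u * a ^ m + v * b = 1" if ex: "\<exists>u v. u * a + v * b = 1" for a b :: 'a and m
  proof -
    obtain u v where 1: "u * a + v * b = 1" using ex by blast
    show ?thesis
    proof (induction m)
      case 0
      show ?case by (rule exI[of _ 1], rule exI[of _ 0]) simp
    next
      case (Suc m)
      then obtain u' v' where "u' * a ^ m + v' * b = 1" by blast
      then have "(u * a + v * b) * (u' * a ^ m + v' * b) = 1" using 1 by simp
      then have "(u * u') * a ^ Suc m + (u * a * v' + v * u' * a ^ m + v * b * v') * b = 1"
        by (simp add: algebra_simps)
      then show ?case by blast
    qed
  qed
  obtain u v where "u * a + v * b = 1" using euclidean_bezout[OF assms] .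
  then obtain u v where "u * a ^ m + v * b = 1" using step by blast
  then have "v * b + u * a ^ m = 1" by (simp add: add.commute)
  then obtain u v where "v * b ^ n + u * a ^ m = 1" using step by blast
  then have "u * a ^ m + v * b ^ n = 1" by (simp add: add.commute)
  then show thesis by (rule that)
qed

text \<open>
  Euclid's lemma for powers, from the Bezout identity for \<open>a ^ m\<close> and \<open>b ^ n\<close>.
\<close>

lemma coprime_powers_dvd_mult:
  fixes a b :: "'a::euclidean_ring"
  assumes "coprime a b" "a ^ m dvd c * b ^ n"
  shows "a ^ m dvd c"
proof -
  obtain u v where "u * a ^ m + v * b ^ n = 1" using euclidean_bezout_powers[OF assms(1)] .
  then have "c = c * (u * a ^ m + v * b ^ n)" by simp
  also have "\<dots> = c * u * a ^ m + v * (c * b ^ n)" by (simp add: algebra_simps)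
  also have "a ^ m dvd \<dots>" by (rule dvd_add[OF dvd_triv_right dvd_mult[OF assms(2)]])
  finally show ?thesis .
qed

lemma is_hom_rat_const: "is_hom (rat_const :: 'a::field \<Rightarrow> _)"
  by (simp add: is_hom_def rat_const_def One_fract_def one_pCons mult.commute)

lemma Fract_pCons: "Fract (pCons c p) 1 = rat_const c + rat_var * Fract p (1 :: 'a::field poly)"
  by (simp add: rat_const_def rat_var_def)

lemma Fract_eq_divide: "Fract p q = Fract p 1 / Fract q (1 :: 'a::idom poly)"
  by simp

lemma rat_var_neq_const: "rat_var \<noteq> rat_const (c :: 'a::field)"
  by (simp add: rat_var_def rat_const_def eq_fract)

lemma poly_map_hom_pCons:
  assumes "is_hom h"
  shows "poly (map_poly h (pCons c p)) s = h c + s * poly (map_poly h p) s"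
  using is_hom_simps(4)[OF assms] by (cases "c = 0 \<and> p = 0") (auto simp: map_poly_pCons)

lemma poly_map_rat_const_var: "poly (map_poly rat_const p) rat_var = Fract p (1 :: 'a::field poly)"
proof (induction p)
  case (pCons c p)
  then show ?case
    by (simp add: poly_map_hom_pCons[OF is_hom_rat_const] Fract_pCons)
qed (simp add: Zero_fract_def)

text \<open>
  Composites of coefficient changes and pullbacks are identified by this principle, so that no
  computation with numerators and denominators is necessary.
\<close>

lemma rat_hom_eqI:
  fixes F G :: "'a::field poly fract \<Rightarrow> 'b::field"
  assumes "is_hom F" "is_hom G" "\<And>c. F (rat_const c) = G (rat_const c)" "F rat_var = G rat_var"
  shows "F f = G f"
proof -
  have poly: "F (Fract p 1) = G (Fract p 1)" for p
  proof (induction p)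
    case 0
    then show ?case
      using is_hom_simps(4)[OF assms(1)] is_hom_simps(4)[OF assms(2)] by (simp flip: Zero_fract_def)
  next
    case (pCons c p)
    then show ?case
      unfolding Fract_pCons is_hom_simps[OF assms(1)] is_hom_simps[OF assms(2)] by (simp add: assms(3,4))
  qed
  obtain p q where "f = Fract p q" by (cases f)
  then show ?thesis
    unfolding Fract_eq_divide[of p q]
    by (simp only: is_hom_divide[OF assms(1)] is_hom_divide[OF assms(2)] poly)
qed

text \<open>
  Here \<open>rat_eval\<close> is a coefficient change \<open>K(y) \<rightarrow> L(y)\<close>, which is always meaningful because \<open>y\<close> is
  transcendental over \<open>L\<close>.
\<close>

lemma rat_map_hom:
  fixes h :: "'a::field \<Rightarrow> 'b::field"
  assumes "is_hom h"
  shows "is_hom (rat_eval (\<lambda>c. rat_const (h c)) rat_var)"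
    "rat_eval (\<lambda>c. rat_const (h c)) rat_var (rat_const c) = rat_const (h c)"
    "rat_eval (\<lambda>c. rat_const (h c)) rat_var rat_var = rat_var"
    "q \<noteq> 0 \<Longrightarrow> rat_eval (\<lambda>c. rat_const (h c)) rat_var (Fract p q) = Fract (map_poly h p) (map_poly h q)"
proof -
  have eq: "poly (map_poly (\<lambda>c. rat_const (h c)) p) rat_var = Fract (map_poly h p) 1" for p
  proof -
    have "map_poly (\<lambda>c. rat_const (h c)) p = map_poly rat_const (map_poly h p)"
      by (rule poly_eqI) (simp add: coeff_map_poly is_hom_simps[OF is_hom_rat_const] is_hom_simps[OF assms])
    then show ?thesis by (simp add: poly_map_rat_const_var)
  qed
  have nz: "map_poly h p \<noteq> 0" if "p \<noteq> 0" for p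
    using that is_hom_eq_0_iff[OF assms] by (subst map_poly_eq_0_iff) (auto simp: is_hom_simps[OF assms])
  have tr: "poly (map_poly (\<lambda>c. rat_const (h c)) p) rat_var \<noteq> 0" if "p \<noteq> 0" for p
    using nz[OF that] by (simp add: eq Zero_fract_def eq_fract)
  note hom = is_hom_compose[OF is_hom_rat_const assms]
  show "is_hom (rat_eval (\<lambda>c. rat_const (h c)) rat_var)"
    "rat_eval (\<lambda>c. rat_const (h c)) rat_var (rat_const c) = rat_const (h c)"
    "rat_eval (\<lambda>c. rat_const (h c)) rat_var rat_var = rat_var"
    using rat_eval_hom[OF hom tr] by auto
  show "rat_eval (\<lambda>c. rat_const (h c)) rat_var (Fract p q) = Fract (map_poly h p) (map_poly h q)"
    if "q \<noteq> 0"
    using rat_eval_Fract[OF hom tr that] by (simp add: eq)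
qed

text \<open>
  The summand \<open>b * r\<close> collects the terms below the leading one, each of which keeps a factor \<open>b\<close>.
\<close>

lemma clear_denominators:
  fixes a b :: "'a::field poly"
  assumes "b \<noteq> 0"
  shows "\<exists>r. poly (map_poly rat_const p) (Fract a b) * Fract (b ^ degree p) 1
    = Fract (smult (lead_coeff p) (a ^ degree p) + b * r) 1"
proof (induction p)
  case 0
  show ?case by (rule exI[of _ 0]) (simp add: Zero_fract_def eq_fract)
next
  case (pCons c p)
  show ?case
  proof (cases "p = 0")
    case True
    then show ?thesis unfolding poly_map_hom_pCons[OF is_hom_rat_const]
      by (intro exI[of _ 0]) (simp add: rat_const_def)
  next
    case False
    from pCons obtain r where
      r: "poly (map_poly rat_const p) (Fract a b) * Fract (b ^ degree p) 1
        = Fract (smult (lead_coeff p) (a ^ degree p) + b * r) 1" by blast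
    have split: "Fract (b ^ Suc (degree p)) 1 = Fract b 1 * Fract (b ^ degree p) 1" by simp
    have "poly (map_poly rat_const (pCons c p)) (Fract a b) * Fract (b ^ degree (pCons c p)) 1
        = rat_const c * Fract (b ^ Suc (degree p)) 1
          + (Fract a b * Fract b 1) * (poly (map_poly rat_const p) (Fract a b) * Fract (b ^ degree p) 1)"
      using False split
      by (simp add: poly_map_hom_pCons[OF is_hom_rat_const] algebra_simps del: mult_fract power_Suc)
    also have "Fract a b * Fract b 1 = Fract a 1"
      using assms by (simp add: eq_fract)
    also have "rat_const c * Fract (b ^ Suc (degree p)) 1 + Fract a 1
        * (poly (map_poly rat_const p) (Fract a b) * Fract (b ^ degree p) 1)
      = Fract (smult (lead_coeff p) (a ^ Suc (degree p)) + b * (smult c (b ^ degree p) + a * r)) 1"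
      unfolding r by (simp add: rat_const_def algebra_simps)
    finally show ?thesis using False by (intro exI) simp
  qed
qed

text \<open>
  A non-constant rational function \<open>a / b\<close> in lowest terms is transcendental over the constants:
  clearing denominators in an algebraic equation of degree \<open>n\<close> shows \<open>b dvd a ^ n\<close>, so \<open>b\<close> is a
  unit, and a non-constant polynomial cannot satisfy an algebraic equation for degree reasons.
\<close>

lemma nonconstant_transcendental:
  fixes s :: "'a::field poly fract"
  assumes "\<And>c. s \<noteq> rat_const c" "p \<noteq> 0"
  shows "poly (map_poly rat_const p) s \<noteq> 0"
proof
  assume root: "poly (map_poly rat_const p) s = 0"
  obtain a b where ab: "num_den s = (a, b)" by fastforce
  note nd = num_den[OF ab]
  obtain r where "Fract (smult (lead_coeff p) (a ^ degree p) + b * r) 1 = (0 :: 'a poly fract)"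
    using clear_denominators[OF nd(2), of p a] root by (auto simp: nd(1))
  then have "smult (lead_coeff p) (a ^ degree p) = b * (- r)"
    by (simp add: Zero_fract_def eq_fract add_eq_0_iff)
  then have "b dvd smult (lead_coeff p) (a ^ degree p)" by (metis dvd_triv_left)
  then have "b dvd a ^ degree p" using assms(2) by (simp add: dvd_smult_iff)
  then have "b ^ 1 dvd 1 * a ^ degree p" by simp
  then have "is_unit b" using coprime_powers_dvd_mult[of b a 1 1 "degree p"] nd(3) by (simp add: coprime_commute)
  then obtain c where c: "b = [:c:]" using is_unit_poly_iff by blast
  then have c0: "c \<noteq> 0" using nd(2) by simp
  define a' where "a' = smult (inverse c) a"
  have s: "s = Fract a' 1" using c c0 by (simp add: nd(1) eq_fract a'_def)
  have "poly (map_poly rat_const p) (Fract a' 1) = Fract (pcompose p a') 1" for p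
  proof (induction p)
    case (pCons c p)
    show ?case
      unfolding poly_map_hom_pCons[OF is_hom_rat_const] pCons.IH
      by (simp add: pcompose_pCons rat_const_def)
  qed (simp add: Zero_fract_def)
  then have "pcompose p a' = 0" using root by (simp add: s Zero_fract_def eq_fract)
  moreover have "degree a' > 0"
  proof (rule ccontr)
    assume "\<not> ?thesis"
    then obtain d where "a' = [:d:]" using degree_eq_zeroE[of a'] by auto
    then show False using assms(1)[of d] s by (simp add: rat_const_def)
  qed
  ultimately show False using assms(2) by (simp add: pcompose_eq_0)
qed

lemma rat_eval_hom_nonconstant:
  fixes s :: "'b::field poly fract"
  assumes "is_hom h" "\<And>c. s \<noteq> rat_const c"
  shows "is_hom (rat_eval (\<lambda>c. rat_const (h c)) s)"
    "rat_eval (\<lambda>c. rat_const (h c)) s (rat_const c) = rat_const (h c)"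
    "rat_eval (\<lambda>c. rat_const (h c)) s rat_var = s"
proof -
  have tr: "poly (map_poly (\<lambda>c. rat_const (h c)) p) s \<noteq> 0" if "p \<noteq> 0" for p
  proof -
    have "map_poly (\<lambda>c. rat_const (h c)) p = map_poly rat_const (map_poly h p)"
      by (rule poly_eqI) (simp add: coeff_map_poly is_hom_simps[OF is_hom_rat_const] is_hom_simps[OF assms(1)])
    moreover have "map_poly h p \<noteq> 0"
      using that is_hom_eq_0_iff[OF assms(1)] by (subst map_poly_eq_0_iff) (auto simp: is_hom_simps[OF assms(1)])
    ultimately show ?thesis using nonconstant_transcendental[OF assms(2)] by simp
  qed
  note hom = is_hom_compose[OF is_hom_rat_const assms(1)]
  show "is_hom (rat_eval (\<lambda>c. rat_const (h c)) s)"
    "rat_eval (\<lambda>c. rat_const (h c)) s (rat_const c) = rat_const (h c)"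
    "rat_eval (\<lambda>c. rat_const (h c)) s rat_var = s"
    using rat_eval_hom[OF hom tr] by auto
qed

text \<open>
  Non-constancy survives an extension of the coefficient field: if \<open>p = d * q\<close> with a factor \<open>d\<close> from
  the larger field, then \<open>d\<close> is a quotient of coefficients of \<open>p\<close> and \<open>q\<close>, so it lies in the smaller one.
\<close>

lemma rat_map_nonconstant:
  fixes h :: "'a::field \<Rightarrow> 'b::field"
  assumes "is_hom h" "\<And>c. f \<noteq> rat_const c"
  shows "rat_eval (\<lambda>c. rat_const (h c)) rat_var f \<noteq> rat_const d"
proof
  assume *: "rat_eval (\<lambda>c. rat_const (h c)) rat_var f = rat_const d"
  obtain p q where pq: "f = Fract p q" "q \<noteq> 0" by (cases f)
  note h = is_hom_simps[OF assms(1)]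
  have "map_poly h q \<noteq> 0"
    using pq(2) is_hom_eq_0_iff[OF assms(1)] by (subst map_poly_eq_0_iff) (auto simp: h)
  moreover have "Fract (map_poly h p) (map_poly h q) = Fract [:d:] 1"
    using * pq rat_map_hom(4)[OF assms(1) pq(2)] by (simp add: rat_const_def)
  ultimately have "map_poly h p = smult d (map_poly h q)"
    by (simp add: eq_fract)
  then have co: "h (coeff p i) = d * h (coeff q i)" for i
    by (metis coeff_map_poly coeff_smult h(4))
  define c where "c = coeff p (degree q) / lead_coeff q"
  have "d = h c"
    using co[of "degree q"] pq(2) is_hom_eq_0_iff[OF assms(1), of "lead_coeff q"]
    by (simp add: c_def is_hom_divide[OF assms(1)])
  then have "h (coeff p i) = h (c * coeff q i)" for i
    using co[of i] by (simp add: h)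
  then have "p = smult c q"
    by (intro poly_eqI) (simp add: is_hom_eq_iff[OF assms(1)])
  then have "f = rat_const c"
    using pq by (simp add: rat_const_def eq_fract)
  then show False using assms(2) by blast
qed

section \<open>An intrinsic description of the Berkovich line\<close>

text \<open>
  The axioms treat a point as an absolute value on \<open>K(y)\<close> with values in \<open>[0, \<infinity>]\<close>, in the manner of a
  place: multiplicativity is required away from \<open>\<infinity>\<close>, which avoids the ambiguous product \<open>0 * \<infinity>\<close>, and
  the last axiom makes the inverse of a function vanish at its poles. Unlike the description by numerators and
  denominators, these conditions visibly pass from \<open>\<zeta>\<close> to \<open>\<zeta> \<circ> \<Phi>\<close> for a field homomorphism \<open>\<Phi>\<close> that
  preserves the absolute value of constants.
\<close>

definition projective_seminorm :: "real \<Rightarrow> 'a::field berkovich_point \<Rightarrow> bool" where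
  "projective_seminorm r \<zeta> \<longleftrightarrow>
     (\<forall>c. \<zeta> (rat_const c) = ennreal (cp_abs r c)) \<and>
     (\<forall>f g. \<zeta> (f + g) \<le> \<zeta> f + \<zeta> g) \<and>
     (\<forall>f g. \<zeta> f \<noteq> \<infinity> \<longrightarrow> \<zeta> g \<noteq> \<infinity> \<longrightarrow> \<zeta> (f * g) = \<zeta> f * \<zeta> g) \<and>
     (\<forall>f. \<zeta> f = \<infinity> \<longrightarrow> \<zeta> (inverse f) = 0)"

lemma cp_abs_0 [simp]: "cp_abs r 0 = 0"
  by (simp add: cp_abs_def)

lemma cp_abs_1 [simp]: "cp_abs r (1 :: 'a::idom cpuiseux) = 1" if "0 < r"
  using cp_abs_mult[of r "1 :: 'a cpuiseux" 1] cp_abs_eq_0[OF that, of "1 :: 'a cpuiseux"] by auto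

lemma multiplicative_seminormD:
  assumes "0 < r" "multiplicative_seminorm r \<nu>"
  shows "0 \<le> \<nu> p" "\<nu> (p + q) \<le> \<nu> p + \<nu> q" "\<nu> (p * q) = \<nu> p * \<nu> q" "\<nu> [:c:] = cp_abs r c"
    "\<nu> 0 = 0" "\<nu> 1 = 1"
proof -
  show *: "0 \<le> \<nu> p" "\<nu> (p + q) \<le> \<nu> p + \<nu> q" "\<nu> (p * q) = \<nu> p * \<nu> q" "\<nu> [:c:] = cp_abs r c" for p q c
    using assms(2) by (auto simp: multiplicative_seminorm_def)
  show "\<nu> 0 = 0" using *(4)[of 0] assms(1) by simp
  show "\<nu> 1 = 1" using *(4)[of 1] assms(1) by (simp add: one_pCons)
qed

text \<open>
  A Bezout identity bounds \<open>1 = \<parallel>1\<parallel>\<close> by multiples of \<open>\<nu> p\<close> and \<open>\<nu> q\<close>.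
\<close>

lemma multiplicative_seminorm_coprime:
  assumes "0 < r" "multiplicative_seminorm r \<nu>" "coprime p q" "\<nu> q = 0"
  shows "\<nu> p \<noteq> 0"
proof
  assume "\<nu> p = 0"
  obtain u v where "u * p + v * q = 1" using euclidean_bezout[OF assms(3)] .
  then have "1 \<le> \<nu> (u * p) + \<nu> (v * q)"
    using multiplicative_seminormD(2,6)[OF assms(1,2)] by metis
  then show False
    using \<open>\<nu> p = 0\<close> assms(4) by (simp add: multiplicative_seminormD[OF assms(1,2)])
qed

text \<open>
  Lowest terms may be replaced by any representation whose denominator has non-zero seminorm, so sums
  and products of fractions can be evaluated without cancelling.
\<close>

lemma affine_point_Fract:
  assumes "0 < r" "multiplicative_seminorm r \<nu>" "\<nu> b \<noteq> 0"
  shows "affine_point \<nu> (Fract a b) = ennreal (\<nu> a / \<nu> b)"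
proof -
  note \<nu> = multiplicative_seminormD[OF assms(1,2)]
  have b: "b \<noteq> 0" using assms(3) \<nu>(5) by auto
  obtain p q where pq: "num_den (Fract a b) = (p, q)" by fastforce
  note nd = num_den[OF pq]
  have "a * q = p * b" using nd(1,2) b by (simp add: eq_fract)
  then have eq: "\<nu> a * \<nu> q = \<nu> p * \<nu> b" using \<nu>(3) by metis
  have "\<nu> q \<noteq> 0"
    using multiplicative_seminorm_coprime[OF assms(1,2) nd(3)] eq assms(3) by auto
  moreover from this have "\<nu> p / \<nu> q = \<nu> a / \<nu> b" using assms(3) eq by (simp add: field_simps)
  ultimately show ?thesis
    using \<nu>(1)[of p] \<nu>(1)[of q] by (simp add: affine_point_def pq divide_ennreal)
qed

lemma affine_point_finite:
  assumes "0 < r" "multiplicative_seminorm r \<nu>" "affine_point \<nu> f \<noteq> \<infinity>"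
  obtains a b where "f = Fract a b" "\<nu> b \<noteq> 0"
proof -
  obtain p q where pq: "num_den f = (p, q)" by fastforce
  note nd = num_den[OF pq]
  have "\<nu> q \<noteq> 0"
  proof
    assume q: "\<nu> q = 0"
    then have "\<nu> p > 0"
      using multiplicative_seminorm_coprime[OF assms(1,2) nd(3)] multiplicative_seminormD(1)[OF assms(1,2), of p]
      by (simp add: less_le)
    then show False using assms(3) q by (simp add: affine_point_def pq)
  qed
  then show thesis by (rule that[OF nd(1)])
qed

lemma affine_point_infinite:
  assumes "0 < r" "multiplicative_seminorm r \<nu>" "affine_point \<nu> f = \<infinity>"
  obtains a b where "f = Fract a b" "b \<noteq> 0" "\<nu> a \<noteq> 0" "\<nu> b = 0"
proof -
  obtain p q where pq: "num_den f = (p, q)" by fastforce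
  note nd = num_den[OF pq]
  have q: "\<nu> q = 0"
  proof (rule ccontr)
    assume "\<nu> q \<noteq> 0"
    then show False
      using assms(3) affine_point_Fract[OF assms(1,2), of q p] by (simp add: nd(1))
  qed
  show thesis
    by (rule that[OF nd(1,2) multiplicative_seminorm_coprime[OF assms(1,2) nd(3) q] q])
qed

lemma projective_seminorm_affine_point:
  assumes "0 < r" "multiplicative_seminorm r \<nu>"
  shows "projective_seminorm r (affine_point \<nu>)"
  unfolding projective_seminorm_def
proof (intro conjI allI impI)
  note \<nu> = multiplicative_seminormD[OF assms] and ev = affine_point_Fract[OF assms]
  show "affine_point \<nu> (rat_const c) = ennreal (cp_abs r c)" for c
    unfolding rat_const_def by (subst ev) (simp_all add: \<nu>)
  fix f g
  show "affine_point \<nu> (f + g) \<le> affine_point \<nu> f + affine_point \<nu> g"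
  proof (cases "affine_point \<nu> f = \<infinity> \<or> affine_point \<nu> g = \<infinity>")
    case False
    obtain a b where f: "f = Fract a b" "\<nu> b \<noteq> 0"
      using affine_point_finite[OF assms, where f = f] False by blast
    obtain c d where g: "g = Fract c d" "\<nu> d \<noteq> 0"
      using affine_point_finite[OF assms, where f = g] False by blast
    have nz: "b \<noteq> 0" "d \<noteq> 0" "\<nu> b > 0" "\<nu> d > 0"
      using f g \<nu>(5) \<nu>(1)[of b] \<nu>(1)[of d] by (auto simp: less_le)
    have "\<nu> (a * d + c * b) / \<nu> (b * d) \<le> (\<nu> (a * d) + \<nu> (c * b)) / \<nu> (b * d)"
      by (rule divide_right_mono) (rule \<nu>)+
    also have "\<dots> = \<nu> a / \<nu> b + \<nu> c / \<nu> d"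
      unfolding \<nu>(3) using nz by (subst add_frac_eq) auto
    finally have le: "\<nu> (a * d + c * b) / \<nu> (b * d) \<le> \<nu> a / \<nu> b + \<nu> c / \<nu> d" .
    have "affine_point \<nu> (f + g) = ennreal (\<nu> (a * d + c * b) / \<nu> (b * d))"
      using nz by (simp add: f(1) g(1) ev \<nu>(3))
    also have "\<dots> \<le> ennreal (\<nu> a / \<nu> b + \<nu> c / \<nu> d)"
      using le by (rule ennreal_leI)
    also have "\<dots> = affine_point \<nu> f + affine_point \<nu> g"
      using f g by (simp add: ev \<nu>(1))
    finally show ?thesis .
  qed auto
  show "affine_point \<nu> (f * g) = affine_point \<nu> f * affine_point \<nu> g"
    if fin: "affine_point \<nu> f \<noteq> \<infinity>" "affine_point \<nu> g \<noteq> \<infinity>"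
  proof -
    obtain a b where f: "f = Fract a b" "\<nu> b \<noteq> 0" by (rule affine_point_finite[OF assms fin(1)])
    obtain c d where g: "g = Fract c d" "\<nu> d \<noteq> 0" by (rule affine_point_finite[OF assms fin(2)])
    have "affine_point \<nu> (f * g) = ennreal (\<nu> (a * c) / \<nu> (b * d))"
      using f g by (simp add: ev \<nu>(3))
    also have "\<nu> (a * c) / \<nu> (b * d) = (\<nu> a / \<nu> b) * (\<nu> c / \<nu> d)" by (simp add: \<nu>(3))
    also have "ennreal \<dots> = ennreal (\<nu> a / \<nu> b) * ennreal (\<nu> c / \<nu> d)"
      by (rule ennreal_mult) (simp_all add: \<nu>(1))
    finally show ?thesis using f g by (simp add: ev)
  qed
  show "affine_point \<nu> (inverse f) = 0" if inf: "affine_point \<nu> f = \<infinity>"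
  proof -
    obtain a b where "f = Fract a b" "\<nu> a \<noteq> 0" "\<nu> b = 0"
      by (rule affine_point_infinite[OF assms inf])
    then show ?thesis by (simp add: ev)
  qed
qed

lemma coeff_mult_bounded_degree:
  assumes "degree p \<le> m" "degree q \<le> n"
  shows "coeff (p * q) (m + n) = coeff p m * coeff q n"
proof -
  have "(\<Sum>i\<le>m + n. coeff p i * coeff q (m + n - i)) = (\<Sum>i\<in>{m}. coeff p i * coeff q (m + n - i))"
  proof (rule sum.mono_neutral_right)
    show "\<forall>i\<in>{..m + n} - {m}. coeff p i * coeff q (m + n - i) = 0"
    proof
      fix i assume "i \<in> {..m + n} - {m}"
      then have "i > degree p \<or> m + n - i > degree q" using assms by auto
      then show "coeff p i * coeff q (m + n - i) = 0" by (auto simp: coeff_eq_0)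
    qed
  qed auto
  then show ?thesis by (simp add: coeff_mult)
qed

text \<open>
  For a fixed denominator the value is the absolute value of an expression that is linear in the
  numerator \<open>a\<close>; reading off the coefficient at \<open>degree b\<close>, not the leading one, covers the case of a zero
  at \<open>\<infinity>\<close> as well.
\<close>

lemma infinity_point_Fract:
  assumes "0 < r" "b \<noteq> 0"
  shows "infinity_point r (Fract a b) =
    (if degree a \<le> degree b then ennreal (cp_abs r (coeff a (degree b) / lead_coeff b)) else \<infinity>)"
proof -
  obtain p q where pq: "num_den (Fract a b) = (p, q)" by fastforce
  note nd = num_den[OF pq]
  have eq: "a * q = p * b" using nd(1,2) assms(2) by (simp add: eq_fract)
  show ?thesis
  proof (cases "a = 0")
    case True
    then have "p = 0" using eq assms(2) by simp
    then show ?thesis using True assms pq by (simp add: infinity_point_def)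
  next
    case False
    then have "p \<noteq> 0" using eq nd(2) by auto
    have deg: "degree a + degree q = degree p + degree b"
      using eq False \<open>p \<noteq> 0\<close> assms(2) nd(2) by (metis degree_mult_eq)
    have "lead_coeff a * lead_coeff q = lead_coeff p * lead_coeff b"
      using eq by (metis lead_coeff_mult)
    then have "lead_coeff p / lead_coeff q = lead_coeff a / lead_coeff b"
      using assms(2) nd(2) by (simp add: field_simps)
    then show ?thesis
      using deg assms
      by (cases "degree p" "degree q" rule: linorder_cases) (auto simp: infinity_point_def pq coeff_eq_0)
  qed
qed

lemma projective_seminorm_infinity_point:
  assumes "0 < r" "r < 1"
  shows "projective_seminorm r (infinity_point r :: 'a::field berkovich_point)"
  unfolding projective_seminorm_def
proof (intro conjI allI impI)
  note ev = infinity_point_Fract[OF assms(1)]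
  show "infinity_point r (rat_const c) = ennreal (cp_abs r c)" for c :: "'a cpuiseux"
    unfolding rat_const_def by (subst ev) simp_all
  fix f g :: "'a cpuiseux poly fract"
  obtain a b where f: "f = Fract a b" "b \<noteq> 0" by (cases f)
  obtain c d where g: "g = Fract c d" "d \<noteq> 0" by (cases g)
  have deg: "degree (b * d) = degree b + degree d" using f g by (simp add: degree_mult_eq)
  show "infinity_point r (f + g) \<le> infinity_point r f + infinity_point r g"
  proof (cases "degree a \<le> degree b \<and> degree c \<le> degree d")
    case True
    have "degree (a * d + c * b) \<le> degree b + degree d"
      using True by (intro degree_add_le order_trans[OF degree_mult_le]) auto
    moreover have "coeff (a * d + c * b) (degree b + degree d) / lead_coeff (b * d)
        = coeff a (degree b) / lead_coeff b + coeff c (degree d) / lead_coeff d"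
      using True f(2) g(2) coeff_mult_bounded_degree[of a "degree b" d "degree d"]
        coeff_mult_bounded_degree[of c "degree d" b "degree b"]
      by (simp add: lead_coeff_mult add.commute field_simps)
    moreover have "cp_abs r (u + v) \<le> cp_abs r u + cp_abs r v" for u v :: "'a cpuiseux"
      using cp_abs_triangle[OF assms, of u v] cp_abs_nonneg[of r u] cp_abs_nonneg[of r v] by simp
    ultimately show ?thesis
      using True f g deg by (simp add: ev cp_abs_nonneg flip: ennreal_plus)
  qed (use f g in \<open>auto simp: ev\<close>)
  show "infinity_point r (f * g) = infinity_point r f * infinity_point r g"
    if "infinity_point r f \<noteq> \<infinity>" "infinity_point r g \<noteq> \<infinity>"
  proof -
    have le: "degree a \<le> degree b" "degree c \<le> degree d"
      using that f g by (auto simp: ev split: if_splits)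
    have "degree (a * c) \<le> degree b + degree d"
      using le by (intro order_trans[OF degree_mult_le]) auto
    then show ?thesis
      using le f g deg
      by (simp add: ev lead_coeff_mult coeff_mult_bounded_degree cp_abs_nonneg flip: ennreal_mult cp_abs_mult)
  qed
  show "infinity_point r (inverse f) = 0" if "infinity_point r f = \<infinity>"
  proof -
    have "degree b < degree a" using that f by (auto simp: ev split: if_splits)
    moreover from this have "a \<noteq> 0" by auto
    ultimately show ?thesis using f assms by (simp add: ev coeff_eq_0)
  qed
qed

text \<open>
  If \<open>\<parallel>y\<parallel>\<close> is finite, then so is the seminorm of every polynomial, and it remains to recover the value of
  a fraction. When the denominator has seminorm zero, the numerator has not, and a finite value of the
  fraction would contradict multiplicativity.
\<close>

lemma projective_seminorm_affine:
  assumes r: "0 < r" and \<zeta>: "projective_seminorm r \<zeta>" and fin: "\<zeta> rat_var \<noteq> \<infinity>"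
  shows "\<zeta> \<in> affine_point ` {\<nu>. multiplicative_seminorm r \<nu>}"
proof -
  have const: "\<zeta> (rat_const c) = ennreal (cp_abs r c)" for c
    using \<zeta> by (auto simp: projective_seminorm_def)
  have add: "\<zeta> (f + g) \<le> \<zeta> f + \<zeta> g" for f g
    using \<zeta> by (auto simp: projective_seminorm_def)
  have mult: "\<zeta> f \<noteq> \<infinity> \<Longrightarrow> \<zeta> g \<noteq> \<infinity> \<Longrightarrow> \<zeta> (f * g) = \<zeta> f * \<zeta> g" for f g
    using \<zeta> by (auto simp: projective_seminorm_def)
  have inv: "\<zeta> f = \<infinity> \<Longrightarrow> \<zeta> (inverse f) = 0" for f
    using \<zeta> by (auto simp: projective_seminorm_def)
  have one: "\<zeta> 1 = 1" using const[of 1] r by (simp add: is_hom_simps[OF is_hom_rat_const])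
  have poly_fin: "\<zeta> (Fract p 1) \<noteq> \<infinity>" for p
  proof (induction p)
    case 0
    show ?case using const[of 0] r by (simp add: is_hom_simps[OF is_hom_rat_const] Zero_fract_def)
  next
    case (pCons c p)
    have "\<zeta> (Fract (pCons c p) 1) \<le> \<zeta> (rat_const c) + \<zeta> (rat_var * Fract p 1)"
      unfolding Fract_pCons by (rule add)
    also have "\<dots> < \<infinity>"
      using fin pCons.IH by (simp add: const mult ennreal_mult_less_top less_top)
    finally show ?case by simp
  qed
  define \<nu> where "\<nu> p = enn2real (\<zeta> (Fract p 1))" for p
  have \<nu>: "\<zeta> (Fract p 1) = ennreal (\<nu> p)" for p
    using poly_fin[of p] by (simp add: \<nu>_def ennreal_enn2real_if)
  have \<nu>_nonneg: "0 \<le> \<nu> p" for p by (simp add: \<nu>_def)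
  have ms: "multiplicative_seminorm r \<nu>"
    unfolding multiplicative_seminorm_def
  proof (intro conjI allI)
    fix p q c
    show "\<nu> (p + q) \<le> \<nu> p + \<nu> q"
      using add[of "Fract p 1" "Fract q 1"] by (simp add: \<nu> \<nu>_nonneg flip: ennreal_plus)
    show "\<nu> (p * q) = \<nu> p * \<nu> q"
      using mult[of "Fract p 1" "Fract q 1"] poly_fin by (simp add: \<nu> \<nu>_nonneg flip: ennreal_mult)
    show "\<nu> [:c:] = cp_abs r c"
      using const[of c] by (simp add: \<nu>_def rat_const_def cp_abs_nonneg)
  qed (rule \<nu>_nonneg)
  have "\<zeta> f = affine_point \<nu> f" for f
  proof -
    consider (fin) a b where "f = Fract a b" "\<nu> b \<noteq> 0"
      | (inf) a b where "f = Fract a b" "b \<noteq> 0" "\<nu> a \<noteq> 0" "\<nu> b = 0" "affine_point \<nu> f = \<infinity>"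
      using affine_point_finite[OF r ms, of f] affine_point_infinite[OF r ms, of f] by metis
    then show ?thesis
    proof cases
      case (fin a b)
      have b: "b \<noteq> 0" using fin multiplicative_seminormD(5)[OF r ms] by auto
      let ?i = "inverse (Fract b 1)"
      have "?i * Fract b 1 = 1" using b by (simp add: One_fract_def eq_fract)
      moreover have "\<zeta> ?i \<noteq> \<infinity>"
        using inv[of ?i] \<nu>[of b] fin(2) \<nu>_nonneg[of b] by (auto simp del: inverse_fract)
      ultimately have "\<zeta> ?i * ennreal (\<nu> b) = 1"
        using mult[of ?i "Fract b 1"] poly_fin by (simp add: one \<nu> del: inverse_fract)
      moreover obtain t where t: "\<zeta> ?i = ennreal t" "t \<ge> 0"
        using \<open>\<zeta> ?i \<noteq> \<infinity>\<close> by (cases "\<zeta> ?i") auto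
      ultimately have "t * \<nu> b = 1"
        using \<nu>_nonneg[of b] by (simp flip: ennreal_mult)
      then have "t = 1 / \<nu> b" using fin(2) by (simp add: field_simps)
      moreover have "f = Fract a 1 * ?i" using fin(1) by simp
      ultimately have "\<zeta> f = ennreal (\<nu> a / \<nu> b)"
        using mult[of "Fract a 1" ?i] \<open>\<zeta> ?i \<noteq> \<infinity>\<close> poly_fin[of a] t \<nu>_nonneg
        by (simp add: \<nu> del: inverse_fract mult_fract flip: ennreal_mult)
      then show ?thesis using affine_point_Fract[OF r ms fin(2)] fin(1) by simp
    next
      case (inf a b)
      then have "f * Fract b 1 = Fract a 1" by (simp add: eq_fract)
      then have "\<zeta> f = \<infinity>"
        using mult[of f "Fract b 1"] poly_fin[of b] \<nu>[of a] \<nu>[of b] inf(3,4) \<nu>_nonneg[of a]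
        by (metis ennreal_0 ennreal_eq_0_iff mult_zero_right order_antisym)
      then show ?thesis using inf(5) by simp
    qed
  qed
  then have "\<zeta> = affine_point \<nu>" by (rule ext)
  then show ?thesis using ms by blast
qed

text \<open>
  If \<open>\<parallel>y\<parallel> = \<infinity>\<close>, then \<open>w = 1/y\<close> has seminorm \<open>0\<close>; dividing a polynomial of degree at most \<open>n\<close> by
  \<open>y\<^sup>n\<close> turns it into a polynomial in \<open>w\<close>, so that only its coefficient of degree \<open>n\<close> counts.
\<close>

lemma projective_seminorm_infinity:
  assumes r: "0 < r" and \<zeta>: "projective_seminorm r \<zeta>" and inf: "\<zeta> rat_var = \<infinity>"
  shows "\<zeta> = infinity_point r"
proof
  have const: "\<zeta> (rat_const c) = ennreal (cp_abs r c)" for c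
    using \<zeta> by (auto simp: projective_seminorm_def)
  have add: "\<zeta> (f + g) \<le> \<zeta> f + \<zeta> g" for f g
    using \<zeta> by (auto simp: projective_seminorm_def)
  have mult: "\<zeta> f \<noteq> \<infinity> \<Longrightarrow> \<zeta> g \<noteq> \<infinity> \<Longrightarrow> \<zeta> (f * g) = \<zeta> f * \<zeta> g" for f g
    using \<zeta> by (auto simp: projective_seminorm_def)
  have inv: "\<zeta> f = \<infinity> \<Longrightarrow> \<zeta> (inverse f) = 0" for f
    using \<zeta> by (auto simp: projective_seminorm_def)
  have one: "\<zeta> 1 = 1" using const[of 1] r by (simp add: is_hom_simps[OF is_hom_rat_const])
  have null_add: "\<zeta> (f + g) = \<zeta> g" if "\<zeta> f = 0" for f g
  proof (rule antisym)
    show "\<zeta> (f + g) \<le> \<zeta> g" using add[of f g] that by simp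
    have "- f = rat_const (- 1) * f"
      using is_hom_minus[OF is_hom_rat_const, of 0 "1 :: 'a cpuiseux"]
      by (simp add: is_hom_simps[OF is_hom_rat_const])
    then have "\<zeta> (- f) = 0" using mult[of "rat_const (- 1)" f] that by (simp add: const)
    then show "\<zeta> g \<le> \<zeta> (f + g)" using add[of "f + g" "- f"] by simp
  qed
  have rv: "rat_var \<noteq> (0 :: 'a cpuiseux poly fract)"
    using rat_var_neq_const[of 0] by (simp add: is_hom_simps[OF is_hom_rat_const])
  define w where "w = inverse (rat_var :: 'a cpuiseux poly fract)"
  have w: "\<zeta> w = 0" unfolding w_def by (rule inv[OF inf])
  have wpow: "\<zeta> (w ^ n) = (if n = 0 then 1 else 0)" for n
    by (induction n) (auto simp: one mult w)
  have reduced: "\<zeta> (Fract p 1 * w ^ n) = ennreal (cp_abs r (coeff p n))" if "degree p \<le> n" for p n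
    using that
  proof (induction n arbitrary: p)
    case 0
    then obtain c where "p = [:c:]" by (auto elim: degree_eq_zeroE)
    then show ?case using const[of c] by (simp add: rat_const_def)
  next
    case (Suc n)
    obtain c q where p: "p = pCons c q" by (cases p)
    have q: "degree q \<le> n" using Suc.prems by (auto simp: p split: if_splits)
    have "rat_var * w = 1" using rv by (simp add: w_def)
    then have "Fract p 1 * w ^ Suc n = rat_const c * w ^ Suc n + Fract q 1 * w ^ n"
      unfolding p Fract_pCons by (simp add: algebra_simps)
    moreover have "\<zeta> (rat_const c * w ^ Suc n) = 0"
      using mult[of "rat_const c" "w ^ Suc n"] wpow[of "Suc n"] by (simp add: const)
    ultimately show ?case using null_add Suc.IH[OF q] by (simp add: p)
  qed
  have le: "\<zeta> (Fract p q) = ennreal (cp_abs r (coeff p (degree q) / lead_coeff q))"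
    if pq: "degree p \<le> degree q" "q \<noteq> 0" for p q
  proof -
    let ?n = "degree q"
    let ?u = "Fract p 1 * w ^ ?n" and ?v = "Fract q 1 * w ^ ?n"
    have "Fract q 1 \<noteq> 0" using pq(2) by (simp add: Zero_fract_def eq_fract)
    then have nz: "?v \<noteq> 0" using rv by (simp add: w_def)
    have lq: "0 < cp_abs r (lead_coeff q)"
      using pq r cp_abs_eq_0[OF r, of "lead_coeff q"] cp_abs_nonneg[of r "lead_coeff q"] by (simp add: less_le)
    have fin: "\<zeta> (inverse ?v) \<noteq> \<infinity>"
      using inv[of "inverse ?v"] reduced[of q ?n] lq by auto
    then obtain t where t: "\<zeta> (inverse ?v) = ennreal t" "t \<ge> 0" by (cases "\<zeta> (inverse ?v)") auto
    have "\<zeta> (inverse ?v * ?v) = \<zeta> (inverse ?v) * \<zeta> ?v"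
      using fin reduced[of q ?n] by (intro mult) auto
    moreover have "inverse ?v * ?v = 1" using nz by (rule left_inverse)
    ultimately have tq: "t * cp_abs r (lead_coeff q) = 1"
      using reduced[of q ?n] t by (simp add: one cp_abs_nonneg flip: ennreal_mult)
    have "cp_abs r (coeff p ?n) = cp_abs r (coeff p ?n / lead_coeff q) * cp_abs r (lead_coeff q)"
      using pq(2) by (simp flip: cp_abs_mult)
    then have "cp_abs r (coeff p ?n) * t
        = cp_abs r (coeff p ?n / lead_coeff q) * (t * cp_abs r (lead_coeff q))"
      by (simp only: mult_ac)
    then have val: "cp_abs r (coeff p ?n) * t = cp_abs r (coeff p ?n / lead_coeff q)"
      by (simp only: tq mult_1_right)
    have "Fract p q = Fract p 1 * w ^ ?n / (Fract q 1 * w ^ ?n)"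
      using rv unfolding w_def by (subst Fract_eq_divide) (simp del: divide_fract)
    then have "Fract p q = ?u * inverse ?v" by (simp only: divide_inverse)
    then have "\<zeta> (Fract p q) = \<zeta> ?u * \<zeta> (inverse ?v)"
      using mult[of ?u "inverse ?v"] fin reduced[OF pq(1)] by simp
    then show ?thesis
      using reduced[OF pq(1)] t val by (simp add: cp_abs_nonneg flip: ennreal_mult)
  qed
  fix f :: "'a cpuiseux poly fract"
  obtain p q where f: "f = Fract p q" "q \<noteq> 0" by (cases f)
  show "\<zeta> f = infinity_point r f"
  proof (cases "degree p \<le> degree q")
    case True
    then show ?thesis using le[OF True f(2)] f infinity_point_Fract[OF r f(2)] by simp
  next
    case False
    then have p: "p \<noteq> 0" by auto
    have "\<zeta> (inverse f) = 0"
      using le[of q p] False p f r by (simp add: coeff_eq_0)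
    moreover have "f * inverse f = 1" using f p by (simp add: One_fract_def eq_fract)
    ultimately have "\<zeta> f = \<infinity>" using mult[of f "inverse f"] one by (metis ennreal_zero_neq_top infinity_ennreal_def mult_zero_right zero_neq_one)
    then show ?thesis using False f infinity_point_Fract[OF r f(2)] by simp
  qed
qed

theorem berkovich_line_eq:
  assumes "0 < r" "r < 1"
  shows "berkovich_line r = {\<zeta>. projective_seminorm r \<zeta>}"
  unfolding berkovich_line_def
  using projective_seminorm_affine_point[OF assms(1)] projective_seminorm_infinity_point[OF assms]
    projective_seminorm_affine[OF assms(1)] projective_seminorm_infinity[OF assms(1)]
  by blast

section \<open>The Galois group as a group of characters\<close>

text \<open>
  Linear factors of \<open>p\<close> over the small field can be split off until one of them vanishes at \<open>u\<close>.
\<close>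

lemma algebraic_over_alg_closed:
  fixes h :: "'a::alg_closed_field \<Rightarrow> 'b::field"
  assumes "is_hom h" "p \<noteq> 0" "poly (map_poly h p) u = 0"
  shows "\<exists>c. u = h c"
  using assms(2,3)
proof (induction "degree p" arbitrary: p rule: less_induct)
  case less
  show ?case
  proof (cases "degree p = 0")
    case True
    then obtain c where "p = [:c:]" by (rule degree_eq_zeroE)
    then show ?thesis
      using less.prems is_hom_eq_0_iff[OF assms(1), of c] by (simp add: poly_map_hom_pCons[OF assms(1)])
  next
    case False
    then obtain x where "poly p x = 0" using alg_closed_imp_poly_has_root by blast
    then obtain q where p: "p = [:- x, 1:] * q" by (auto simp: poly_eq_0_iff_dvd)
    have q: "q \<noteq> 0" using less.prems p by auto
    then have "degree p = Suc (degree q)" unfolding p by (subst degree_mult_eq) auto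
    moreover have "poly (map_poly h [:- x, 1:]) u = u - h x"
      using is_hom_minus[OF assms(1), of 0 x]
      by (simp add: poly_map_hom_pCons[OF assms(1)] is_hom_simps[OF assms(1)])
    then have "u = h x \<or> poly (map_poly h q) u = 0"
      using less.prems(2) unfolding p poly_map_poly_hom(2)[OF assms(1)] by simp
    ultimately show ?thesis using less.hyps[of q] q by auto
  qed
qed

lemma cp_monom_mult: "cp_monom c p * cp_monom d q = cp_monom (c * d) (p + q :: rat)"
  by (rule cp_eqI) (simp add: cp_nth_monom_mult cp_nth_monom)

lemma cp_monom_power: "cp_monom c q ^ n = cp_monom (c ^ n) (of_nat n * q)"
  by (induction n) (simp_all add: one_cpuiseux_def cp_monom_mult algebra_simps)

lemma cp_monom_of_int: "cp_monom c (of_int i) = cp_of_fls (fls_shift (- i) (fls_const c))"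
proof (rule cp_eqI)
  fix q
  show "cp_nth (cp_monom c (of_int i)) q = cp_nth (cp_of_fls (fls_shift (- i) (fls_const c))) q"
    by (cases "q \<in> \<int>")
      (auto simp: cp_nth_monom cp_of_fls_nth_int cp_of_fls_nth_nonint elim!: Ints_cases)
qed

definition cp_trunc :: "rat \<Rightarrow> 'a::comm_monoid_add cpuiseux \<Rightarrow> 'a cpuiseux" where
  "cp_trunc N a = (\<Sum>q\<in>{q. q \<le> N \<and> cp_nth a q \<noteq> 0}. cp_monom (cp_nth a q) q)"

lemma cp_nth_trunc: "cp_nth (cp_trunc N a) q = (if q \<le> N then cp_nth a q else 0)"
proof -
  have "cp_nth (cp_trunc N a) q
      = (\<Sum>p\<in>{q. q \<le> N \<and> cp_nth a q \<noteq> 0}. if q = p then cp_nth a p else 0)"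
    by (simp add: cp_trunc_def cp_nth_sum cp_nth_monom)
  also have "\<dots> = (if q \<le> N then cp_nth a q else 0)"
    using cp_finite[of N a] by (subst sum.delta') auto
  finally show ?thesis .
qed

lift_definition cp_twist :: "(rat \<Rightarrow> 'a::mult_zero) \<Rightarrow> 'a cpuiseux \<Rightarrow> 'a cpuiseux"
  is "\<lambda>w f q. w q * f q"
proof -
  fix w f :: "rat \<Rightarrow> 'a" assume f: "left_finite f"
  show "left_finite (\<lambda>q. w q * f q)"
    unfolding left_finite_def
  proof
    fix N
    have "{q. q \<le> N \<and> w q * f q \<noteq> 0} \<subseteq> {q. q \<le> N \<and> f q \<noteq> 0}" by auto
    then show "finite {q. q \<le> N \<and> w q * f q \<noteq> 0}"
      using f finite_subset unfolding left_finite_def by blast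
  qed
qed

lemma cp_nth_twist [simp]: "cp_nth (cp_twist w a) q = w q * cp_nth a q"
  by transfer simp

text \<open>Characters of \<open>\<rat>/\<int>\<close> are the compatible systems of roots of unity.\<close>

definition root_character :: "(rat \<Rightarrow> 'a::field) \<Rightarrow> bool" where
  "root_character w \<longleftrightarrow> (\<forall>p q. w (p + q) = w p * w q) \<and> (\<forall>q\<in>\<int>. w q = 1)"

lemma root_characterD:
  assumes "root_character w"
  shows "w (p + q) = w p * w q" "q \<in> \<int> \<Longrightarrow> w q = 1" "w q \<noteq> 0" "w p * w (q - p) = w q"
proof -
  show *: "w (p + q) = w p * w q" "q \<in> \<int> \<Longrightarrow> w q = 1" for p q
    using assms by (auto simp: root_character_def)
  show "w p * w (q - p) = w q" using *(1)[of p "q - p"] by simp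
  show "w q \<noteq> 0" using *(1)[of q "- q"] *(2)[of 0] by auto
qed

lemma root_character_1: "root_character (\<lambda>_. 1)"
  by (simp add: root_character_def)

lemma root_character_mult:
  "root_character w \<Longrightarrow> root_character v \<Longrightarrow> root_character (\<lambda>q. w q * v q)"
  by (simp add: root_character_def)

lemma root_character_inverse: "root_character w \<Longrightarrow> root_character (\<lambda>q. inverse (w q))"
  by (simp add: root_character_def)

lemma cp_twist_1 [simp]: "cp_twist (\<lambda>_. 1) a = (a :: 'a::field cpuiseux)"
  by (rule cp_eqI) simp

lemma cp_twist_twist: "cp_twist w (cp_twist v a) = cp_twist (\<lambda>q. w q * v q :: 'a::field) a"
  by (rule cp_eqI) (simp add: mult.assoc)

lemma cp_twist_inverse:
  assumes "root_character w"
  shows "cp_twist w (cp_twist (\<lambda>q. inverse (w q)) a) = a" "cp_twist (\<lambda>q. inverse (w q)) (cp_twist w a) = a"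
  using root_characterD(3)[OF assms] by (simp_all add: cp_twist_twist)

lemma is_hom_cp_twist:
  assumes "root_character (w :: rat \<Rightarrow> 'a::field)"
  shows "is_hom (cp_twist w)"
  unfolding is_hom_def
proof (intro conjI allI)
  note w = root_characterD[OF assms]
  show "cp_twist w 1 = 1" by (rule cp_eqI) (simp add: cp_nth_1 w)
  fix a b :: "'a cpuiseux"
  show "cp_twist w (a + b) = cp_twist w a + cp_twist w b"
    by (rule cp_eqI) (simp add: algebra_simps)
  show "cp_twist w (a * b) = cp_twist w a * cp_twist w b"
  proof (rule cp_eqI)
    fix q
    let ?A = "{p. cp_nth a p \<noteq> 0 \<and> cp_nth b (q - p) \<noteq> 0}"
    have A: "finite ?A" by (rule cp_conv_finite)
    have "cp_nth (cp_twist w a * cp_twist w b) q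
        = (\<Sum>p\<in>?A. cp_nth (cp_twist w a) p * cp_nth (cp_twist w b) (q - p))"
      by (rule cp_nth_mult_superset[OF A]) auto
    also have "\<dots> = (\<Sum>p\<in>?A. w q * (cp_nth a p * cp_nth b (q - p)))"
    proof (rule sum.cong[OF refl])
      fix p
      show "cp_nth (cp_twist w a) p * cp_nth (cp_twist w b) (q - p) = w q * (cp_nth a p * cp_nth b (q - p))"
        unfolding cp_nth_twist w(4)[of p q, symmetric] by (simp only: mult_ac)
    qed
    also have "\<dots> = cp_nth (cp_twist w (a * b)) q"
      by (simp add: cp_nth_mult_superset[OF A] sum_distrib_left)
    finally show "cp_nth (cp_twist w (a * b)) q = cp_nth (cp_twist w a * cp_twist w b) q" ..
  qed
qed

lemma cp_twist_cp_of_fls: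
  assumes "root_character w"
  shows "cp_twist w (cp_of_fls f) = cp_of_fls f"
proof (rule cp_eqI)
  fix q show "cp_nth (cp_twist w (cp_of_fls f)) q = cp_nth (cp_of_fls f) q"
    using root_characterD(2)[OF assms, of q] by (cases "q \<in> \<int>") (auto simp: cp_of_fls_nth_nonint)
qed

lemma cp_abs_eqI: "(\<And>q. cp_nth a q = 0 \<longleftrightarrow> cp_nth b q = 0) \<Longrightarrow> cp_abs r a = cp_abs r b"
  by (simp add: cp_abs_def cp_ord_def) (metis cp_eqI cp_nth_0)

lemma cp_twist_puiseux:
  assumes "a \<in> puiseux"
  shows "cp_twist w (a :: 'a::field cpuiseux) \<in> puiseux"
proof -
  obtain n where n: "n > 0" "\<And>q. cp_nth a q \<noteq> 0 \<Longrightarrow> of_nat n * q \<in> \<int>"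
    using assms by (auto simp: puiseux_def)
  then have "\<forall>q. cp_nth (cp_twist w a) q \<noteq> 0 \<longrightarrow> of_nat n * q \<in> \<int>" by simp
  with n(1) show ?thesis by (auto simp: puiseux_def)
qed

lemma cp_twist_galois:
  assumes "0 < r" "r < 1" "root_character (w :: rat \<Rightarrow> 'a::field)"
  shows "cp_twist w \<in> galois r"
proof -
  interpret M: Metric_space UNIV "cp_dist r :: 'a cpuiseux \<Rightarrow> _" by (rule cp_Metric_space[OF assms(1,2)])
  note hom = is_hom_cp_twist[OF assms(3)]
  have "bij_betw (cp_twist w) puiseux puiseux"
    by (rule bij_betw_byWitness[where f' = "cp_twist (\<lambda>q. inverse (w q))"])
      (auto simp: cp_twist_inverse[OF assms(3)] cp_twist_puiseux)
  moreover have "cp_dist r (cp_twist w a) (cp_twist w b) = cp_dist r a b" for a b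
    unfolding cp_dist_def is_hom_minus[OF hom, symmetric]
    by (rule cp_abs_eqI) (simp add: root_characterD(3)[OF assms(3)])
  then have "continuous_map (cp_topology r) (cp_topology r) (cp_twist w)"
    unfolding M.metric_continuous_map[OF M.Metric_space_axioms] by auto
  ultimately show ?thesis
    by (simp add: galois_def puiseux_automorphism_def is_hom_simps[OF hom] cp_twist_cp_of_fls[OF assms(3)])
qed

lemma cp_monom_puiseux: "cp_monom c q \<in> puiseux"
proof -
  obtain a b where q: "q = of_int a / of_int b" "b > 0"
    by (cases q) (auto simp: Fract_of_int_quotient)
  then have "of_nat (nat b) * q = (of_int a :: rat)" by simp
  then have "of_nat (nat b) * q \<in> \<int>" by (simp only: Ints_of_int)
  then have "\<forall>p. cp_nth (cp_monom c q) p \<noteq> 0 \<longrightarrow> of_nat (nat b) * p \<in> \<int>"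
    by (simp add: cp_nth_monom)
  with q(2) show ?thesis unfolding puiseux_def by (auto intro!: exI[of _ "nat b"])
qed

lemma puiseux_add:
  assumes "a \<in> puiseux" "b \<in> puiseux"
  shows "a + b \<in> (puiseux :: 'a::comm_monoid_add cpuiseux set)"
proof -
  obtain m where m: "m > 0" "\<And>q. cp_nth a q \<noteq> 0 \<Longrightarrow> of_nat m * q \<in> \<int>"
    using assms(1) by (auto simp: puiseux_def)
  obtain n where n: "n > 0" "\<And>q. cp_nth b q \<noteq> 0 \<Longrightarrow> of_nat n * q \<in> \<int>"
    using assms(2) by (auto simp: puiseux_def)
  have "of_nat (m * n) * q \<in> \<int>" if "cp_nth (a + b) q \<noteq> 0" for q
  proof -
    have "cp_nth a q \<noteq> 0 \<or> cp_nth b q \<noteq> 0" using that by auto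
    then have "of_nat n * (of_nat m * q) \<in> \<int> \<or> of_nat m * (of_nat n * q) \<in> \<int>"
      using m(2) n(2) by (meson Ints_mult Ints_of_nat)
    then show ?thesis by (simp add: mult_ac)
  qed
  moreover have "m * n > 0" using m n by simp
  ultimately show ?thesis unfolding puiseux_def by blast
qed

lemma cp_sum_monom_puiseux: "(\<Sum>q\<in>A. cp_monom (f q) q) \<in> (puiseux :: 'a::comm_monoid_add cpuiseux set)"
proof (induction A rule: infinite_finite_induct)
  case (insert x A)
  then show ?case by (simp add: puiseux_add cp_monom_puiseux)
qed (auto simp: puiseux_def)

text \<open>
  An automorphism \<open>\<sigma>\<close> over \<open>k((x))\<close> fixes \<open>(x\<^sup>q)\<^sup>d\<close> when \<open>d * q\<close> is an integer. Hence \<open>\<sigma>(x\<^sup>q) / x\<^sup>q\<close> is a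
  \<open>d\<close>-th root of unity, so it lies in \<open>k\<close> because \<open>k\<close> is algebraically closed; call it \<open>w q\<close>. Then \<open>\<sigma>\<close>
  and the twist by \<open>w\<close> agree on finite sums of monomials, and by density and continuity everywhere.
\<close>

lemma galois_cp_twist:
  fixes \<sigma> :: "'a::alg_closed_field cpuiseux \<Rightarrow> 'a cpuiseux"
  assumes "0 < r" "r < 1" "\<sigma> \<in> galois r"
  obtains w where "root_character w" "\<sigma> = cp_twist w"
proof -
  interpret M: Metric_space UNIV "cp_dist r :: 'a cpuiseux \<Rightarrow> _" by (rule cp_Metric_space[OF assms(1,2)])
  have add: "\<sigma> (a + b) = \<sigma> a + \<sigma> b" if "a \<in> puiseux" "b \<in> puiseux" for a b
    using assms(3) that by (auto simp: galois_def puiseux_automorphism_def)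
  have mult: "\<sigma> (a * b) = \<sigma> a * \<sigma> b" if "a \<in> puiseux" "b \<in> puiseux" for a b
    using assms(3) that by (auto simp: galois_def puiseux_automorphism_def)
  have fls: "\<sigma> (cp_of_fls c) = cp_of_fls c" for c
    using assms(3) by (auto simp: galois_def puiseux_automorphism_def)
  have cont: "continuous_map (cp_topology r) (cp_topology r) \<sigma>"
    using assms(3) by (simp add: galois_def)
  have zero: "\<sigma> 0 = 0" using fls[of 0] by (simp add: is_hom_0[OF is_hom_cp_of_fls])
  have monom_int: "\<sigma> (cp_monom c q) = cp_monom c q" if "q \<in> \<int>" for c q
    using that by (auto elim!: Ints_cases simp: cp_monom_of_int fls)
  define h where "h c = cp_of_fls (fls_const c)" for c :: 'a
  have hom_const: "is_hom h"
    unfolding h_def by (rule is_hom_compose[OF is_hom_cp_of_fls])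
      (simp add: is_hom_def fls_plus_const fls_const_mult_const)
  have const: "h c = cp_monom c 0" for c
    using cp_monom_of_int[of c 0] by (simp add: h_def)
  define w where "w q = cp_nth (\<sigma> (cp_monom 1 q)) q" for q
  have \<sigma>_monom1: "\<sigma> (cp_monom 1 q) = cp_monom (w q) q" for q
  proof -
    obtain a b where q: "q = of_int a / of_int b" "b > 0"
      by (cases q) (auto simp: Fract_of_int_quotient)
    let ?d = "nat b" and ?X = "cp_monom (1 :: 'a) q"
    have dq: "of_nat ?d * q = of_int a" using q by simp
    have X: "?X \<noteq> 0" by (metis cp_nth_0 cp_nth_monom zero_neq_one)
    have "\<sigma> (?X ^ n) = \<sigma> ?X ^ n" for n
    proof (induction n)
      case 0
      show ?case using monom_int[of 0 1] by (simp add: one_cpuiseux_def)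
    next
      case (Suc n)
      then show ?case by (simp add: mult cp_monom_puiseux cp_monom_power)
    qed
    moreover have "\<sigma> (?X ^ ?d) = ?X ^ ?d"
      unfolding cp_monom_power dq by (rule monom_int) simp
    moreover define u where "u = \<sigma> ?X / ?X"
    ultimately have "u ^ ?d = 1" using X by (simp add: power_divide)
    have "poly (map_poly h (monom 1 ?d - 1)) u = poly (monom 1 ?d - 1) u"
    proof -
      have "map_poly h (monom 1 ?d - 1) = monom 1 ?d - 1"
        by (rule poly_eqI)
          (simp add: coeff_map_poly is_hom_simps(1,4)[OF hom_const] is_hom_minus[OF hom_const])
      then show ?thesis by simp
    qed
    also have "\<dots> = 0" using \<open>u ^ ?d = 1\<close> by (simp add: poly_monom)
    finally have root: "poly (map_poly h (monom 1 ?d - 1)) u = 0" .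
    have "coeff (monom 1 ?d - 1 :: 'a poly) ?d = 1" using q(2) by simp
    then have "monom 1 ?d - 1 \<noteq> (0 :: 'a poly)" by (metis coeff_0 zero_neq_one)
    then obtain c where "u = h c"
      using algebraic_over_alg_closed[OF hom_const _ root] by blast
    then have "\<sigma> ?X = cp_monom c 0 * ?X" using X by (simp add: u_def const field_simps)
    then have "\<sigma> ?X = cp_monom c q" by (simp add: cp_monom_mult)
    moreover from this have "w q = c" by (simp add: w_def cp_nth_monom)
    ultimately show ?thesis by simp
  qed
  have w: "root_character w"
    unfolding root_character_def
  proof (intro conjI allI ballI)
    fix p q
    have "\<sigma> (cp_monom 1 (p + q)) = \<sigma> (cp_monom 1 p * cp_monom 1 q)"
      by (simp add: cp_monom_mult)
    also have "\<dots> = cp_monom (w p * w q) (p + q)"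
      unfolding mult[OF cp_monom_puiseux cp_monom_puiseux] \<sigma>_monom1 by (rule cp_monom_mult)
    finally have "cp_nth (cp_monom (w (p + q)) (p + q)) (p + q) = cp_nth (cp_monom (w p * w q) (p + q)) (p + q)"
      by (simp only: \<sigma>_monom1)
    then show "w (p + q) = w p * w q" by (simp add: cp_nth_monom)
  qed (simp add: w_def monom_int cp_nth_monom)
  note hom = is_hom_cp_twist[OF w]
  have \<sigma>_monom: "\<sigma> (cp_monom c q) = cp_twist w (cp_monom c q)" for c q
  proof -
    have "\<sigma> (cp_monom c q) = \<sigma> (cp_monom c 0 * cp_monom 1 q)" by (simp add: cp_monom_mult)
    also have "\<dots> = cp_monom c 0 * cp_monom (w q) q"
      by (simp add: mult cp_monom_puiseux \<sigma>_monom1 monom_int)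
    also have "\<dots> = cp_twist w (cp_monom c q)"
      by (rule cp_eqI) (simp add: cp_monom_mult cp_nth_monom)
    finally show ?thesis .
  qed
  have \<sigma>_sum: "\<sigma> (\<Sum>q\<in>A. cp_monom (f q) q) = cp_twist w (\<Sum>q\<in>A. cp_monom (f q) q)" for A f
    by (induction A rule: infinite_finite_induct)
      (simp_all add: zero is_hom_simps[OF hom] add cp_monom_puiseux cp_sum_monom_puiseux \<sigma>_monom)
  have "\<sigma> a = cp_twist w a" for a
  proof (rule cp_eqI)
    fix p
    have "0 < r powr of_rat p" using assms(1) by simp
    then obtain d where d: "d > 0" "\<And>b. cp_dist r a b < d \<Longrightarrow> cp_dist r (\<sigma> a) (\<sigma> b) < r powr of_rat p"
      using cont unfolding M.metric_continuous_map[OF M.Metric_space_axioms] by (metis UNIV_I)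
    obtain n :: nat where n: "r powr of_rat (of_nat n) < d"
      using cp_small_exponent[OF assms(1,2) d(1)] .
    \<comment> \<open>The truncation must be close to \<open>a\<close>, but must also retain the coefficient at \<open>p\<close>.\<close>
    define t where "t = cp_trunc (max (of_nat n) p) a"
    have "cp_dist r a t < d"
      unfolding cp_dist_def
      by (rule cp_abs_lessI[OF assms(1,2) n]) (simp add: t_def cp_nth_trunc)
    then have "cp_abs r (\<sigma> a - \<sigma> t) < r powr of_rat p"
      using d(2) by (simp add: cp_dist_def)
    then have "cp_nth (\<sigma> a - \<sigma> t) p = 0"
      by (rule cp_abs_lessD[OF assms(1,2)]) simp
    then have "cp_nth (\<sigma> a) p = cp_nth (\<sigma> t) p" by simp
    also have "\<sigma> t = cp_twist w t"
      unfolding t_def cp_trunc_def by (rule \<sigma>_sum)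
    also have "cp_nth \<dots> p = cp_nth (cp_twist w a) p" by (simp add: t_def cp_nth_trunc)
    finally show "cp_nth (\<sigma> a) p = cp_nth (cp_twist w a) p" .
  qed
  then have "\<sigma> = cp_twist w" by (rule ext)
  with w show thesis by (rule that)
qed

section \<open>Substitution into completed Puiseux series\<close>

text \<open>
  Compatibility of the chosen roots makes \<open>root_power\<close> independent of the representation of the
  exponent; a common denominator then turns it into a homomorphism on \<open>\<rat>\<close>.
\<close>

lemma root_power_Fract:
  assumes "compatible_roots l \<Lambda>" "l \<noteq> 0" "b > 0"
  shows "root_power \<Lambda> (of_int a / of_nat b) = \<Lambda> b powi a" "\<Lambda> b \<noteq> 0"
proof -
  have root: "\<Lambda> (b * c) ^ c = \<Lambda> b" if "b > 0" "c > 0" for b c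
    using assms(1) that by (auto simp: compatible_roots_def)
  show nz: "\<Lambda> b \<noteq> 0"
    using root[of 1 b] assms by (auto simp: compatible_roots_def)
  obtain u v where uv: "quotient_of (of_int a / of_nat b) = (u, v)" by fastforce
  have v: "v > 0" "of_int a / of_nat b = (of_int u / of_int v :: rat)" "coprime u v"
    using quotient_of_denom_pos[OF uv] quotient_of_div[OF uv] quotient_of_coprime[OF uv] by auto
  have "of_int a * of_int v = (of_int u * of_nat b :: rat)"
    using v assms(3) by (simp add: field_simps)
  then have eq: "a * v = u * int b"
    by (metis of_int_mult of_int_of_nat_eq of_int_eq_iff)
  then have "v dvd int b" using v(3) by (metis coprime_commute coprime_dvd_mult_right_iff dvd_triv_right)
  then obtain c where c: "int b = v * c" by blast
  have "c > 0" using c v(1) assms(3) by (metis of_nat_0_less_iff zero_less_mult_pos)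
  have b: "b = nat v * nat c" using c v(1) \<open>c > 0\<close> by (metis nat_int nat_mult_distrib less_imp_le)
  have "a = u * c" using eq c v(1) by simp
  then have "\<Lambda> b powi a = (\<Lambda> b powi c) powi u" by (simp add: power_int_mult mult.commute[of u])
  also have "\<Lambda> b powi c = \<Lambda> (nat v)"
    using root[of "nat v" "nat c"] v(1) \<open>c > 0\<close> unfolding b by (simp add: power_int_def)
  finally show "root_power \<Lambda> (of_int a / of_nat b) = \<Lambda> b powi a" by (simp add: root_power_def uv)
qed

lemma root_power_props:
  assumes "compatible_roots l \<Lambda>" "l \<noteq> 0"
  shows "root_power \<Lambda> (p + q) = root_power \<Lambda> p * root_power \<Lambda> q" "root_power \<Lambda> q \<noteq> 0" "root_power \<Lambda> 0 = 1"
proof -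
  note rp = root_power_Fract[OF assms]
  have ex: "\<exists>a b. b > 0 \<and> q = of_int a / of_nat b" for q :: rat
  proof -
    obtain a b where "q = of_int a / of_int b" "b > 0"
      by (cases q) (auto simp: Fract_of_int_quotient)
    then show ?thesis by (intro exI[of _ a] exI[of _ "nat b"]) simp
  qed
  obtain a b where p: "b > 0" "p = of_int a / of_nat b" using ex[of p] by blast
  obtain c d where q: "d > 0" "q = of_int c / of_nat d" using ex[of q] by blast
  have bd: "b * d > 0" using p q by simp
  have eqs: "p + q = of_int (a * int d + c * int b) / of_nat (b * d)"
    "p = of_int (a * int d) / of_nat (b * d)" "q = of_int (c * int b) / of_nat (b * d)"
    using p q by (simp_all add: field_simps)
  show "root_power \<Lambda> (p + q) = root_power \<Lambda> p * root_power \<Lambda> q"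
    unfolding eqs(1) by (subst eqs(2), subst eqs(3), unfold rp(1)[OF bd])
      (rule power_int_add, use rp(2)[OF bd] in simp)
  show "root_power \<Lambda> q \<noteq> 0" using rp[OF q(1)] by (simp add: q(2))
  show "root_power \<Lambda> 0 = 1" by (simp add: root_power_def)
qed

lemma skew_monom_mult:
  assumes "skew_endomorphism \<phi>" "compatible_roots (skew_lead \<phi>) \<Lambda>"
  shows "skew_monom \<phi> \<Lambda> p * skew_monom \<phi> \<Lambda> q = skew_monom \<phi> \<Lambda> (p + q)"
proof -
  note d = skew_x_decomp[OF assms(1)]
  let ?B = "\<lambda>q. fps_compose (fps_binomial (of_rat q)) (skew_pert \<phi>)"
  have B: "?B (p + q) = ?B p * ?B q"
    unfolding of_rat_add fps_binomial_add_mult by (rule fps_compose_mult_distrib[OF d(3)])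
  have M: "cp_monom (root_power \<Lambda> (p + q)) (of_nat (skew_order \<phi>) * (p + q))
      = cp_monom (root_power \<Lambda> p) (of_nat (skew_order \<phi>) * p)
        * cp_monom (root_power \<Lambda> q) (of_nat (skew_order \<phi>) * q)"
    by (simp add: cp_monom_mult root_power_props(1)[OF assms(2) d(2)] distrib_left)
  show ?thesis
    unfolding skew_monom_def B M
    by (simp add: fls_times_fps_to_fls is_hom_simps[OF is_hom_cp_of_fls] mult_ac)
qed

lemma skew_monom_0:
  assumes "skew_endomorphism \<phi>" "compatible_roots (skew_lead \<phi>) \<Lambda>"
  shows "skew_monom \<phi> \<Lambda> 0 = 1"
  using root_power_props(3)[OF assms(2) skew_x_decomp(2)[OF assms(1)]]
  by (simp add: skew_monom_def one_cpuiseux_def[symmetric] is_hom_simps[OF is_hom_cp_of_fls])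

lemma skew_monom_lead:
  assumes "skew_endomorphism \<phi>" "compatible_roots (skew_lead \<phi>) \<Lambda>"
  shows "cp_nth (skew_monom \<phi> \<Lambda> q) (of_nat (skew_order \<phi>) * q) \<noteq> 0"
proof -
  note d = skew_x_decomp[OF assms(1)]
  have "cp_nth (skew_monom \<phi> \<Lambda> q) (of_nat (skew_order \<phi>) * q) = root_power \<Lambda> q"
    using cp_of_fls_nth_int[of "fps_to_fls (fps_compose (fps_binomial (of_rat q)) (skew_pert \<phi>))" 0]
    by (simp add: skew_monom_def cp_nth_monom_mult)
  then show ?thesis using root_power_props(2)[OF assms(2) d(2)] by simp
qed

text \<open>
  For \<open>n = 1\<close> the image of \<open>x\<^sup>q\<close> only involves exponents congruent to \<open>q\<close> modulo \<open>\<int>\<close>, and characters of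
  \<open>\<rat>/\<int>\<close> do not distinguish these.
\<close>

lemma skew_monom_exponents:
  assumes "cp_nth (skew_monom \<phi> \<Lambda> q) p \<noteq> 0"
  shows "p - of_nat (skew_order \<phi>) * q \<in> \<int>"
proof (rule ccontr)
  assume "\<not> ?thesis"
  then show False
    using assms by (simp add: skew_monom_def cp_nth_monom_mult cp_of_fls_nth_nonint)
qed

lemma skew_series_nth_superset:
  assumes "skew_endomorphism \<phi>" "finite A"
    "{q. cp_nth a q \<noteq> 0 \<and> cp_nth (skew_monom \<phi> \<Lambda> q) p \<noteq> 0} \<subseteq> A"
  shows "cp_nth (skew_series \<phi> \<Lambda> a) p = (\<Sum>q\<in>A. cp_nth a q * cp_nth (skew_monom \<phi> \<Lambda> q) p)"
  unfolding skew_series_nth[OF assms(1)]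
  by (rule sum.mono_neutral_left) (use assms(2,3) in auto)

lemma skew_series_finite:
  assumes "skew_endomorphism \<phi>"
  shows "finite {q. cp_nth a q \<noteq> 0 \<and> cp_nth (skew_monom \<phi> \<Lambda> q) p \<noteq> 0}"
proof (rule finite_subset[OF _ cp_finite[of "p / of_nat (skew_order \<phi>)" a]], safe)
  fix q assume "cp_nth (skew_monom \<phi> \<Lambda> q) p \<noteq> 0"
  from skew_monom_support[OF this] show "q \<le> p / of_nat (skew_order \<phi>)"
    using skew_x_decomp(1)[OF assms] by (simp add: pos_le_divide_eq mult.commute)
qed

lemma skew_series_add:
  assumes "skew_endomorphism \<phi>"
  shows "skew_series \<phi> \<Lambda> (a + b) = skew_series \<phi> \<Lambda> a + skew_series \<phi> \<Lambda> b"
proof (rule cp_eqI)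
  fix p
  let ?S = "\<lambda>a. {q. cp_nth a q \<noteq> 0 \<and> cp_nth (skew_monom \<phi> \<Lambda> q) p \<noteq> 0}"
  have fin: "finite (?S a \<union> ?S b)" by (simp add: skew_series_finite[OF assms])
  note nth = skew_series_nth_superset[OF assms fin]
  have "cp_nth (skew_series \<phi> \<Lambda> (a + b)) p
      = (\<Sum>q\<in>?S a \<union> ?S b. cp_nth (a + b) q * cp_nth (skew_monom \<phi> \<Lambda> q) p)"
    by (rule nth) auto
  also have "\<dots> = cp_nth (skew_series \<phi> \<Lambda> a) p + cp_nth (skew_series \<phi> \<Lambda> b) p"
    by (subst (1 2) nth) (auto simp: distrib_right sum.distrib)
  finally show "cp_nth (skew_series \<phi> \<Lambda> (a + b)) p = cp_nth (skew_series \<phi> \<Lambda> a + skew_series \<phi> \<Lambda> b) p"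
    by simp
qed

lemma skew_series_sum:
  assumes "skew_endomorphism \<phi>"
  shows "skew_series \<phi> \<Lambda> (\<Sum>i\<in>A. f i) = (\<Sum>i\<in>A. skew_series \<phi> \<Lambda> (f i))"
proof -
  have "skew_series \<phi> \<Lambda> 0 = 0"
    by (rule cp_eqI) (simp add: skew_series_nth[OF assms])
  then show ?thesis
    by (induction A rule: infinite_finite_induct) (simp_all add: skew_series_add[OF assms])
qed

lemma skew_series_low:
  assumes "skew_endomorphism \<phi>" "\<And>q. q < l \<Longrightarrow> cp_nth a q = 0" "p < of_nat (skew_order \<phi>) * l"
  shows "cp_nth (skew_series \<phi> \<Lambda> a) p = 0"
proof -
  have empty: "{q. cp_nth a q \<noteq> 0 \<and> cp_nth (skew_monom \<phi> \<Lambda> q) p \<noteq> 0} = {}"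
  proof safe
    fix q assume q: "cp_nth a q \<noteq> 0" "cp_nth (skew_monom \<phi> \<Lambda> q) p \<noteq> 0"
    have "l \<le> q" using assms(2)[of q] q(1) by force
    then have "of_nat (skew_order \<phi>) * l \<le> of_nat (skew_order \<phi>) * q" by (rule mult_left_mono) simp
    then show "q \<in> {}" using skew_monom_support[OF q(2)] assms(3) by simp
  qed
  show ?thesis unfolding skew_series_nth[OF assms(1)] empty by simp
qed

lemma cp_nth_mult_eq_0:
  assumes "\<And>q. q < l \<Longrightarrow> cp_nth a q = 0" "\<And>q. q < m \<Longrightarrow> cp_nth b q = 0" "q < l + m"
  shows "cp_nth (a * b) q = 0"
  by (rule cp_nth_mult_low(2)[OF _ _ assms(3)]) (use assms(1,2) in force)+

lemma skew_series_mult_sums: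
  assumes "skew_endomorphism \<phi>" "compatible_roots (skew_lead \<phi>) \<Lambda>"
  shows "skew_series \<phi> \<Lambda> ((\<Sum>i\<in>A. cp_monom (f i) i) * (\<Sum>j\<in>B. cp_monom (g j) j))
    = skew_series \<phi> \<Lambda> (\<Sum>i\<in>A. cp_monom (f i) i) * skew_series \<phi> \<Lambda> (\<Sum>j\<in>B. cp_monom (g j) j)"
  unfolding sum_product skew_series_sum[OF assms(1)]
proof (intro sum.cong refl)
  fix i j
  have "skew_series \<phi> \<Lambda> (cp_monom (f i) i * cp_monom (g j) j)
      = cp_const (f i * g j) * skew_monom \<phi> \<Lambda> (i + j)"
    by (simp add: cp_monom_mult skew_series_monom[OF assms(1)])
  also have "\<dots> = (cp_const (f i) * skew_monom \<phi> \<Lambda> i) * (cp_const (g j) * skew_monom \<phi> \<Lambda> j)"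
    unfolding skew_monom_mult[OF assms, symmetric]
    using cp_monom_mult[of "f i" 0 "g j" 0] by (simp add: cp_const_def[symmetric] mult_ac)
  finally show "skew_series \<phi> \<Lambda> (cp_monom (f i) i * cp_monom (g j) j)
      = skew_series \<phi> \<Lambda> (cp_monom (f i) i) * skew_series \<phi> \<Lambda> (cp_monom (g j) j)"
    by (simp add: skew_series_monom[OF assms(1)])
qed

text \<open>
  The coefficient of the product at \<open>p\<close> depends on finitely many terms of \<open>a\<close> and \<open>b\<close>, and for finite sums
  of monomials the claim is \<open>skew_monom_mult\<close>. Truncating at \<open>N\<close> leaves remainders whose products with
  anything supported above \<open>l\<close> only have exponents at least \<open>N + l\<close>, which the substitution multiplies by
  \<open>n\<close>.
\<close>

lemma skew_series_mult:
  assumes "skew_endomorphism \<phi>" "compatible_roots (skew_lead \<phi>) \<Lambda>"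
  shows "skew_series \<phi> \<Lambda> (a * b) = skew_series \<phi> \<Lambda> a * skew_series \<phi> \<Lambda> b"
proof (rule cp_eqI)
  fix p
  let ?n = "of_nat (skew_order \<phi>) :: rat" and ?S = "skew_series \<phi> \<Lambda>"
  have n: "?n > 0" using skew_x_decomp(1)[OF assms(1)] by simp
  note add = skew_series_add[OF assms(1)]
  note low = skew_series_low[OF assms(1)]
  obtain la where la: "\<And>q. cp_nth a q \<noteq> 0 \<Longrightarrow> la \<le> q" using cp_lower_bound[of a] by blast
  obtain lb where lb: "\<And>q. cp_nth b q \<noteq> 0 \<Longrightarrow> lb \<le> q" using cp_lower_bound[of b] by blast
  define l where "l = min la lb"
  \<comment> \<open>Then \<open>?n * (N + l) = p + ?n\<close>, so products with a remainder do not reach the exponent \<open>p\<close>.\<close>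
  define N where "N = p / ?n - l + 1"
  have bound: "p < ?n * (N + l)" using n by (simp add: N_def field_simps)
  define a0 where "a0 = cp_trunc N a"
  define b0 where "b0 = cp_trunc N b"
  define a1 where "a1 = a - a0"
  define b1 where "b1 = b - b0"
  have ab: "a = a0 + a1" "b = b0 + b1" by (simp_all add: a1_def b1_def)
  have supp: "q < N \<Longrightarrow> cp_nth a1 q = 0" "q < N \<Longrightarrow> cp_nth b1 q = 0"
    "q < l \<Longrightarrow> cp_nth a0 q = 0" "q < l \<Longrightarrow> cp_nth b q = 0" for q
    using la[of q] lb[of q]
    by (auto simp: a1_def b1_def a0_def b0_def cp_nth_trunc l_def)
  have zero: "cp_nth (?S (u * v)) p = 0 \<and> cp_nth (?S u * ?S v) p = 0"
    if "\<And>q. q < k \<Longrightarrow> cp_nth u q = 0" "\<And>q. q < m \<Longrightarrow> cp_nth v q = 0" "k + m = N + l" for u v k m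
  proof
    show "cp_nth (?S (u * v)) p = 0"
      by (rule low[of "N + l"]) (use cp_nth_mult_eq_0[OF that(1,2)] that(3) bound in auto)
    show "cp_nth (?S u * ?S v) p = 0"
    proof (rule cp_nth_mult_eq_0[of "?n * k" _ "?n * m"])
      show "p < ?n * k + ?n * m" using bound by (simp add: that(3)[symmetric] distrib_left)
    qed (use low[OF that(1)] low[OF that(2)] in auto)
  qed
  have "cp_nth (?S (a1 * b)) p = 0 \<and> cp_nth (?S a1 * ?S b) p = 0"
    by (rule zero[of N _ l]) (use supp in auto)
  moreover have "cp_nth (?S (a0 * b1)) p = 0 \<and> cp_nth (?S a0 * ?S b1) p = 0"
    by (rule zero[of l _ N]) (use supp in auto)
  moreover have "?S (a0 * b0) = ?S a0 * ?S b0"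
    unfolding a0_def b0_def cp_trunc_def by (rule skew_series_mult_sums[OF assms])
  moreover have "?S (a * b) = ?S (a0 * b0) + ?S (a0 * b1) + ?S (a1 * b)"
  proof -
    have "a * b = a0 * b0 + a0 * b1 + a1 * b"
      unfolding ab(1) by (subst (1) ab(2)) (simp add: algebra_simps ab(2))
    then show ?thesis by (simp add: add)
  qed
  moreover have "?S a * ?S b = ?S a0 * ?S b0 + ?S a0 * ?S b1 + ?S a1 * ?S b"
  proof -
    have "?S a = ?S a0 + ?S a1" "?S b = ?S b0 + ?S b1" by (subst ab, rule add)+
    then show ?thesis by (simp add: algebra_simps)
  qed
  ultimately show "cp_nth (?S (a * b)) p = cp_nth (?S a * ?S b) p" by simp
qed

lemma is_hom_skew_series:
  assumes "skew_endomorphism \<phi>" "compatible_roots (skew_lead \<phi>) \<Lambda>"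
  shows "is_hom (skew_series \<phi> \<Lambda>)"
proof -
  have "skew_series \<phi> \<Lambda> 1 = 1"
    using skew_series_monom[OF assms(1), of \<Lambda> 1 0] skew_monom_0[OF assms]
    by (simp add: cp_const_def one_cpuiseux_def[symmetric])
  then show ?thesis
    by (simp add: is_hom_def skew_series_add[OF assms(1)] skew_series_mult[OF assms])
qed

text \<open>
  Only the lowest term of \<open>a\<close> contributes to the coefficient of \<open>skew_series \<phi> \<Lambda> a\<close> at \<open>cp_ord a\<close>.
\<close>

lemma cp_abs_skew_series:
  assumes "skew_endomorphism \<phi>" "compatible_roots (skew_lead \<phi>) \<Lambda>" "skew_simple \<phi>"
  shows "cp_abs r (skew_series \<phi> \<Lambda> a) = cp_abs r a"
proof (cases "a = 0")
  case True
  then show ?thesis by (simp add: is_hom_0[OF is_hom_skew_series[OF assms(1,2)]])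
next
  case False
  have n: "skew_order \<phi> = 1" using assms(3) by (simp add: skew_simple_def)
  let ?v = "cp_ord a"
  have "cp_nth (skew_series \<phi> \<Lambda> a) ?v = (\<Sum>q\<in>{?v}. cp_nth a q * cp_nth (skew_monom \<phi> \<Lambda> q) ?v)"
  proof (rule skew_series_nth_superset[OF assms(1)])
    show "{q. cp_nth a q \<noteq> 0 \<and> cp_nth (skew_monom \<phi> \<Lambda> q) ?v \<noteq> 0} \<subseteq> {?v}"
      using skew_monom_support[of \<phi> \<Lambda>] cp_ord_le[OF False] by (force simp: n intro: antisym)
  qed simp
  then have v: "cp_nth (skew_series \<phi> \<Lambda> a) ?v \<noteq> 0"
    using cp_nth_ord[OF False] skew_monom_lead[OF assms(1,2), of ?v] by (simp add: n)
  have "cp_ord (skew_series \<phi> \<Lambda> a) = ?v"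
    unfolding cp_ord_def[of "skew_series \<phi> \<Lambda> a"]
  proof (rule Least_equality)
    fix q assume q: "cp_nth (skew_series \<phi> \<Lambda> a) q \<noteq> 0"
    show "?v \<le> q"
    proof (rule ccontr)
      assume "\<not> ?v \<le> q"
      then have "cp_nth (skew_series \<phi> \<Lambda> a) q = 0"
        by (intro skew_series_low[OF assms(1), of ?v]) (use cp_ord_le[OF False] n in force)+
      then show False using q by simp
    qed
  qed (rule v)
  moreover have "skew_series \<phi> \<Lambda> a \<noteq> 0" using v by force
  ultimately show ?thesis using False by (simp add: cp_abs_def)
qed

text \<open>
  Twisting multiplies \<open>x\<^sup>q\<close> by \<open>w q\<close>. The image of \<open>x\<^sup>q\<close> is supported on \<open>q + \<int>\<close>, where \<open>w\<close> is constantly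
  \<open>w q\<close>, so it is multiplied by the same factor. For \<open>n > 1\<close> the support would be \<open>n * q + \<int>\<close> instead.
\<close>

lemma skew_series_twist:
  assumes "skew_endomorphism \<phi>" "skew_simple \<phi>" "root_character w"
  shows "skew_series \<phi> \<Lambda> (cp_twist w a) = cp_twist w (skew_series \<phi> \<Lambda> a)"
proof (rule cp_eqI)
  fix p
  let ?A = "{q. cp_nth a q \<noteq> 0 \<and> cp_nth (skew_monom \<phi> \<Lambda> q) p \<noteq> 0}"
  note w = root_characterD[OF assms(3)]
  have "cp_nth (skew_series \<phi> \<Lambda> (cp_twist w a)) p
      = (\<Sum>q\<in>?A. cp_nth (cp_twist w a) q * cp_nth (skew_monom \<phi> \<Lambda> q) p)"
    by (rule skew_series_nth_superset[OF assms(1) skew_series_finite[OF assms(1)]]) auto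
  also have "\<dots> = (\<Sum>q\<in>?A. w p * (cp_nth a q * cp_nth (skew_monom \<phi> \<Lambda> q) p))"
  proof (rule sum.cong[OF refl])
    fix q assume "q \<in> ?A"
    then have "p - q \<in> \<int>"
      using skew_monom_exponents[of \<phi> \<Lambda> q p] assms(2) by (simp add: skew_simple_def)
    then have "w q = w p" using w(4)[of q p] w(2) by simp
    then show "cp_nth (cp_twist w a) q * cp_nth (skew_monom \<phi> \<Lambda> q) p
        = w p * (cp_nth a q * cp_nth (skew_monom \<phi> \<Lambda> q) p)" by simp
  qed
  also have "\<dots> = cp_nth (cp_twist w (skew_series \<phi> \<Lambda> a)) p"
    by (simp add: skew_series_nth[OF assms(1)] sum_distrib_left)
  finally show "cp_nth (skew_series \<phi> \<Lambda> (cp_twist w a)) p = cp_nth (cp_twist w (skew_series \<phi> \<Lambda> a)) p" .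
qed

section \<open>Endomorphisms of the field of rational functions over Laurent series\<close>

text \<open>
  The group \<open>1 + x k[[x]]\<close> is divisible, thanks to binomial series. This purely algebraic property is what
  forces a skew endomorphism to respect the \<open>x\<close>-adic topology.
\<close>

lemma unit_fps_root:
  fixes u :: "'a::field_char_0 fps"
  assumes "fps_nth u 0 = 1" "n > 0"
  obtains v where "fps_nth v 0 = 1" "v ^ n = u"
proof -
  define v where "v = fps_compose (fps_binomial (1 / of_nat n)) (u - 1)"
  have u0: "fps_nth (u - 1) 0 = 0" using assms(1) by simp
  have "v ^ n = fps_compose (fps_binomial 1) (u - 1)"
    using assms(2) by (simp add: v_def fps_compose_power[OF u0] fps_binomial_power)
  also have "\<dots> = u" using u0 by (simp add: fps_binomial_1 fps_compose_add_distrib)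
  finally show thesis by (intro that[of v]) (simp_all add: v_def)
qed

text \<open>
  If \<open>w = a / b\<close> in lowest terms, then \<open>a ^ n\<close> divides the numerator of \<open>z\<close> and \<open>b ^ n\<close> the denominator,
  whose degrees are too small for this unless \<open>a\<close> and \<open>b\<close> are constant.
\<close>

lemma power_in_field_imp_const:
  fixes z w :: "'a::field poly fract"
  assumes "z = Fract p q" "p \<noteq> 0" "q \<noteq> 0" "z = w ^ n" "degree p < n" "degree q < n"
  shows "\<exists>c. w = rat_const c"
proof -
  obtain a b where ab: "num_den w = (a, b)" by fastforce
  note nd = num_den[OF ab]
  have "Fract a b ^ n = Fract (a ^ n) (b ^ n)" for n
    by (induction n) (simp_all add: One_fract_def)
  then have eq: "p * b ^ n = a ^ n * q" using assms nd by (simp add: eq_fract)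
  have deg: "degree c = 0" if "c ^ n dvd f" "f \<noteq> 0" "degree f < n" for c f :: "'a poly"
  proof -
    have "c \<noteq> 0" using that by (cases n) auto
    then have "n * degree c \<le> degree f" using that(1,2) by (metis degree_power_eq dvd_imp_degree_le)
    then show ?thesis using that(3) by (cases "degree c") auto
  qed
  have ap: "a ^ n dvd p"
    using eq by (intro coprime_powers_dvd_mult[OF nd(3), of n p n]) auto
  have a: "degree a = 0" by (rule deg[OF ap assms(2,5)])
  have bq: "b ^ n dvd q"
  proof (rule coprime_powers_dvd_mult[of b a])
    show "coprime b a" using nd(3) by (simp add: coprime_commute)
    have "q * a ^ n = p * b ^ n" by (simp add: eq mult.commute)
    then show "b ^ n dvd q * a ^ n" by simp
  qed
  have "degree b = 0" by (rule deg[OF bq assms(3,6)])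
  with a obtain c d where "a = [:c:]" "b = [:d:]" by (metis degree_eq_zeroE)
  then have "w = rat_const (c / d)" using nd(1,2) by (simp add: rat_const_def eq_fract)
  then show ?thesis by blast
qed

lemma skew_fixes_const:
  assumes "skew_endomorphism \<phi>"
  shows "\<phi> (rat_const (fls_const c)) = rat_const (fls_const c)"
  using assms by (simp add: skew_endomorphism_def)

text \<open>
  The image of a series with constant term \<open>1\<close> has roots of all orders \<open>n\<close>, of the same kind. Its degrees in
  \<open>y\<close> and its order in \<open>x\<close> are therefore divisible by every \<open>n\<close>, so they vanish.
\<close>

lemma skew_unit_const:
  fixes \<phi> :: "'a::field_char_0 laurent_rat \<Rightarrow> 'a laurent_rat"
  assumes "skew_endomorphism \<phi>" "fps_nth u 0 = 1"
  shows "\<exists>c. \<phi> (rat_const (fps_to_fls u)) = rat_const c \<and> fls_subdegree c = 0"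
proof -
  have hom: "is_hom \<phi>" using assms(1) by (simp add: skew_endomorphism_def)
  define \<psi> where "\<psi> v = \<phi> (rat_const (fps_to_fls v))" for v
  have power: "\<psi> (v ^ n) = \<psi> v ^ n" for v n
    by (simp add: \<psi>_def fps_to_fls_power is_hom_simps[OF hom] is_hom_simps[OF is_hom_rat_const])
  have nz: "\<psi> v \<noteq> 0" if "fps_nth v 0 = 1" for v
  proof -
    have "v \<noteq> 0" using that by auto
    then show ?thesis by (simp add: \<psi>_def is_hom_eq_0_iff[OF hom] is_hom_eq_0_iff[OF is_hom_rat_const])
  qed
  have const: "\<exists>c. \<psi> v = rat_const c" if v: "fps_nth v 0 = 1" for v
  proof -
    obtain p q where pq: "\<psi> v = Fract p q" "q \<noteq> 0" by (cases "\<psi> v")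
    have p: "p \<noteq> 0" using nz[OF v] pq by (auto simp: Zero_fract_def eq_fract)
    \<comment> \<open>An order of root larger than both degrees, so that the root must be constant.\<close>
    define n where "n = degree p + degree q + 1"
    obtain u where u: "fps_nth u 0 = 1" "u ^ n = v" using unit_fps_root[OF v, of n] by (auto simp: n_def)
    have "\<exists>c. \<psi> u = rat_const c"
      by (rule power_in_field_imp_const[OF pq(1) p pq(2), of _ n])
        (simp_all add: power[symmetric] u(2), simp_all add: n_def)
    then obtain c where "\<psi> u = rat_const c" ..
    then have "\<psi> v = rat_const (c ^ n)"
      by (simp add: u(2)[symmetric] power is_hom_simps[OF is_hom_rat_const])
    then show ?thesis ..
  qed
  obtain c where c: "\<psi> u = rat_const c" using const[OF assms(2)] ..
  \<comment> \<open>A multiple of \<open>n\<close> of absolute value less than \<open>n\<close> is zero.\<close>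
  define n where "n = nat \<bar>fls_subdegree c\<bar> + 1"
  obtain v where v: "fps_nth v 0 = 1" "v ^ n = u" using unit_fps_root[OF assms(2), of n] by (auto simp: n_def)
  obtain d where d: "\<psi> v = rat_const d" using const[OF v(1)] ..
  have "rat_const c = rat_const (d ^ n)"
    using power[of v n] by (simp add: c d v(2) is_hom_simps[OF is_hom_rat_const])
  then have "c = d ^ n" by (simp add: is_hom_eq_iff[OF is_hom_rat_const])
  then have sub: "fls_subdegree c = int n * fls_subdegree d" by (simp add: fls_subdegree_pow)
  have "fls_subdegree c = 0"
  proof (cases "fls_subdegree d = 0")
    case False
    then have "int n * 1 \<le> int n * \<bar>fls_subdegree d\<bar>" by (intro mult_left_mono) auto
    then have "int n \<le> \<bar>fls_subdegree c\<bar>" by (simp add: sub abs_mult)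
    then show ?thesis by (simp add: n_def)
  qed (simp add: sub)
  then show ?thesis using c by (auto simp: \<psi>_def)
qed

text \<open>
  Subtracting a constant from \<open>k\<close>, which the endomorphism fixes, reduces the claim to series with
  constant term \<open>1\<close>.
\<close>

lemma skew_integral:
  fixes \<phi> :: "'a::field_char_0 laurent_rat \<Rightarrow> 'a laurent_rat"
  assumes "skew_endomorphism \<phi>"
  shows "\<exists>G. \<phi> (rat_const (fps_to_fls F)) = rat_const (fps_to_fls G)"
proof -
  have hom: "is_hom \<phi>" using assms(1) by (simp add: skew_endomorphism_def)
  note simps = is_hom_simps[OF hom] is_hom_simps[OF is_hom_rat_const]
  define k where "k = fps_nth F 0 - 1"
  define u where "u = F - fps_const k"
  have "fps_nth u 0 = 1" by (simp add: u_def k_def)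
  then obtain c where c: "\<phi> (rat_const (fps_to_fls u)) = rat_const c" "fls_subdegree c = 0"
    using skew_unit_const[OF assms] by blast
  have "fps_to_fls F = fps_to_fls u + fls_const k"
    by (simp add: u_def fps_const_to_fls)
  then have "\<phi> (rat_const (fps_to_fls F)) = rat_const (c + fls_const k)"
    by (simp add: simps c(1) skew_fixes_const[OF assms])
  also have "c + fls_const k = fps_to_fls (fls_regpart c + fps_const k)"
    using c(2) by (simp add: fps_const_to_fls)
  finally show ?thesis by blast
qed

text \<open>
  Let \<open>P\<close> be the image of \<open>x\<close>, and let \<open>D F\<close> be the difference between the image of \<open>F\<close> and \<open>F(P)\<close>. Splitting
  off the constant term, \<open>F = c + x * F'\<close>, gives \<open>D F = P * D F'\<close>. As all these differences are power
  series and \<open>P\<close> has no constant term, \<open>D F\<close> is divisible by arbitrarily high powers of \<open>x\<close>.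
\<close>

lemma skew_substitution:
  fixes \<phi> :: "'a::field_char_0 laurent_rat \<Rightarrow> 'a laurent_rat"
  assumes "skew_endomorphism \<phi>"
  shows "\<phi> (rat_const (fps_to_fls F)) = rat_const (fps_to_fls (fps_compose F (fls_regpart (skew_x \<phi>))))"
proof -
  have hom: "is_hom \<phi>" using assms(1) by (simp add: skew_endomorphism_def)
  note simps = is_hom_simps[OF hom] is_hom_simps[OF is_hom_rat_const]
  note x = skew_x[OF assms]
  define P where "P = fls_regpart (skew_x \<phi>)"
  have P: "skew_x \<phi> = fps_to_fls P" using x(2) by (simp add: P_def)
  have P0: "fps_nth P 0 = 0" using x(2) by (simp add: P_def fls_eq0_below_subdegree)
  obtain G where G: "\<And>F. \<phi> (rat_const (fps_to_fls F)) = rat_const (fps_to_fls (G F))"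
    using skew_integral[OF assms] by metis
  have rc: "rat_const a = rat_const b \<longleftrightarrow> a = b" for a b :: "'a fls"
    by (rule is_hom_eq_iff[OF is_hom_rat_const])
  have const: "G (fps_const c) = fps_const c" for c
    using G[of "fps_const c"] skew_fixes_const[OF assms, of c]
    by (metis rc fps_const_to_fls fps_to_fls_eq_iff)
  have rec: "G F - fps_compose F P = P * (G (fps_shift 1 F) - fps_compose (fps_shift 1 F) P)" for F
  proof -
    have F: "F = fps_const (fps_nth F 0) + fps_X * fps_shift 1 F"
      by (rule fps_ext) (simp add: fps_X_mult_nth)
    have "rat_const (fps_to_fls (G F)) = \<phi> (rat_const (fps_to_fls (fps_const (fps_nth F 0) + fps_X * fps_shift 1 F)))"
      by (simp only: G[symmetric] F[symmetric])
    also have "\<dots> = rat_const (fps_to_fls (fps_const (fps_nth F 0))) + rat_const (fps_to_fls P) * rat_const (fps_to_fls (G (fps_shift 1 F)))"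
      by (simp only: fps_to_fls_plus fls_times_fps_to_fls fps_X_to_fls simps x(1) P G const)
    also have "\<dots> = rat_const (fps_to_fls (fps_const (fps_nth F 0) + P * G (fps_shift 1 F)))"
      by (simp add: simps fls_times_fps_to_fls)
    finally have "G F = fps_const (fps_nth F 0) + P * G (fps_shift 1 F)"
      by (simp only: rc fps_to_fls_eq_iff)
    moreover have "fps_compose F P = fps_const (fps_nth F 0) + P * fps_compose (fps_shift 1 F) P"
      by (subst F) (simp add: fps_compose_add_distrib fps_compose_mult_distrib[OF P0] P0)
    ultimately show ?thesis by (simp add: algebra_simps)
  qed
  have zero: "fps_nth (G F - fps_compose F P) i = 0" if "i < N" for N i F
    using that
  proof (induction N arbitrary: i F)
    case (Suc N)
    have "fps_nth (G F - fps_compose F P) i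
        = (\<Sum>j=0..i. fps_nth P j * fps_nth (G (fps_shift 1 F) - fps_compose (fps_shift 1 F) P) (i - j))"
      unfolding rec[of F] fps_mult_nth ..
    also have "\<dots> = 0"
    proof (rule sum.neutral, rule ballI)
      fix j assume "j \<in> {0..i}"
      show "fps_nth P j * fps_nth (G (fps_shift 1 F) - fps_compose (fps_shift 1 F) P) (i - j) = 0"
      proof (cases "j = 0")
        case False
        then have "i - j < N" using Suc.prems \<open>j \<in> {0..i}\<close> by auto
        from Suc.IH[OF this, of "fps_shift 1 F"] show ?thesis by simp
      qed (simp add: P0)
    qed
    finally show ?case .
  qed simp
  have "G F - fps_compose F P = 0" by (rule fps_ext) (use zero in auto)
  then show ?thesis by (simp add: G P_def[symmetric])
qed

text \<open>
  A power series of order exactly \<open>1\<close> has a compositional inverse.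
\<close>

lemma skew_simple_surj_const:
  fixes \<phi> :: "'a::field_char_0 laurent_rat \<Rightarrow> 'a laurent_rat"
  assumes "skew_endomorphism \<phi>" "skew_simple \<phi>"
  shows "\<exists>f. \<phi> (rat_const f) = rat_const g"
proof -
  have hom: "is_hom \<phi>" using assms(1) by (simp add: skew_endomorphism_def)
  define P where "P = fls_regpart (skew_x \<phi>)"
  have sub: "fls_subdegree (skew_x \<phi>) = 1"
    using skew_x(2)[OF assms(1)] assms(2) by (simp add: skew_simple_def skew_order_def)
  then have "skew_x \<phi> \<noteq> 0" by auto
  then have P: "fps_nth P 0 = 0" "fps_nth P 1 \<noteq> 0"
    using sub nth_fls_subdegree_nonzero[of "skew_x \<phi>"] by (auto simp: P_def fls_eq0_below_subdegree)
  have inv0: "fps_nth (fps_inv P) 0 = 0" by (simp add: fps_inv_def)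
  have fps: "\<exists>f. \<phi> (rat_const f) = rat_const (fps_to_fls G)" for G
  proof -
    have "fps_compose (fps_compose G (fps_inv P)) P = G"
      by (simp add: fps_compose_assoc[OF P(1) inv0, symmetric] fps_inv[OF P])
    then show ?thesis
      using skew_substitution[OF assms(1), of "fps_compose G (fps_inv P)"] by (auto simp: P_def)
  qed
  show ?thesis
  proof (cases "fls_subdegree g \<ge> 0")
    case True
    then show ?thesis using fps[of "fls_regpart g"] by simp
  next
    case False
    then have "fls_subdegree (inverse g) \<ge> 0" by (cases "g = 0") auto
    then obtain f where "\<phi> (rat_const f) = rat_const (inverse g)"
      using fps[of "fls_regpart (inverse g)"] by auto
    then have "\<phi> (rat_const (inverse f)) = rat_const g"
      by (simp add: is_hom_inverse[OF hom] is_hom_inverse[OF is_hom_rat_const])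
    then show ?thesis by blast
  qed
qed

text \<open>
  Otherwise \<open>y\<close> and some element of \<open>k((x))\<close> would have the same image, although homomorphisms of
  fields are injective.
\<close>

lemma skew_simple_var_nonconstant:
  fixes \<phi> :: "'a::field_char_0 laurent_rat \<Rightarrow> 'a laurent_rat"
  assumes "skew_endomorphism \<phi>" "skew_simple \<phi>"
  shows "\<phi> rat_var \<noteq> rat_const g"
proof
  have hom: "is_hom \<phi>" using assms(1) by (simp add: skew_endomorphism_def)
  assume "\<phi> rat_var = rat_const g"
  moreover obtain f where "\<phi> (rat_const f) = rat_const g" using skew_simple_surj_const[OF assms] by blast
  ultimately have "rat_var = rat_const f" using is_hom_eq_iff[OF hom] by metis
  then show False using rat_var_neq_const by blast
qed

section \<open>Equivariance of simple skew products\<close>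

text \<open>
  Evaluation at the image of \<open>y\<close> is a homomorphism because that image is not constant: non-constancy of
  \<open>\<phi>(y)\<close> over \<open>k((x))\<close> carries over to the completed Puiseux series, and there it means transcendence.
\<close>

lemma skew_pullback_hom:
  fixes \<phi> :: "'a::field_char_0 laurent_rat \<Rightarrow> 'a laurent_rat"
  assumes "skew_endomorphism \<phi>" "compatible_roots (skew_lead \<phi>) \<Lambda>" "skew_simple \<phi>"
  shows "is_hom (skew_pullback \<phi> \<Lambda>)"
    "skew_pullback \<phi> \<Lambda> (rat_const c) = rat_const (skew_series \<phi> \<Lambda> c)"
    "skew_pullback \<phi> \<Lambda> rat_var = rat_eval (\<lambda>c. rat_const (cp_of_fls c)) rat_var (\<phi> rat_var)"
proof -
  have "rat_eval (\<lambda>c. rat_const (cp_of_fls c)) rat_var (\<phi> rat_var) \<noteq> rat_const c" for c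
    by (rule rat_map_nonconstant[OF is_hom_cp_of_fls skew_simple_var_nonconstant[OF assms(1,3)]])
  then show "is_hom (skew_pullback \<phi> \<Lambda>)"
    "skew_pullback \<phi> \<Lambda> (rat_const c) = rat_const (skew_series \<phi> \<Lambda> c)"
    "skew_pullback \<phi> \<Lambda> rat_var = rat_eval (\<lambda>c. rat_const (cp_of_fls c)) rat_var (\<phi> rat_var)"
    unfolding skew_pullback_def
    by (intro rat_eval_hom_nonconstant[OF is_hom_skew_series[OF assms(1,2)]]; simp)+
qed

lemma skew_product_simple:
  assumes "skew_simple \<phi>"
  shows "skew_product \<phi> \<Lambda> \<zeta> = (\<lambda>f. \<zeta> (skew_pullback \<phi> \<Lambda> f))"
proof
  fix f
  have "ennreal_powr t 1 = t" for t
    by (cases t) (simp_all add: ennreal_powr_def)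
  then show "skew_product \<phi> \<Lambda> \<zeta> f = \<zeta> (skew_pullback \<phi> \<Lambda> f)"
    using assms by (simp add: skew_product_def skew_scale_def skew_simple_def)
qed

text \<open>
  The axioms of a projective seminorm only mention field operations, which the pullback respects, and
  absolute values of constants, which it preserves for \<open>n = 1\<close>.
\<close>

lemma skew_product_berkovich_line:
  fixes \<phi> :: "'a::field_char_0 laurent_rat \<Rightarrow> 'a laurent_rat"
  assumes "0 < r" "r < 1" "skew_endomorphism \<phi>" "compatible_roots (skew_lead \<phi>) \<Lambda>" "skew_simple \<phi>"
    and "\<zeta> \<in> berkovich_line r"
  shows "skew_product \<phi> \<Lambda> \<zeta> \<in> berkovich_line r"
proof -
  note pb = skew_pullback_hom[OF assms(3-5)]
  have "projective_seminorm r \<zeta>" using assms(6) by (simp add: berkovich_line_eq[OF assms(1,2)])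
  then have "projective_seminorm r (\<lambda>f. \<zeta> (skew_pullback \<phi> \<Lambda> f))"
    by (simp add: projective_seminorm_def pb(2) is_hom_simps[OF pb(1)] is_hom_inverse[OF pb(1)]
        cp_abs_skew_series[OF assms(3-5)])
  then show ?thesis
    by (simp add: berkovich_line_eq[OF assms(1,2)] skew_product_simple[OF assms(5)])
qed

text \<open>
  Both sides pull back along endomorphisms of \<open>K(y)\<close>, which agree on constants because substitution
  commutes with twists, and on \<open>y\<close> because the image of \<open>y\<close> has coefficients in \<open>k((x))\<close>, the field that
  the Galois group fixes.
\<close>

lemma galois_act_skew_product:
  fixes \<phi> :: "'a::field_char_0 laurent_rat \<Rightarrow> 'a laurent_rat"
  assumes "skew_endomorphism \<phi>" "compatible_roots (skew_lead \<phi>) \<Lambda>" "skew_simple \<phi>"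
    and w: "root_character w"
  shows "skew_product \<phi> \<Lambda> (galois_act (cp_twist w) \<zeta>) = galois_act (cp_twist w) (skew_product \<phi> \<Lambda> \<zeta>)"
proof -
  note pb = skew_pullback_hom[OF assms(1-3)]
  note \<tau> = rat_map_hom(1-3)[OF is_hom_cp_twist[OF w]]
  note \<iota> = rat_map_hom(1-3)[OF is_hom_cp_of_fls]
  let ?\<tau> = "rat_eval (\<lambda>c. rat_const (cp_twist w c)) rat_var"
  let ?\<iota> = "rat_eval (\<lambda>c :: 'a fls. rat_const (cp_of_fls c)) rat_var"
  let ?\<Phi> = "skew_pullback \<phi> \<Lambda>"
  have fixed: "?\<tau> (?\<iota> g) = ?\<iota> g" for g
    by (rule rat_hom_eqI[OF is_hom_compose[OF \<tau>(1) \<iota>(1)] \<iota>(1)])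
      (simp_all add: \<iota> \<tau> cp_twist_cp_of_fls[OF w])
  have "?\<tau> (?\<Phi> f) = ?\<Phi> (?\<tau> f)" for f
    by (rule rat_hom_eqI[OF is_hom_compose[OF \<tau>(1) pb(1)] is_hom_compose[OF pb(1) \<tau>(1)]])
      (simp_all add: pb \<tau> fixed skew_series_twist[OF assms(1,3) w])
  then show ?thesis
    by (simp add: skew_product_simple[OF assms(3)] galois_act_def)
qed

text \<open>
  Acting by precomposition reverses the order of composition, which does not matter since characters
  commute.
\<close>

lemma galois_act_twist_twist:
  assumes "root_character v" "root_character w"
  shows "galois_act (cp_twist v) (galois_act (cp_twist w) \<zeta>) = galois_act (cp_twist (\<lambda>q. v q * w q)) \<zeta>"
proof -
  note v = rat_map_hom(1-3)[OF is_hom_cp_twist[OF assms(1)]]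
  note w = rat_map_hom(1-3)[OF is_hom_cp_twist[OF assms(2)]]
  note vw = rat_map_hom(1-3)[OF is_hom_cp_twist[OF root_character_mult[OF assms]]]
  have "rat_eval (\<lambda>c. rat_const (cp_twist w c)) rat_var (rat_eval (\<lambda>c. rat_const (cp_twist v c)) rat_var f)
      = rat_eval (\<lambda>c. rat_const (cp_twist (\<lambda>q. v q * w q) c)) rat_var f" for f
    by (rule rat_hom_eqI[OF is_hom_compose[OF w(1) v(1)] vw(1)])
      (simp_all add: v w vw cp_twist_twist mult.commute)
  then show ?thesis by (simp add: galois_act_def)
qed

lemma galois_orbit_eq:
  fixes \<zeta> :: "'a::alg_closed_field berkovich_point"
  assumes "0 < r" "r < 1"
  shows "galois_orbit r \<zeta> = (\<lambda>w. galois_act (cp_twist w) \<zeta>) ` {w. root_character w}"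
proof -
  have "(galois r :: ('a cpuiseux \<Rightarrow> 'a cpuiseux) set) = cp_twist ` {w. root_character w}"
  proof (intro equalityI subsetI)
    fix \<sigma> :: "'a cpuiseux \<Rightarrow> 'a cpuiseux" assume "\<sigma> \<in> galois r"
    then obtain w where "root_character w" "\<sigma> = cp_twist w" by (rule galois_cp_twist[OF assms])
    then show "\<sigma> \<in> cp_twist ` {w. root_character w}" by blast
  qed (auto intro: cp_twist_galois[OF assms])
  then show ?thesis by (simp add: galois_orbit_def image_image)
qed

text \<open>
  The permutations \<open>g\<close> carry fibres of \<open>F\<close> to fibres of \<open>F\<close>. By transitivity all fibres have the same size,
  and they partition \<open>A\<close>.
\<close>

lemma card_image_dvd_if_transitive:
  assumes "finite A"
    and trans: "\<And>x y. x \<in> A \<Longrightarrow> y \<in> A \<Longrightarrow>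
      \<exists>g. bij_betw g A A \<and> g x = y \<and> (\<forall>u\<in>A. \<forall>v\<in>A. F (g u) = F (g v) \<longleftrightarrow> F u = F v)"
  shows "card (F ` A) dvd card A"
proof (cases "A = {}")
  case False
  then obtain x where x: "x \<in> A" by blast
  define fibre where "fibre z = {u \<in> A. F u = z}" for z
  have "card (fibre z) = card (fibre (F x))" if z: "z \<in> F ` A" for z
  proof -
    obtain y where y: "y \<in> A" "z = F y" using z by blast
    obtain g where g: "bij_betw g A A" "g x = y" "\<And>u v. u \<in> A \<Longrightarrow> v \<in> A \<Longrightarrow> F (g u) = F (g v) \<longleftrightarrow> F u = F v"
      using trans[OF x y(1)] by blast
    have "g ` fibre (F x) = fibre z"
    proof
      show "g ` fibre (F x) \<subseteq> fibre z"
        using g(3)[OF _ x] bij_betwE[OF g(1)] by (auto simp: fibre_def y(2) g(2))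
      show "fibre z \<subseteq> g ` fibre (F x)"
      proof
        fix v assume v: "v \<in> fibre z"
        then obtain u where "u \<in> A" "v = g u"
          using bij_betw_imp_surj_on[OF g(1)] by (auto simp: fibre_def)
        then show "v \<in> g ` fibre (F x)"
          using v g(3)[OF _ x, of u] by (auto simp: fibre_def y(2) g(2))
      qed
    qed
    moreover have "inj_on g (fibre (F x))"
      using bij_betw_imp_inj_on[OF g(1)] by (rule inj_on_subset) (auto simp: fibre_def)
    ultimately show ?thesis by (metis card_image)
  qed
  then have "card (fibre (F x)) * card (fibre ` F ` A) = card (\<Union> (fibre ` F ` A))"
    by (intro card_partition) (auto simp: assms(1) fibre_def)
  also have "\<Union> (fibre ` F ` A) = A" by (auto simp: fibre_def)
  also have "card (fibre ` F ` A) = card (F ` A)"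
    by (rule card_image) (auto simp: inj_on_def fibre_def)
  finally show ?thesis by (metis dvd_triv_right)
qed simp

lemma galois_orbit_skew_product:
  fixes \<phi> :: "'a::{alg_closed_field, field_char_0} laurent_rat \<Rightarrow> 'a laurent_rat"
  assumes "0 < r" "r < 1" "skew_endomorphism \<phi>" "compatible_roots (skew_lead \<phi>) \<Lambda>" "skew_simple \<phi>"
  shows "skew_product \<phi> \<Lambda> ` galois_orbit r \<zeta> = galois_orbit r (skew_product \<phi> \<Lambda> \<zeta>)"
  unfolding galois_orbit_eq[OF assms(1,2)] image_image
  by (rule image_cong) (simp_all add: galois_act_skew_product[OF assms(3-5)])

text \<open>
  The point with character \<open>u\<close> in the orbit is carried to the point with character \<open>v\<close> by the twist with
  \<open>v / u\<close>. Twists permute the orbit, and by equivariance they respect the fibres of the skew product.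
\<close>

lemma card_galois_orbit_skew_product:
  fixes \<phi> :: "'a::{alg_closed_field, field_char_0} laurent_rat \<Rightarrow> 'a laurent_rat"
  assumes "0 < r" "r < 1" "skew_endomorphism \<phi>" "compatible_roots (skew_lead \<phi>) \<Lambda>" "skew_simple \<phi>"
    and "finite (galois_orbit r \<zeta>)"
  shows "card (galois_orbit r (skew_product \<phi> \<Lambda> \<zeta>)) dvd card (galois_orbit r \<zeta>)"
  unfolding galois_orbit_skew_product[OF assms(1-5), symmetric]
proof (rule card_image_dvd_if_transitive[OF assms(6)])
  let ?F = "skew_product \<phi> \<Lambda>" and ?O = "galois_orbit r \<zeta>"
  note orbit = galois_orbit_eq[OF assms(1,2)]
  note equiv = galois_act_skew_product[OF assms(3-5)]
  have inverse: "galois_act (cp_twist (\<lambda>q. inverse (w q))) (galois_act (cp_twist w) \<eta>) = \<eta>"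
    "galois_act (cp_twist w) (galois_act (cp_twist (\<lambda>q. inverse (w q))) \<eta>) = \<eta>"
    if w: "root_character w" for w and \<eta> :: "'a berkovich_point"
  proof -
    have "galois_act (cp_twist (\<lambda>_. 1)) \<eta> = \<eta>"
    proof -
      note one = rat_map_hom(1-3)[OF is_hom_cp_twist[OF root_character_1]]
      have "rat_eval (\<lambda>c. rat_const (cp_twist (\<lambda>_. 1) c)) rat_var f = (f :: 'a cpuiseux poly fract)" for f
        by (rule rat_hom_eqI[OF one(1), of "\<lambda>f. f"]) (use one(2,3) in \<open>simp_all add: is_hom_def\<close>)
      then show ?thesis by (simp add: galois_act_def)
    qed
    then show "galois_act (cp_twist (\<lambda>q. inverse (w q))) (galois_act (cp_twist w) \<eta>) = \<eta>"
      "galois_act (cp_twist w) (galois_act (cp_twist (\<lambda>q. inverse (w q))) \<eta>) = \<eta>"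
      using root_characterD(3)[OF w]
      by (simp_all add: galois_act_twist_twist w root_character_inverse)
  qed
  fix x y assume "x \<in> ?O" "y \<in> ?O"
  then obtain u v where u: "root_character u" "x = galois_act (cp_twist u) \<zeta>"
    and v: "root_character v" "y = galois_act (cp_twist v) \<zeta>"
    by (auto simp: orbit)
  define w where "w q = v q * inverse (u q)" for q
  have w: "root_character w"
    unfolding w_def by (intro root_character_mult root_character_inverse u v)
  let ?g = "galois_act (cp_twist w)" and ?h = "galois_act (cp_twist (\<lambda>q. inverse (w q)))"
  have stable: "galois_act (cp_twist c) \<eta> \<in> ?O" if c: "root_character c" and \<eta>: "\<eta> \<in> ?O" for c \<eta>
  proof -
    obtain d where d: "root_character d" "\<eta> = galois_act (cp_twist d) \<zeta>" using \<eta> by (auto simp: orbit)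
    show ?thesis
      unfolding d(2) galois_act_twist_twist[OF c d(1)] orbit using root_character_mult[OF c d(1)] by blast
  qed
  have "bij_betw ?g ?O ?O"
    by (rule bij_betw_byWitness[where f' = ?h])
      (auto simp: inverse[OF w] intro: stable[OF w] stable[OF root_character_inverse[OF w]])
  moreover have "?g x = y"
    unfolding u(2) v(2) galois_act_twist_twist[OF w u(1)]
    using root_characterD(3)[OF u(1)] by (simp add: w_def mult.assoc)
  moreover have "?F (?g a) = ?F (?g b) \<longleftrightarrow> ?F a = ?F b" for a b
    unfolding equiv[OF w] using inverse(1)[OF w] by metis
  ultimately show "\<exists>g. bij_betw g ?O ?O \<and> g x = y \<and> (\<forall>a\<in>?O. \<forall>b\<in>?O. ?F (g a) = ?F (g b) \<longleftrightarrow> ?F a = ?F b)"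
    by blast
qed

text \<open>
  If the orbit of \<open>\<zeta>\<close> is infinite, the claim holds because every non-zero element of \<^typ>\<open>enat\<close> divides
  \<open>\<infinity>\<close> and orbits are non-empty.
\<close>

lemma galois_multiplicity_skew_product:
  fixes \<phi> :: "'a::{alg_closed_field, field_char_0} laurent_rat \<Rightarrow> 'a laurent_rat"
  assumes "0 < r" "r < 1" "skew_endomorphism \<phi>" "compatible_roots (skew_lead \<phi>) \<Lambda>" "skew_simple \<phi>"
  shows "galois_multiplicity r (skew_product \<phi> \<Lambda> \<zeta>) dvd galois_multiplicity r \<zeta>"
proof (cases "finite (galois_orbit r \<zeta>)")
  case True
  then have "finite (galois_orbit r (skew_product \<phi> \<Lambda> \<zeta>))"
    unfolding galois_orbit_skew_product[OF assms, symmetric] by simp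
  moreover obtain k where "card (galois_orbit r \<zeta>) = card (galois_orbit r (skew_product \<phi> \<Lambda> \<zeta>)) * k"
    using card_galois_orbit_skew_product[OF assms True] by blast
  ultimately show ?thesis
    using True by (auto simp: galois_multiplicity_def simp flip: times_enat_simps(1))
next
  case False
  have "galois_orbit r \<eta> \<noteq> {}" for \<eta> :: "'a berkovich_point"
    using root_character_1 by (auto simp: galois_orbit_eq[OF assms(1,2)])
  then have "galois_multiplicity r (skew_product \<phi> \<Lambda> \<zeta>) \<noteq> 0"
    by (auto simp: galois_multiplicity_def zero_enat_def)
  then have "\<infinity> = galois_multiplicity r (skew_product \<phi> \<Lambda> \<zeta>) * \<infinity>"
    by (cases "galois_multiplicity r (skew_product \<phi> \<Lambda> \<zeta>)") (auto simp: zero_enat_def)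
  then show ?thesis using False by (metis dvd_triv_left galois_multiplicity_def)
qed

theorem theoremC:
  fixes \<phi> :: "'k::{alg_closed_field, field_char_0} fls poly fract \<Rightarrow> 'k fls poly fract"
    and \<Lambda> :: "nat \<Rightarrow> 'k" and r :: real
  assumes "0 < r" "r < 1"
    and "skew_endomorphism \<phi>" "compatible_roots (skew_lead \<phi>) \<Lambda>"
    and "skew_simple \<phi>"
  shows "(\<forall>\<zeta>\<in>berkovich_line r.
            galois_multiplicity r (skew_product \<phi> \<Lambda> \<zeta>) dvd galois_multiplicity r \<zeta>) \<and>
         (\<forall>m>0. skew_product \<phi> \<Lambda> ` multiplicity_locus r m \<subseteq> multiplicity_locus r m)"
proof (intro conjI ballI allI impI)
  show "galois_multiplicity r (skew_product \<phi> \<Lambda> \<zeta>) dvd galois_multiplicity r \<zeta>" for \<zeta>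
    by (rule galois_multiplicity_skew_product[OF assms])
  then show "skew_product \<phi> \<Lambda> ` multiplicity_locus r m \<subseteq> multiplicity_locus r m" for m
    using skew_product_berkovich_line[OF assms]
    by (auto simp: multiplicity_locus_def intro: dvd_trans)
qed

end
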